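(* Let $H\in(0,1/2)\cup(1/2,1)$, $T>0$ and $a<-T$. Let $S=(S(t))_{t\in[0,T]}$ be the sub-fractional Brownian motion with parameter $H$ given by $$S(t)=C_H\int_{-\infty}^{\infty}\left[((t-s)^+)^{H-1/2}+((t+s)^-)^{H-1/2}-2((-s)^+)^{H-1/2}\right]dB(s),$$ and, for $0<\beta<1/2$, let $S^{(n)}=W^{(n)}+Y^{(n)}$ be the transport-process approximation of $S$ defined in the context (it depends on $\beta$). Then for each $q>0$ and each $\beta$ such that $0<|H-1/2|<\beta<1/2$, there is a constant $C>0$ such that $$P\left(\sup_{0\le t\le T}|S(t)-S^{(n)}(t)|>Cn^{-(1/2-\beta)}(\log n)^{5/2}\right)=o(n^{-q})\quad\text{as } n\to\infty.$$
   Context: $B=(B(t))_{t\in\mathbb{R}}$ is a Brownian motion on the whole real line with $B(0)=0$. $x^+=\max(x,0)$, $x^-=\max(-x,0)$, and $(x^{\pm})^{H-1/2}$ is read as $0$ where $x^{\pm}=0$. $C_H>0$ is a constant depending only on $H$, chosen so that $E(S(s)S(t))=s^{2H}+t^{2H}-\frac12[(s+t)^{2H}+|s-t|^{2H}]$. The continuous version of $S$ is taken. Brownian motions constructed from $B$: $B_1$ is the restriction of $B$ to $[0,T]$; $B_2$ is the restriction of $B$ to $[a,0]$; $B_3(s)=sB(1/s)$ for $s\in[1/a,0)$ and $B_3(0)=0$. Transport processes: for $n\ge1$, a (uniform) transport process $(Z^{(n)}(t))_{t\ge0}$ is the position on the real line of a particle starting from $0$ with velocity $+n$ or $-n$, each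 with probability $1/2$, whose velocity changes sign at successive random times, the times between successive changes (and the first change time) being independent and exponentially distributed with parameter $n^2$. On an interval $[b,0]$ with $b<0$ the transport process is constructed going backwards in time, i.e. it is $s\mapsto Z^{(n)}(-s)$. Let $(Z_1^{(n)}(s))_{0\le s\le T}$, $(Z_2^{(n)}(s))_{a\le s\le0}$, $(Z_3^{(n)}(s))_{1/a\le s\le0}$ be transport processes on the same probability space as $B$ such that for each $i=1,2,3$ and each $q>0$ there is a constant $C^{(i)}>0$ with $$P\left(\sup_{t}|B_i(t)-Z_i^{(n)}(t)|>C^{(i)}n^{-1/2}(\log n)^{5/2}\right)=o(n^{-q})\quad\text{as }n\to\infty,$$ the supremum being over the interval where $B_i$ is defined (such processes exist). Integrals $dZ_i^{(n)}$ are pathwise Lebesgue–Stieltjes integrals (paths are piecewise linear). Functions, for $0\le t\le T$: $f_t(s)=(t-s)^{H-1/2}-(-s)^{H-1/2}$ for $s<0$; $g_t(s)=(t-s)^{H-1/2}$ for $s<t$; $F_t(s)=(-t-s)^{H-1/2}-(-s)^{H-1/2}$ for $s<-t$ (so $F_0=0$). $\partial_sf_t(1/v)$ and $\partial_sF_t(1/v)$ denote the derivatives of $f_t$ and $F_t$ evaluated at the point $1/v$. For $0<\beta<1/2$, $\varepsilon_n=-n^{-\beta/|H-1/2|}$. (Only large $n$ matter; one may assume $\varepsilon_n>\max(a,1/a)$.) $I_A$ is the indicator of $A$. Definition of $W^{(n)}$. If $H>1/2$, $$W^{(n)}(t)=C_H\Big\{\int_0^tg_t(s)dZ_1^{(n)}(s)+\int_a^0f_t(s)dZ_2^{(n)}(s)+f_t(a)Z_2^{(n)}(a)-\int_{1/a}^0\Big(-\int_{1/a}^{s\wedge\varepsilon_n}\partial_sf_t\Big(\frac1v\Big)\frac1{v^3}dv\Big)dZ_3^{(n)}(s)\Big\}.$$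 If $H<1/2$, $$W^{(n)}(t)=C_H\Big\{\int_0^{(t+\varepsilon_n)\vee0}g_t(s)dZ_1^{(n)}(s)+\int_{(t+\varepsilon_n)\vee0}^tg_t(\varepsilon_n+s)dZ_1^{(n)}(s)+\int_a^{\varepsilon_n}f_t(s)dZ_2^{(n)}(s)+f_t(a)Z_2^{(n)}(a)-\int_{1/a}^0\Big(-\int_{1/a}^{s}\partial_sf_t\Big(\frac1v\Big)\frac1{v^3}dv\Big)dZ_3^{(n)}(s)\Big\}.$$ Definition of $Y^{(n)}$. If $H>1/2$, $$Y^{(n)}(t)=C_H\Big\{-\int_{-t}^0(-s)^{H-1/2}dZ_2^{(n)}(s)+\int_a^{-t}F_t(s)dZ_2^{(n)}(s)+F_t(a)Z_2^{(n)}(a)-\int_{1/a}^0\Big(-\int_{1/a}^{[\varepsilon_n\vee(1/a)]\wedge s}\partial_sF_t\Big(\frac1v\Big)\frac1{v^3}dv\Big)dZ_3^{(n)}(s)\Big\}.$$ If $H<1/2$, $$Y^{(n)}(t)=C_H\Big\{-\int_{-t}^{\varepsilon_n\vee(-t)}(-s)^{H-1/2}dZ_2^{(n)}(s)-\int_{\varepsilon_n\vee(-t)}^0(-s-\varepsilon_n)^{H-1/2}dZ_2^{(n)}(s)+F_t(a)Z_2^{(n)}(a)$$ $$-\int_{1/a}^0\Big(-\int_{1/a}^{s}\partial_sF_t\Big(\frac1v\Big)\frac1{v^3}dv\Big)dZ_3^{(n)}(s)+\int_a^{a\vee(-t+\varepsilon_n)}F_t(s)dZ_2^{(n)}(s)+I_{\{-\varepsilon_n\le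 t\}}\int_{a\vee(-t+\varepsilon_n)}^{-t}F_{t+\varepsilon_n}(s)dZ_2^{(n)}(s)\Big\}.$$ *)

theory Defs
  imports "HOL-Probability.Probability" "HOL-Library.Landau_Symbols"
begin

section \<open>Brownian motion on the real line and the Wiener integral\<close>

locale two_sided_brownian_motion = prob_space M
  for M :: "'a measure" and B :: "real \<Rightarrow> 'a \<Rightarrow> real" +
  assumes measurable_B: "\<And>t. B t \<in> borel_measurable M"
    and B_zero: "\<And>\<omega>. \<omega> \<in> space M \<Longrightarrow> B 0 \<omega> = 0"
    and continuous_paths: "\<And>\<omega>. \<omega> \<in> space M \<Longrightarrow> continuous_on UNIV (\<lambda>t. B t \<omega>)"
    and normal_increments: "\<And>s t. s < t \<Longrightarrow>
          distributed M lborel (\<lambda>\<omega>. B t \<omega> - B s \<omega>) (normal_density 0 (sqrt (t - s)))"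
    and indep_increments: "\<And>ts :: real list. sorted_wrt (<) ts \<Longrightarrow>
          indep_vars (\<lambda>_. borel) (\<lambda>i \<omega>. B (ts ! Suc i) \<omega> - B (ts ! i) \<omega>) {..<length ts - 1}"

text \<open>A step function is given by a list of triples \<open>(c, l, u)\<close> with \<open>l \<le> u\<close>, each standing for
  \<open>c\<close> times the indicator of \<open>(l, u]\<close>.\<close>

definition step_fun :: "(real \<times> real \<times> real) list \<Rightarrow> real \<Rightarrow> real" where
  "step_fun p x = (\<Sum>(c, l, u)\<leftarrow>p. c * indicator {l<..u} x)"

definition step_integral ::
    "(real \<Rightarrow> 'a \<Rightarrow> real) \<Rightarrow> (real \<times> real \<times> real) list \<Rightarrow> 'a \<Rightarrow> real" where
  "step_integral B p \<omega> = (\<Sum>(c, l, u)\<leftarrow>p. c * (B u \<omega> - B l \<omega>))"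

text \<open>\<open>X\<close> is (a version of) the integral of the deterministic function \<open>k\<close> over the real line
  with respect to \<open>B\<close>: the mean square limit of the integrals of step functions that approximate
  \<open>k\<close> in \<open>L\<^sup>2\<close>. By the Ito isometry \<open>X\<close> is unique up to null sets, and it exists whenever
  \<open>k\<close> is square integrable.\<close>

definition has_wiener_integral ::
    "'a measure \<Rightarrow> (real \<Rightarrow> 'a \<Rightarrow> real) \<Rightarrow> (real \<Rightarrow> real) \<Rightarrow> ('a \<Rightarrow> real) \<Rightarrow> bool" where
  "has_wiener_integral M B k X \<longleftrightarrow>
     k \<in> borel_measurable borel \<and> X \<in> borel_measurable M \<and>
     (\<exists>p :: nat \<Rightarrow> (real \<times> real \<times> real) list.
        (\<forall>m. \<forall>(c, l, u) \<in> set (p m). l \<le> u) \<and>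
        (\<lambda>m. \<integral>\<^sup>+ x. ennreal ((k x - step_fun (p m) x)\<^sup>2) \<partial>lborel) \<longlonglongrightarrow> 0 \<and>
        (\<lambda>m. \<integral>\<^sup>+ \<omega>. ennreal ((X \<omega> - step_integral B (p m) \<omega>)\<^sup>2) \<partial>M) \<longlonglongrightarrow> 0)"


section \<open>Sub-fractional Brownian motion\<close>

text \<open>Here \<open>0 powr x = 0\<close> for every \<open>x\<close>, which is the convention required when \<open>H < 1/2\<close>.\<close>

definition subfbm_kernel :: "real \<Rightarrow> real \<Rightarrow> real \<Rightarrow> real" where
  "subfbm_kernel H t s =
     max (t - s) 0 powr (H - 1/2) + max (- (t + s)) 0 powr (H - 1/2)
       - 2 * max (- s) 0 powr (H - 1/2)"

text \<open>\<open>S\<close> is a continuous version on \<open>[0, T]\<close> of \<open>C\<close> times the Wiener integral of the kernel.\<close>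

definition subfbm_version ::
    "'a measure \<Rightarrow> (real \<Rightarrow> 'a \<Rightarrow> real) \<Rightarrow> real \<Rightarrow> real \<Rightarrow> real \<Rightarrow> (real \<Rightarrow> 'a \<Rightarrow> real) \<Rightarrow> bool" where
  "subfbm_version M B H C T S \<longleftrightarrow>
     (\<forall>t\<in>{0..T}. S t \<in> borel_measurable M \<and>
        (\<exists>X. has_wiener_integral M B (subfbm_kernel H t) X \<and> (AE \<omega> in M. S t \<omega> = C * X \<omega>))) \<and>
     (\<forall>\<omega>\<in>space M. continuous_on {0..T} (\<lambda>t. S t \<omega>))"


section \<open>Transport processes\<close>

text \<open>\<open>\<xi>\<close> is the sign of the initial velocity and \<open>\<tau> 0, \<tau> 1, \<dots>\<close> are the times between successive
  velocity changes, so that the \<open>k\<close>-th change (counting from 0) happens at time \<open>\<tau> 0 + \<dots> + \<tau> k\<close>.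
  No independence between \<open>\<xi>\<close> and \<open>\<tau>\<close> is required. Almost surely only finitely many changes
  happen up to any given time; otherwise \<open>card\<close> yields 0, and \<open>Z\<close> is still Lipschitz.\<close>

definition transport_velocity :: "nat \<Rightarrow> real \<Rightarrow> (nat \<Rightarrow> real) \<Rightarrow> real \<Rightarrow> real" where
  "transport_velocity n x r u = x * real n * (- 1) ^ card {k. (\<Sum>j\<le>k. r j) \<le> u}"

definition transport_process :: "'a measure \<Rightarrow> nat \<Rightarrow> (real \<Rightarrow> 'a \<Rightarrow> real) \<Rightarrow> bool" where
  "transport_process M n Z \<longleftrightarrow>
     (\<exists>(\<xi> :: 'a \<Rightarrow> real) (\<tau> :: nat \<Rightarrow> 'a \<Rightarrow> real).
        \<xi> \<in> borel_measurable M \<and> (\<forall>\<omega>\<in>space M. \<xi> \<omega> \<in> {- 1, 1}) \<and>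
        measure M {\<omega>\<in>space M. \<xi> \<omega> = 1} = 1/2 \<and> measure M {\<omega>\<in>space M. \<xi> \<omega> = - 1} = 1/2 \<and>
        prob_space.indep_vars M (\<lambda>_. borel) \<tau> UNIV \<and>
        (\<forall>k. distributed M lborel (\<tau> k) (exponential_density ((real n)\<^sup>2))) \<and>
        (\<forall>\<omega>\<in>space M. \<forall>t\<ge>0.
           Z t \<omega> = (LBINT u=0..t. transport_velocity n (\<xi> \<omega>) (\<lambda>k. \<tau> k \<omega>) u)))"


section \<open>Lebesgue--Stieltjes integrals\<close>

definition total_variation :: "(real \<Rightarrow> real) \<Rightarrow> real \<Rightarrow> real \<Rightarrow> real" where
  "total_variation G l u =
     (SUP (N, p) \<in> {(N :: nat, p :: nat \<Rightarrow> real). mono p \<and> range p \<subseteq> {l..u}}.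
        \<Sum>i<N. \<bar>G (p (Suc i)) - G (p i)\<bar>)"

text \<open>The integral of \<open>h\<close> over \<open>(l, u]\<close> with respect to \<open>dG\<close>, for \<open>G\<close> right-continuous and of
  bounded variation on \<open>[l, u]\<close>, through the Jordan decomposition of \<open>G\<close> into its positive and
  negative variation (up to additive constants, which do not matter). The integrators are
  extended by constants outside \<open>[l, u]\<close>. The integral is 0 if \<open>u \<le> l\<close>.\<close>

definition ls_integral :: "real \<Rightarrow> real \<Rightarrow> (real \<Rightarrow> real) \<Rightarrow> (real \<Rightarrow> real) \<Rightarrow> real" where
  "ls_integral l u h G =
     (let c = (\<lambda>x. max l (min u x));
          P = (\<lambda>x. (total_variation G l (c x) + G (c x)) / 2);
          N = (\<lambda>x. (total_variation G l (c x) - G (c x)) / 2)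
      in (LINT x:{l<..u}|interval_measure P. h x) - (LINT x:{l<..u}|interval_measure N. h x))"


section \<open>The approximating process\<close>

text \<open>The formulas for \<open>f_fun\<close>, \<open>g_fun\<close>, \<open>F_fun\<close> are meant for \<open>s < 0\<close>, \<open>s < t\<close> and \<open>s < -t\<close>.\<close>

definition f_fun :: "real \<Rightarrow> real \<Rightarrow> real \<Rightarrow> real" where
  "f_fun H t s = (t - s) powr (H - 1/2) - (- s) powr (H - 1/2)"

definition g_fun :: "real \<Rightarrow> real \<Rightarrow> real \<Rightarrow> real" where
  "g_fun H t s = (t - s) powr (H - 1/2)"

definition F_fun :: "real \<Rightarrow> real \<Rightarrow> real \<Rightarrow> real" where
  "F_fun H t s = (- t - s) powr (H - 1/2) - (- s) powr (H - 1/2)"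

definition inv_integral :: "(real \<Rightarrow> real) \<Rightarrow> real \<Rightarrow> real \<Rightarrow> real" where
  "inv_integral K l s = (LBINT v=l..s. deriv K (1 / v) * (1 / v ^ 3))"

definition eps :: "real \<Rightarrow> real \<Rightarrow> nat \<Rightarrow> real" where
  "eps H \<beta> n = - (real n powr (- \<beta> / \<bar>H - 1/2\<bar>))"

text \<open>In the two definitions below \<open>C\<close> is the normalising constant, \<open>e\<close> stands for \<open>eps H \<beta> n\<close>, and
  \<open>z1, z2, z3\<close> are paths of the three transport processes. For \<open>e\<close> close to 0 the bounds of all
  integrals are in increasing order.\<close>

definition W_approx ::
    "real \<Rightarrow> real \<Rightarrow> real \<Rightarrow> real \<Rightarrow> (real \<Rightarrow> real) \<Rightarrow> (real \<Rightarrow> real) \<Rightarrow> (real \<Rightarrow> real) \<Rightarrow> real \<Rightarrow> real" where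
  "W_approx C H a e z1 z2 z3 t =
     (if H > 1/2 then
        C * (ls_integral 0 t (g_fun H t) z1
             + ls_integral a 0 (f_fun H t) z2
             + f_fun H t a * z2 a
             - ls_integral (1/a) 0 (\<lambda>s. - inv_integral (f_fun H t) (1/a) (min s e)) z3)
      else
        C * (ls_integral 0 (max (t + e) 0) (g_fun H t) z1
             + ls_integral (max (t + e) 0) t (\<lambda>s. g_fun H t (e + s)) z1
             + ls_integral a e (f_fun H t) z2
             + f_fun H t a * z2 a
             - ls_integral (1/a) 0 (\<lambda>s. - inv_integral (f_fun H t) (1/a) s) z3))"

definition Y_approx ::
    "real \<Rightarrow> real \<Rightarrow> real \<Rightarrow> real \<Rightarrow> (real \<Rightarrow> real) \<Rightarrow> (real \<Rightarrow> real) \<Rightarrow> real \<Rightarrow> real" where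
  "Y_approx C H a e z2 z3 t =
     (if H > 1/2 then
        C * (- ls_integral (- t) 0 (\<lambda>s. (- s) powr (H - 1/2)) z2
             + ls_integral a (- t) (F_fun H t) z2
             + F_fun H t a * z2 a
             - ls_integral (1/a) 0
                 (\<lambda>s. - inv_integral (F_fun H t) (1/a) (min (max e (1/a)) s)) z3)
      else
        C * (- ls_integral (- t) (max e (- t)) (\<lambda>s. (- s) powr (H - 1/2)) z2
             - ls_integral (max e (- t)) 0 (\<lambda>s. (- s - e) powr (H - 1/2)) z2
             + F_fun H t a * z2 a
             - ls_integral (1/a) 0 (\<lambda>s. - inv_integral (F_fun H t) (1/a) s) z3
             + ls_integral a (max a (- t + e)) (F_fun H t) z2
             + (if - e \<le> t
                then ls_integral (max a (- t + e)) (- t) (F_fun H (t + e)) z2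
                else 0)))"

definition S_approx ::
    "real \<Rightarrow> real \<Rightarrow> real \<Rightarrow> real \<Rightarrow> (nat \<Rightarrow> real \<Rightarrow> 'a \<Rightarrow> real) \<Rightarrow> (nat \<Rightarrow> real \<Rightarrow> 'a \<Rightarrow> real) \<Rightarrow>
      (nat \<Rightarrow> real \<Rightarrow> 'a \<Rightarrow> real) \<Rightarrow> nat \<Rightarrow> real \<Rightarrow> 'a \<Rightarrow> real" where
  "S_approx C H a \<beta> Z1 Z2 Z3 n t \<omega> =
     W_approx C H a (eps H \<beta> n) (\<lambda>s. Z1 n s \<omega>) (\<lambda>s. Z2 n s \<omega>) (\<lambda>s. Z3 n s \<omega>) t
     + Y_approx C H a (eps H \<beta> n) (\<lambda>s. Z2 n s \<omega>) (\<lambda>s. Z3 n s \<omega>) t"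


section \<open>Rates of uniform approximation\<close>

definition brownian_inversion :: "(real \<Rightarrow> 'a \<Rightarrow> real) \<Rightarrow> real \<Rightarrow> 'a \<Rightarrow> real" where
  "brownian_inversion B s \<omega> = (if s = 0 then 0 else s * B (1 / s) \<omega>)"

text \<open>The supremum is taken in the extended reals, so that it is meaningful for unbounded
  differences as well.\<close>

definition sup_exceed_prob ::
    "'a measure \<Rightarrow> real set \<Rightarrow> (real \<Rightarrow> 'a \<Rightarrow> real) \<Rightarrow> (real \<Rightarrow> 'a \<Rightarrow> real) \<Rightarrow> real \<Rightarrow> real" where
  "sup_exceed_prob M I X Y c =
     measure M {\<omega>\<in>space M. (SUP t\<in>I. ereal \<bar>X t \<omega> - Y t \<omega>\<bar>) > ereal c}"

definition transport_rate ::
    "'a measure \<Rightarrow> real set \<Rightarrow> (real \<Rightarrow> 'a \<Rightarrow> real) \<Rightarrow> (nat \<Rightarrow> real \<Rightarrow> 'a \<Rightarrow> real) \<Rightarrow> bool" where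
  "transport_rate M I X Z \<longleftrightarrow>
     (\<forall>q>0. \<exists>C>0.
        (\<lambda>n. sup_exceed_prob M I X (Z n) (C * real n powr (- 1/2) * ln (real n) powr (5/2)))
          \<in> o(\<lambda>n. real n powr (- q)))"

end

theory Submission
  imports Defs
begin

text \<open>Write \<open>al = H - 1/2\<close>. Integration by parts turns the Wiener integral of the kernel into
  an explicit functional of the path of \<open>B\<close>, a sum of integrals of increments \<open>B u - B (u - x)\<close>
  against \<open>x powr (al - 1)\<close> and, in the coordinate \<open>x = - 1 / s\<close>, of one tail integral near minus
  infinity. That this functional is the Wiener integral follows from the Ito isometry alone: both
  \<open>E ((B u - B l) * (B u' - B l'))\<close> and the scalar product of the indicators of \<open>(l, u]\<close> and
  \<open>(l', u']\<close> are obtained from squares by the same polarization, and Fubini extends the equality to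
  superpositions of increments. The approximating process is the same functional of the transport
  processes with the singularities truncated at distance \<open>e = n powr (- \<beta> / \<bar>al\<bar>)\<close>. The truncated
  kernels have total variation of order \<open>e powr (- \<bar>al\<bar>) = n powr \<beta>\<close>, so exchanging \<open>B\<close> and the
  transport processes costs \<open>n powr (\<beta> - 1/2) * (log n) powr (5/2)\<close>; on paths with Hoelder constant
  \<open>K\<close> of order \<open>g < 1/2\<close> the truncation costs \<open>K * e powr (g - \<bar>al\<bar>)\<close>. As \<open>\<bar>al\<bar> < \<beta>\<close>, the latter is
  of order \<open>n powr (\<beta> - 1/2)\<close> for suitable \<open>g\<close> and \<open>K\<close> a small power of \<open>n\<close>, and the Hoelder
  constant exceeds such a power with a probability smaller than any power of \<open>1 / n\<close>.\<close>

section \<open>Superpositions of increments and the Ito isometry\<close>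

text \<open>The Wiener integral is a mean square limit, known for each \<open>t\<close> only up to a
  null set, whereas the error is a supremum over \<open>t\<close> along one path. The explicit
  functional removes this obstacle: on a regular path it is continuous in \<open>t\<close> on
  \<open>(0, T]\<close>, so that one null set serves all times and every later estimate concerns a
  single Hoelder path. Increments are taken from the singular end of each kernel, because only there
  does their Hoelder exponent offset the singularity. The sign of \<open>al\<close> decides where
  truncation occurs: for \<open>al < 0\<close> at the finite singularities \<open>t\<close>,
  \<open>0\<close> and \<open>- t\<close>; for \<open>al > 0\<close> only in the tail, where a
  density of order \<open>x powr (- al)\<close> meets the factor \<open>1 / x\<close> of time
  inversion. The exponents are balanced exactly: with \<open>K\<close> of order
  \<open>n powr eta\<close>, the cost \<open>K * e powr (g - \<bar>al\<bar>)\<close> is of order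
  \<open>n powr (\<beta> - 1/2)\<close> for \<open>eta = g * \<beta> / \<bar>al\<bar> - 1/2\<close>.
  This is positive iff \<open>g > \<bar>al\<bar> / (2 * \<beta>)\<close>, and such a
  \<open>g < 1/2\<close> exists precisely because \<open>\<bar>al\<bar> < \<beta>\<close>.\<close>

lemma integral_abs_mult_le_sqrt:
  fixes X Y :: "'n \<Rightarrow> real"
  assumes X[measurable]: "X \<in> borel_measurable N" and Y[measurable]: "Y \<in> borel_measurable N"
    and "integrable N (\<lambda>w. (X w)\<^sup>2)" "integrable N (\<lambda>w. (Y w)\<^sup>2)"
  shows "integrable N (\<lambda>w. X w * Y w)"
    and "(\<integral>w. \<bar>X w * Y w\<bar> \<partial>N) \<le> sqrt (\<integral>w. (X w)\<^sup>2 \<partial>N) * sqrt (\<integral>w. (Y w)\<^sup>2 \<partial>N)"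
proof -
  let ?p = "\<integral>w. (X w)\<^sup>2 \<partial>N" and ?q = "\<integral>w. (Y w)\<^sup>2 \<partial>N"
  have b: "norm (X w * Y w) \<le> norm ((X w)\<^sup>2 + (Y w)\<^sup>2)" for w
  proof -
    have "0 \<le> (\<bar>X w\<bar> - \<bar>Y w\<bar>)\<^sup>2" "0 \<le> \<bar>X w\<bar> * \<bar>Y w\<bar>" "norm (X w * Y w) = \<bar>X w\<bar> * \<bar>Y w\<bar>" by (simp_all add: abs_mult)
    then show ?thesis by (simp add: power2_diff)
  qed
  show int: "integrable N (\<lambda>w. X w * Y w)"
    by (rule Bochner_Integration.integrable_bound[of N "\<lambda>w. (X w)\<^sup>2 + (Y w)\<^sup>2"]) (use assms b in auto)
  have "(\<integral>\<^sup>+w. ennreal \<bar>X w\<bar> * ennreal \<bar>Y w\<bar> \<partial>N)\<^sup>2 \<le> (\<integral>\<^sup>+w. ennreal \<bar>X w\<bar> ^ 2 \<partial>N) * (\<integral>\<^sup>+w. ennreal \<bar>Y w\<bar> ^ 2 \<partial>N)"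
    by (rule Cauchy_Schwarz_nn_integral) auto
  also have "(\<integral>\<^sup>+w. ennreal \<bar>X w\<bar> ^ 2 \<partial>N) = ennreal ?p"
    using assms by (simp add: ennreal_power nn_integral_eq_integral)
  also have "(\<integral>\<^sup>+w. ennreal \<bar>Y w\<bar> ^ 2 \<partial>N) = ennreal ?q"
    using assms by (simp add: ennreal_power nn_integral_eq_integral)
  also have "(\<integral>\<^sup>+w. ennreal \<bar>X w\<bar> * ennreal \<bar>Y w\<bar> \<partial>N) = ennreal (\<integral>w. \<bar>X w * Y w\<bar> \<partial>N)"
    using int by (simp add: ennreal_mult[symmetric] abs_mult[symmetric] nn_integral_eq_integral)
  finally have "(\<integral>w. \<bar>X w * Y w\<bar> \<partial>N)\<^sup>2 \<le> ?p * ?q"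
    by (simp add: ennreal_power ennreal_mult[symmetric] ennreal_le_iff)
  then show "(\<integral>w. \<bar>X w * Y w\<bar> \<partial>N) \<le> sqrt ?p * sqrt ?q"
    by (simp add: real_le_rsqrt real_sqrt_mult[symmetric])
qed

text \<open>Fubini on the product of the parameter plane with \<open>N\<close>. Cauchy-Schwarz for
  fixed parameters \<open>(r, s)\<close> gives the majorant \<open>\<bar>h r\<bar> * sqrt (p r) *
  (\<bar>k s\<bar> * sqrt (q s))\<close>, a product of integrable functions; hence the integrability
  conditions on the weighted square roots of the second moments.\<close>

lemma integral_mult_superposition:
  fixes X Y :: "'n \<Rightarrow> real \<Rightarrow> real" and h k p q :: "real \<Rightarrow> real"
  assumes N: "sigma_finite_measure N"
    and X[measurable]: "case_prod X \<in> borel_measurable (N \<Otimes>\<^sub>M lborel)"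
    and Y[measurable]: "case_prod Y \<in> borel_measurable (N \<Otimes>\<^sub>M lborel)"
    and h[measurable]: "h \<in> borel_measurable borel" and k[measurable]: "k \<in> borel_measurable borel"
    and p: "\<And>r. has_bochner_integral N (\<lambda>w. (X w r)\<^sup>2) (p r)"
    and q: "\<And>r. has_bochner_integral N (\<lambda>w. (Y w r)\<^sup>2) (q r)"
    and hp: "integrable lborel (\<lambda>r. h r * sqrt (p r))"
    and kq: "integrable lborel (\<lambda>r. k r * sqrt (q r))"
  shows "has_bochner_integral N (\<lambda>w. (\<integral>r. h r * X w r \<partial>lborel) * (\<integral>r. k r * Y w r \<partial>lborel))
     (\<integral>z. h (fst z) * k (snd z) * (\<integral>w. X w (fst z) * Y w (snd z) \<partial>N) \<partial>(lborel \<Otimes>\<^sub>M lborel))"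
proof -
  interpret N: sigma_finite_measure N by fact

  let ?L = "lborel \<Otimes>\<^sub>M lborel :: (real \<times> real) measure"
  interpret LN: pair_sigma_finite ?L N ..
  define F where "F = (\<lambda>(z, w). h (fst z) * k (snd z) * (X w (fst z) * Y w (snd z)))"
  have X'[measurable]: "(\<lambda>(z, w). X w (fst z)) \<in> borel_measurable (?L \<Otimes>\<^sub>M N)"
    using measurable_compose[OF _ X, of "\<lambda>(z, w). (w, fst z)" "?L \<Otimes>\<^sub>M N"] by (simp add: case_prod_beta)
  have Y'[measurable]: "(\<lambda>(z, w). Y w (snd z)) \<in> borel_measurable (?L \<Otimes>\<^sub>M N)"
    using measurable_compose[OF _ Y, of "\<lambda>(z, w). (w, snd z)" "?L \<Otimes>\<^sub>M N"] by (simp add: case_prod_beta)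
  have F[measurable]: "F \<in> borel_measurable (?L \<Otimes>\<^sub>M N)"
    unfolding F_def by measurable
  have Xr[measurable]: "(\<lambda>w. X w r) \<in> borel_measurable N" for r
    using measurable_compose[OF _ X, of "\<lambda>w. (w, r)" N] by simp
  have Yr[measurable]: "(\<lambda>w. Y w r) \<in> borel_measurable N" for r
    using measurable_compose[OF _ Y, of "\<lambda>w. (w, r)" N] by simp
  have CS: "integrable N (\<lambda>w. X w r * Y w s)"
    "(\<integral>w. \<bar>X w r * Y w s\<bar> \<partial>N) \<le> sqrt (p r) * sqrt (q s)" for r s
    using integral_abs_mult_le_sqrt[OF Xr Yr, of r s] p[of r] q[of s]
    by (auto simp: has_bochner_integral_iff)
  have prod: "integrable ?L (\<lambda>(r, s). (h r * sqrt (p r)) * (k s * sqrt (q s)))"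
  proof (rule lborel_pair.Fubini_integrable)
    show "(\<lambda>(r, s). (h r * sqrt (p r)) * (k s * sqrt (q s))) \<in> borel_measurable ?L"
      using borel_measurable_integrable[OF hp] borel_measurable_integrable[OF kq] by measurable
    have eq: "norm (case (x, y) of (r, s) \<Rightarrow> h r * sqrt (p r) * (k s * sqrt (q s))) =
      norm (h x * sqrt (p x)) * norm (k y * sqrt (q y))" for x y
      by (simp add: abs_mult)
    show "integrable lborel
      (\<lambda>x. \<integral> y. norm (case (x, y) of (r, s) \<Rightarrow> h r * sqrt (p r) * (k s * sqrt (q s))) \<partial>lborel)"
      using integrable_norm[OF hp] unfolding eq by (simp del: real_norm_def)
    show "AE x in lborel. integrable lborel (\<lambda>y. case (x, y) of (r, s) \<Rightarrow> h r * sqrt (p r) * (k s * sqrt (q s)))"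
      using kq by simp
  qed
  have Fi: "integrable (?L \<Otimes>\<^sub>M N) F"
  proof (rule LN.Fubini_integrable)
    show "integrable ?L (\<lambda>z. \<integral>w. norm (F (z, w)) \<partial>N)"
    proof (rule Bochner_Integration.integrable_bound[OF prod])
      show "AE z in ?L. norm (\<integral>w. norm (F (z, w)) \<partial>N)
        \<le> norm (case z of (r, s) \<Rightarrow> (h r * sqrt (p r)) * (k s * sqrt (q s)))"
      proof (rule AE_I2, safe)
        fix r s :: real
        have "0 \<le> (\<integral>w. (X w r)\<^sup>2 \<partial>N)" "0 \<le> (\<integral>w. (Y w s)\<^sup>2 \<partial>N)" by simp_all
        then have "0 \<le> p r" "0 \<le> q s"
          using p[of r] q[of s] by (simp_all only: has_bochner_integral_iff)
        moreover have "(\<integral>w. norm (F ((r, s), w)) \<partial>N) = \<bar>h r * k s\<bar> * (\<integral>w. \<bar>X w r * Y w s\<bar> \<partial>N)"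
          by (simp add: F_def abs_mult)
        moreover have "0 \<le> (\<integral>w. \<bar>X w r * Y w s\<bar> \<partial>N)" by simp
        ultimately show "norm (\<integral>w. norm (F ((r, s), w)) \<partial>N)
          \<le> norm ((h r * sqrt (p r)) * (k s * sqrt (q s)))"
          using mult_left_mono[OF CS(2)[of r s], of "\<bar>h r * k s\<bar>"] by (simp add: abs_mult mult_ac)
      qed
    qed measurable
    show "AE z in ?L. integrable N (\<lambda>w. F (z, w))"
      using CS by (auto simp: F_def)
  qed measurable
  have meas: "(\<lambda>w. (\<integral>r. h r * X w r \<partial>lborel) * (\<integral>r. k r * Y w r \<partial>lborel)) \<in> borel_measurable N"
  proof -
    have "(\<lambda>w. \<integral>r. h r * X w r \<partial>lborel) \<in> borel_measurable N"
      "(\<lambda>w. \<integral>r. k r * Y w r \<partial>lborel) \<in> borel_measurable N"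
      by (rule lborel.borel_measurable_lebesgue_integral, measurable)+
    then show ?thesis by simp
  qed
  \<comment> \<open>Constants leave a Bochner integral unconditionally, so the factorization follows
    from integrability of \<open>F (z, w)\<close> in \<open>z\<close> alone, which holds for almost
    every \<open>w\<close>.\<close>
  have fac: "(\<integral>z. F (z, w) \<partial>?L) = (\<integral>r. h r * X w r \<partial>lborel) * (\<integral>r. k r * Y w r \<partial>lborel)"
    if "integrable ?L (\<lambda>z. F (z, w))" for w
  proof -
    have "(\<integral>z. F (z, w) \<partial>?L) = (\<integral>r. (\<integral>s. F ((r, s), w) \<partial>lborel) \<partial>lborel)"
      by (rule lborel_pair.integral_fst'[OF that, symmetric])
    also have "\<dots> = (\<integral>r. (\<integral>s. (h r * X w r) * (k s * Y w s) \<partial>lborel) \<partial>lborel)"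
      by (simp add: F_def mult_ac)
    finally show ?thesis by simp
  qed
  have ae: "AE w in N. (\<integral>z. F (z, w) \<partial>?L) = (\<integral>r. h r * X w r \<partial>lborel) * (\<integral>r. k r * Y w r \<partial>lborel)"
  proof -
    have "integrable (?L \<Otimes>\<^sub>M N) (case_prod (\<lambda>z w. F (z, w)))" using Fi by simp
    from LN.AE_integrable_snd[OF this] show ?thesis by eventually_elim (rule fac)
  qed
  have i1: "integrable N (\<lambda>w. \<integral>z. F (z, w) \<partial>?L)"
    using LN.integrable_snd[of "\<lambda>z w. F (z, w)"] Fi by simp
  have "integrable N (\<lambda>w. (\<integral>r. h r * X w r \<partial>lborel) * (\<integral>r. k r * Y w r \<partial>lborel))"
    using integrable_cong_AE[OF _ meas ae] i1 by auto
  moreover have "(\<integral>w. (\<integral>r. h r * X w r \<partial>lborel) * (\<integral>r. k r * Y w r \<partial>lborel) \<partial>N) = (\<integral>w. (\<integral>z. F (z, w) \<partial>?L) \<partial>N)"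
    using integral_cong_AE[OF _ meas ae] i1 by auto
  moreover have "\<dots> = (\<integral>z. (\<integral>w. F (z, w) \<partial>N) \<partial>?L)"
    using LN.Fubini_integral[of "\<lambda>z w. F (z, w)"] Fi by simp
  moreover have "\<dots> = (\<integral>z. h (fst z) * k (snd z) * (\<integral>w. X w (fst z) * Y w (snd z) \<partial>N) \<partial>?L)"
    by (simp add: F_def)
  ultimately show ?thesis by (simp add: has_bochner_integral_iff)
qed


text \<open>\<open>(h, l, u)\<close> stands for the superposition of the intervals \<open>(l r, u r]\<close> with weights \<open>h r\<close>.\<close>

type_synonym weighted_intervals = "(real \<Rightarrow> real) \<times> (real \<Rightarrow> real) \<times> (real \<Rightarrow> real)"

definition superposition ::
    "(real \<Rightarrow> 'n \<Rightarrow> real) \<Rightarrow> weighted_intervals \<Rightarrow> 'n \<Rightarrow> real" where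
  "superposition b = (\<lambda>(h, l, u) w. LBINT r. h r * (b (u r) w - b (l r) w))"

text \<open>\<open>sqrt \<bar>u r - l r\<bar>\<close> is the mean square norm of the increment from
  \<open>l r\<close> to \<open>u r\<close>, so the condition is absolute convergence of the
  superposition in that norm.\<close>

definition admissible :: "weighted_intervals \<Rightarrow> bool" where
  "admissible = (\<lambda>(h, l, u). h \<in> borel_measurable borel \<and> l \<in> borel_measurable borel \<and>
     u \<in> borel_measurable borel \<and> integrable lborel (\<lambda>r. h r * sqrt \<bar>u r - l r\<bar>))"

text \<open>The length of the overlap of \<open>(l, u]\<close> and \<open>(l', u']\<close> when the
  endpoints are ordered. The form through distances stays correct for reversed endpoints and is what
  polarization produces.\<close>

definition inner_increments :: "real \<Rightarrow> real \<Rightarrow> real \<Rightarrow> real \<Rightarrow> real" where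
  "inner_increments l u l' u' = (\<bar>u - l'\<bar> + \<bar>l - u'\<bar> - \<bar>u - u'\<bar> - \<bar>l - l'\<bar>) / 2"

definition superposition_inner ::
   "weighted_intervals \<Rightarrow> weighted_intervals \<Rightarrow> real" where
  "superposition_inner = (\<lambda>(h, l, u) (h', l', u'). \<integral>z. h (fst z) * h' (snd z) *
     inner_increments (l (fst z)) (u (fst z)) (l' (snd z)) (u' (snd z)) \<partial>(lborel \<Otimes>\<^sub>M lborel))"

text \<open>Satisfied by a Brownian motion over its probability space and by the signed indicators of
  \<open>(0, t]\<close> over the real line; the Ito isometry compares these two interpretations.\<close>

locale brownian_variogram = sigma_finite_measure N
  for N :: "'n measure" and b :: "real \<Rightarrow> 'n \<Rightarrow> real" +
  assumes joint_measurable[measurable]: "(\<lambda>(w, t). b t w) \<in> borel_measurable (N \<Otimes>\<^sub>M borel)"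
    and variogram: "\<And>s t. has_bochner_integral N (\<lambda>w. (b t w - b s w)\<^sup>2) \<bar>t - s\<bar>"
begin

lemma measurable_section[measurable]: "b t \<in> borel_measurable N"
  using measurable_compose[OF _ joint_measurable, of "\<lambda>w. (w, t)" N] by simp

lemma measurable_at:
  assumes [measurable]: "f \<in> borel_measurable borel"
  shows "(\<lambda>(w, r). b (f r) w) \<in> borel_measurable (N \<Otimes>\<^sub>M lborel)"
  using measurable_compose[OF _ joint_measurable, of "\<lambda>(w, r). (w, f r)" "N \<Otimes>\<^sub>M lborel"]
  by (simp add: case_prod_beta)

lemma superposition_measurable:
  assumes "admissible x"
  shows "superposition b x \<in> borel_measurable N"
proof -
  obtain h l u where x: "x = (h, l, u)" by (cases x)
  from assms have [measurable]: "h \<in> borel_measurable borel" "l \<in> borel_measurable borel"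
    "u \<in> borel_measurable borel" by (auto simp: admissible_def x)
  note [measurable] = measurable_at[of u] measurable_at[of l]
  show ?thesis unfolding superposition_def x prod.case by (rule lborel.borel_measurable_lebesgue_integral) measurable
qed

lemma integral_mult_increments:
  "(\<integral>w. (b u w - b l w) * (b u' w - b l' w) \<partial>N) = inner_increments l u l' u'"
proof -
  have "(b u w - b l w) * (b u' w - b l' w) =
     ((b u w - b l' w)\<^sup>2 + (b l w - b u' w)\<^sup>2 - (b u w - b u' w)\<^sup>2 - (b l w - b l' w)\<^sup>2) / 2" for w
    by (simp add: power2_eq_square field_simps)
  moreover have "has_bochner_integral N (\<lambda>w. ((b u w - b l' w)\<^sup>2 + (b l w - b u' w)\<^sup>2
      - (b u w - b u' w)\<^sup>2 - (b l w - b l' w)\<^sup>2) / 2) (inner_increments l u l' u')"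
    unfolding inner_increments_def by (intro has_bochner_integral_divide_zero has_bochner_integral_diff
      has_bochner_integral_add variogram)
  ultimately show ?thesis by (simp only: has_bochner_integral_iff)
qed

lemma superposition_mult:
  assumes "admissible x" and "admissible y"
  shows "has_bochner_integral N (\<lambda>w. superposition b x w * superposition b y w) (superposition_inner x y)"
proof -
  obtain h l u where x: "x = (h, l, u)" by (cases x)
  obtain h' l' u' where y: "y = (h', l', u')" by (cases y)
  from assms have [measurable]: "h \<in> borel_measurable borel" "l \<in> borel_measurable borel"
    "u \<in> borel_measurable borel" "h' \<in> borel_measurable borel" "l' \<in> borel_measurable borel"
    "u' \<in> borel_measurable borel"
    by (auto simp: admissible_def x y)
  note [measurable] = measurable_at[of u] measurable_at[of l] measurable_at[of u'] measurable_at[of l']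
  have "has_bochner_integral N
     (\<lambda>w. (\<integral>r. h r * (b (u r) w - b (l r) w) \<partial>lborel) * (\<integral>r. h' r * (b (u' r) w - b (l' r) w) \<partial>lborel))
     (\<integral>z. h (fst z) * h' (snd z) * (\<integral>w. (b (u (fst z)) w - b (l (fst z)) w) *
        (b (u' (snd z)) w - b (l' (snd z)) w) \<partial>N) \<partial>(lborel \<Otimes>\<^sub>M lborel))"
  proof (rule integral_mult_superposition[where p="\<lambda>r. \<bar>u r - l r\<bar>" and q="\<lambda>r. \<bar>u' r - l' r\<bar>"])
    show "sigma_finite_measure N" ..
  qed (use assms variogram in \<open>auto simp: admissible_def x y case_prod_beta'\<close>)
  then show ?thesis
    by (simp add: superposition_def superposition_inner_def x y integral_mult_increments)
qed

lemma superposition_list_mult: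
  assumes "\<forall>x\<in>set xs. admissible x" and "\<forall>x\<in>set ys. admissible x"
  shows "has_bochner_integral N (\<lambda>w. (\<Sum>x\<leftarrow>xs. superposition b x w) * (\<Sum>y\<leftarrow>ys. superposition b y w))
    (\<Sum>x\<leftarrow>xs. \<Sum>y\<leftarrow>ys. superposition_inner x y)"
proof -
  have "has_bochner_integral N (\<lambda>w. superposition b x w * (\<Sum>y\<leftarrow>ys. superposition b y w))
    (\<Sum>y\<leftarrow>ys. superposition_inner x y)" if "admissible x" for x
    using assms(2)
    by (induction ys) (auto simp: distrib_left intro!: has_bochner_integral_add superposition_mult that)
  then show ?thesis
    using assms(1) by (induction xs) (auto simp: distrib_right intro!: has_bochner_integral_add)
qed

text \<open>The right-hand side mentions neither \<open>N\<close> nor \<open>b\<close>. Every two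
  interpretations of the locale therefore give the same value, which is the Ito isometry for finite
  lists of superpositions.\<close>

lemma nn_integral_superposition_square:
  assumes "\<forall>x\<in>set xs. admissible x"
  shows "(\<integral>\<^sup>+w. ennreal ((\<Sum>x\<leftarrow>xs. superposition b x w)\<^sup>2) \<partial>N) =
    ennreal (\<Sum>x\<leftarrow>xs. \<Sum>y\<leftarrow>xs. superposition_inner x y)"
  using superposition_list_mult[OF assms assms]
  by (subst nn_integral_eq_integral) (auto simp: power2_eq_square has_bochner_integral_iff)

end

definition signed_indicator :: "real \<Rightarrow> real \<Rightarrow> real" where
  "signed_indicator t x = (if 0 < x \<and> x \<le> t then 1 else if t < x \<and> x \<le> 0 then - 1 else 0)"

lemma signed_indicator_diff:
  "l \<le> u \<Longrightarrow> signed_indicator u x - signed_indicator l x = indicator {l<..u} x"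
  by (auto simp: signed_indicator_def indicator_def)

interpretation indicators: brownian_variogram lborel signed_indicator
proof
  show "(\<lambda>(w, t). signed_indicator t w) \<in> borel_measurable (lborel \<Otimes>\<^sub>M borel)"
    unfolding signed_indicator_def by measurable
  have sq: "(signed_indicator t w - signed_indicator s w)\<^sup>2 = indicator {min s t<..max s t} w" for s t w
    by (auto simp: signed_indicator_def indicator_def)
  have i: "has_bochner_integral lborel (\<lambda>w. indicator {min s t<..max s t} w :: real) (measure lborel {min s t<..max s t})" for s t :: real
    by (intro has_bochner_integral_real_indicator) (simp_all add: min_def max_def)
  show "has_bochner_integral lborel (\<lambda>w. (signed_indicator t w - signed_indicator s w)\<^sup>2) \<bar>t - s\<bar>" for s t
    using i[of s t] unfolding sq by (cases "s \<le> t") (simp_all add: min_def max_def)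
qed

section \<open>Brownian increments and Wiener integrals of superpositions\<close>

context two_sided_brownian_motion
begin

text \<open>The factor is the double factorial of \<open>2 k - 1\<close>, the moment of order
  \<open>2 k\<close> of a standard normal variable. The case \<open>k = 1\<close> is the variogram;
  large \<open>k\<close> give tail bounds of any polynomial order.\<close>

lemma increment_moment:
  "has_bochner_integral M (\<lambda>\<omega>. (B t \<omega> - B s \<omega>) ^ (2 * k)) (fact (2 * k) / (2 ^ k * fact k) * \<bar>t - s\<bar> ^ k)"
proof -
  have less: "has_bochner_integral M (\<lambda>\<omega>. (B t \<omega> - B s \<omega>) ^ (2 * k)) (fact (2 * k) / (2 ^ k * fact k) * (t - s) ^ k)"
    if "s < t" for s t
  proof -
    note d = normal_increments[OF that]
    have "has_bochner_integral lborel (\<lambda>x. normal_density 0 (sqrt (t - s)) x * x ^ (2 * k))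
       (fact (2 * k) / (2 ^ k * fact k) * (t - s) ^ k)"
      using normal_moment_even[of "sqrt (t - s)" 0 k] that by (simp add: power_divide field_simps)
    then show ?thesis
      using distributed_integrable[OF d, of "\<lambda>x. x ^ (2 * k)"] distributed_integral[OF d, of "\<lambda>x. x ^ (2 * k)"]
      by (simp add: has_bochner_integral_iff)
  qed
  consider "s < t" | "s = t" | "t < s" by linarith
  then show ?thesis
  proof cases
    case 3
    have "(B t \<omega> - B s \<omega>) ^ (2 * k) = (B s \<omega> - B t \<omega>) ^ (2 * k)" for \<omega>
      by (simp add: power_mult power2_commute)
    with less[OF 3] 3 show ?thesis by simp
  qed (use less in \<open>auto simp: has_bochner_integral_iff prob_space power_0_left\<close>)
qed

text \<open>By continuity of the paths, \<open>B t\<close> is the limit of the values at the grid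
  points \<open>\<lfloor>(n + 1) * t\<rfloor> / (n + 1)\<close>. Each approximation involves
  countably many random variables, selected by a measurable integer.\<close>

lemma joint_measurable_B: "(\<lambda>(w, t). B t w) \<in> borel_measurable (M \<Otimes>\<^sub>M borel)"
proof (rule borel_measurable_LIMSEQ_real)
  fix n :: nat
  have "(\<lambda>x. (\<lambda>i :: int. B (real_of_int i / real (Suc n)) (fst x)) \<lfloor>real (Suc n) * snd x\<rfloor>) \<in> borel_measurable (M \<Otimes>\<^sub>M borel)"
    by (rule measurable_compose_countable) (use measurable_B in measurable)
  then show "(\<lambda>x. B (real_of_int \<lfloor>real (Suc n) * snd x\<rfloor> / real (Suc n)) (fst x)) \<in> borel_measurable (M \<Otimes>\<^sub>M borel)"
    by simp
next
  fix x assume "x \<in> space (M \<Otimes>\<^sub>M (borel :: real measure))"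
  then obtain w t where x: "x = (w, t)" and w: "w \<in> space M" by (auto simp: space_pair_measure)
  have "(\<lambda>n. real_of_int \<lfloor>real (Suc n) * t\<rfloor> / real (Suc n)) \<longlonglongrightarrow> t"
  proof (rule real_tendsto_sandwich)
    show "(\<lambda>n. t - 1 / real (Suc n)) \<longlonglongrightarrow> t"
      using tendsto_diff[OF tendsto_const[of t] LIMSEQ_inverse_real_of_nat] by (simp add: inverse_eq_divide)
    show "\<forall>\<^sub>F n in sequentially. t - 1 / real (Suc n) \<le> real_of_int \<lfloor>real (Suc n) * t\<rfloor> / real (Suc n)"
    proof (rule always_eventually, rule allI)
      fix n
      have "real (Suc n) * t - 1 \<le> real_of_int \<lfloor>real (Suc n) * t\<rfloor>" by linarith
      then have "(real (Suc n) * t - 1) / real (Suc n) \<le> real_of_int \<lfloor>real (Suc n) * t\<rfloor> / real (Suc n)"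
        by (rule divide_right_mono) simp
      then show "t - 1 / real (Suc n) \<le> real_of_int \<lfloor>real (Suc n) * t\<rfloor> / real (Suc n)"
        by (simp add: diff_divide_distrib del: of_nat_Suc)
    qed
    show "\<forall>\<^sub>F n in sequentially. real_of_int \<lfloor>real (Suc n) * t\<rfloor> / real (Suc n) \<le> t"
    proof (rule always_eventually, rule allI)
      fix n
      have "real_of_int \<lfloor>real (Suc n) * t\<rfloor> \<le> real (Suc n) * t" by linarith
      then have "real_of_int \<lfloor>real (Suc n) * t\<rfloor> / real (Suc n) \<le> real (Suc n) * t / real (Suc n)"
        by (rule divide_right_mono) simp
      then show "real_of_int \<lfloor>real (Suc n) * t\<rfloor> / real (Suc n) \<le> t" by (simp del: of_nat_Suc)
    qed
  qed simp
  moreover have "isCont (\<lambda>t. B t w) t"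
    using continuous_paths[OF w] by (simp add: continuous_on_eq_continuous_at)
  ultimately show "(\<lambda>n. B (real_of_int \<lfloor>real (Suc n) * snd x\<rfloor> / real (Suc n)) (fst x)) \<longlonglongrightarrow> (case x of (w, t) \<Rightarrow> B t w)"
    unfolding x by (auto intro: isCont_tendsto_compose)
qed

sublocale variogram: brownian_variogram M B
  using joint_measurable_B increment_moment[of _ _ 1] by unfold_locales auto

text \<open>Integrals of step functions are superpositions too. The isometry therefore equates the
  mean square distance between the superposition of \<open>B\<close> and each step integral with the
  distance between \<open>k\<close> and the step function, so that the superposition is the limit of
  the same step integrals as \<open>X\<close>.\<close>

theorem wiener_integral_superposition:
  assumes X: "has_wiener_integral M B k X"
    and adm: "\<forall>x\<in>set xs. admissible x"
    and k: "AE s in lborel. k s = (\<Sum>x\<leftarrow>xs. superposition signed_indicator x s)"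
  shows "AE \<omega> in M. X \<omega> = (\<Sum>x\<leftarrow>xs. superposition B x \<omega>)"
proof -
  define U where "U \<omega> = (\<Sum>x\<leftarrow>xs. superposition B x \<omega>)" for \<omega>
  from X obtain p :: "nat \<Rightarrow> (real \<times> real \<times> real) list" where
    p: "\<And>m c l u. (c, l, u) \<in> set (p m) \<Longrightarrow> l \<le> u"
    and pk: "(\<lambda>m. \<integral>\<^sup>+ x. ennreal ((k x - step_fun (p m) x)\<^sup>2) \<partial>lborel) \<longlonglongrightarrow> 0"
    and pX: "(\<lambda>m. \<integral>\<^sup>+ \<omega>. ennreal ((X \<omega> - step_integral B (p m) \<omega>)\<^sup>2) \<partial>M) \<longlonglongrightarrow> 0"
    and X_meas[measurable]: "X \<in> borel_measurable M"
    unfolding has_wiener_integral_def by blast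
  \<comment> \<open>A single interval becomes a superposition by letting the parameter run over
    \<open>[0, 1]\<close> with constant weight. The weight carries the sign \<open>- c\<close>, so
    that appending these entries to \<open>xs\<close> forms the difference.\<close>
  define st where "st = (\<lambda>(c :: real, l :: real, u :: real).
    (\<lambda>r :: real. - c * indicator {0..1} r :: real, \<lambda>r :: real. l, \<lambda>r :: real. u))"
  have st_adm: "admissible (st x)" for x
    by (cases x) (auto simp: st_def admissible_def intro!: integrable_real_indicator)
  have st_sup: "superposition b (st (c, l, u)) w = - c * (b u w - b l w)" for c l u w
    and b :: "real \<Rightarrow> 'n \<Rightarrow> real"
    by (simp add: superposition_def st_def)
  have st_list: "(\<Sum>x\<leftarrow>map st ps. superposition b x w) = - (\<Sum>(c, l, u)\<leftarrow>ps. c * (b u w - b l w))"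
    for ps w and b :: "real \<Rightarrow> 'n \<Rightarrow> real"
    by (induction ps) (auto simp: st_sup)
  have step: "(\<Sum>x\<leftarrow>map st (p m). superposition signed_indicator x s) = - step_fun (p m) s" for m s
  proof -
    have "(\<Sum>(c, l, u)\<leftarrow>p m. c * (signed_indicator u s - signed_indicator l s)) = step_fun (p m) s"
      unfolding step_fun_def
      by (intro arg_cong[where f=sum_list] map_cong) (auto simp: signed_indicator_diff dest: p)
    then show ?thesis by (simp only: st_list)
  qed
  have eq: "(\<integral>\<^sup>+ \<omega>. ennreal ((U \<omega> - step_integral B (p m) \<omega>)\<^sup>2) \<partial>M)
     = (\<integral>\<^sup>+ x. ennreal ((k x - step_fun (p m) x)\<^sup>2) \<partial>lborel)" for m
  proof -
    have a: "\<forall>x\<in>set (xs @ map st (p m)). admissible x" using adm st_adm by auto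
    have "(\<integral>\<^sup>+ \<omega>. ennreal ((U \<omega> - step_integral B (p m) \<omega>)\<^sup>2) \<partial>M)
      = (\<integral>\<^sup>+ \<omega>. ennreal ((\<Sum>x\<leftarrow>xs @ map st (p m). superposition B x \<omega>)\<^sup>2) \<partial>M)"
      unfolding U_def sum_list_append map_append st_list step_integral_def by simp
    also have "\<dots> = (\<integral>\<^sup>+ s. ennreal ((\<Sum>x\<leftarrow>xs @ map st (p m). superposition signed_indicator x s)\<^sup>2) \<partial>lborel)"
      using variogram.nn_integral_superposition_square[OF a] indicators.nn_integral_superposition_square[OF a] by simp
    also have "\<dots> = (\<integral>\<^sup>+ x. ennreal ((k x - step_fun (p m) x)\<^sup>2) \<partial>lborel)"
      by (rule nn_integral_cong_AE) (use k in \<open>eventually_elim, simp only: sum_list_append map_append step, simp\<close>)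
    finally show ?thesis .
  qed
  have U_meas[measurable]: "U \<in> borel_measurable M"
    unfolding U_def using adm variogram.superposition_measurable by (induction xs) auto
  have step_meas[measurable]: "step_integral B ps \<in> borel_measurable M" for ps
    unfolding step_integral_def using measurable_B by (induction ps) auto
  have le: "(\<integral>\<^sup>+ \<omega>. ennreal ((X \<omega> - U \<omega>)\<^sup>2) \<partial>M) \<le>
     2 * (\<integral>\<^sup>+ \<omega>. ennreal ((X \<omega> - step_integral B (p m) \<omega>)\<^sup>2) \<partial>M) +
     2 * (\<integral>\<^sup>+ x. ennreal ((k x - step_fun (p m) x)\<^sup>2) \<partial>lborel)" for m
  proof -
    have "(x - y)\<^sup>2 \<le> 2 * (x - z)\<^sup>2 + 2 * (y - z)\<^sup>2" for x y z :: real
      using zero_le_power2[of "(x - z) + (y - z)"] by (simp add: power2_eq_square algebra_simps)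
    then have "ennreal ((x - y)\<^sup>2) \<le> ennreal (2 * (x - z)\<^sup>2 + 2 * (y - z)\<^sup>2)" for x y z :: real
      by (intro ennreal_leI) simp
    then have "ennreal ((x - y)\<^sup>2) \<le> 2 * ennreal ((x - z)\<^sup>2) + 2 * ennreal ((y - z)\<^sup>2)" for x y z :: real
      by (simp add: ennreal_mult'')
    then have "(\<integral>\<^sup>+ \<omega>. ennreal ((X \<omega> - U \<omega>)\<^sup>2) \<partial>M) \<le>
      (\<integral>\<^sup>+ \<omega>. 2 * ennreal ((X \<omega> - step_integral B (p m) \<omega>)\<^sup>2) + 2 * ennreal ((U \<omega> - step_integral B (p m) \<omega>)\<^sup>2) \<partial>M)"
      by (intro nn_integral_mono) auto
    also have "\<dots> = 2 * (\<integral>\<^sup>+ \<omega>. ennreal ((X \<omega> - step_integral B (p m) \<omega>)\<^sup>2) \<partial>M) +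
      2 * (\<integral>\<^sup>+ \<omega>. ennreal ((U \<omega> - step_integral B (p m) \<omega>)\<^sup>2) \<partial>M)"
      by (subst nn_integral_add) (auto simp: nn_integral_cmult)
    finally show ?thesis by (simp add: eq)
  qed
  have "(\<lambda>m. 2 * (\<integral>\<^sup>+ \<omega>. ennreal ((X \<omega> - step_integral B (p m) \<omega>)\<^sup>2) \<partial>M) +
     2 * (\<integral>\<^sup>+ x. ennreal ((k x - step_fun (p m) x)\<^sup>2) \<partial>lborel)) \<longlonglongrightarrow> 2 * 0 + 2 * 0"
    by (intro tendsto_add ennreal_tendsto_cmult pX pk) auto
  then have "(\<integral>\<^sup>+ \<omega>. ennreal ((X \<omega> - U \<omega>)\<^sup>2) \<partial>M) \<le> 0"
    by (intro LIMSEQ_le_const[of _ 0]) (use le in auto)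
  then have "AE \<omega> in M. ennreal ((X \<omega> - U \<omega>)\<^sup>2) = 0"
    by (subst nn_integral_0_iff_AE[symmetric]) auto
  then show ?thesis unfolding U_def by eventually_elim (simp add: ennreal_eq_0_iff)
qed

end

section \<open>Hoelder continuity and growth of Brownian paths\<close>

lemma floor_double_cases:
  fixes y :: real
  assumes "0 \<le> y"
  shows "nat \<lfloor>2 * y\<rfloor> = 2 * nat \<lfloor>y\<rfloor> \<or> nat \<lfloor>2 * y\<rfloor> = Suc (2 * nat \<lfloor>y\<rfloor>)"
proof -
  have "\<lfloor>2 * y\<rfloor> = 2 * \<lfloor>y\<rfloor> \<or> \<lfloor>2 * y\<rfloor> = 2 * \<lfloor>y\<rfloor> + 1" by linarith
  moreover have "0 \<le> \<lfloor>y\<rfloor>" using assms by simp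
  moreover have "nat w = 2 * nat z \<or> nat w = Suc (2 * nat z)" if "0 \<le> z" "w = 2 * z \<or> w = 2 * z + 1" for w z :: int
    using that by auto
  ultimately show ?thesis by blast
qed

text \<open>Chaining: let \<open>d k x\<close> be \<open>x\<close> rounded down to level
  \<open>k\<close>. Passing to level \<open>k + 1\<close> moves by at most one dyadic step, so
  \<open>c x\<close> differs from \<open>c (d k x)\<close> by a geometric series. Two points at
  distance about \<open>1 / 2 ^ k\<close> have equal or adjacent roundings at level
  \<open>k\<close>. The constant adds two series and one step, divided by \<open>q\<close> because
  the level is only determined up to one.\<close>

lemma dyadic_increments_imp_holder:
  fixes c :: "real \<Rightarrow> real" and A g :: real
  defines "q \<equiv> 2 powr (- g)"
  assumes cont: "continuous_on {0..1} c" and g: "0 < g" and A: "0 \<le> A"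
    and inc: "\<And>k j. j < 2 ^ k \<Longrightarrow> \<bar>c (real (Suc j) / 2 ^ k) - c (real j / 2 ^ k)\<bar> \<le> A * q ^ k"
    and "x \<in> {0..1}" and "y \<in> {0..1}"
  shows "\<bar>c x - c y\<bar> \<le> A * ((1 + q) / (q * (1 - q))) * \<bar>x - y\<bar> powr g"
proof -
  have q: "0 < q" "q < 1" using g by (auto simp: q_def powr_less_one)
  define d where "d k x = real (nat \<lfloor>2 ^ k * x\<rfloor>) / 2 ^ k" for k and x :: real
  have d_le: "d k x \<le> x" "x - 1 / 2 ^ k \<le> d k x" "0 \<le> d k x" if "0 \<le> x" for k x
  proof -
    have "0 \<le> 2 ^ k * x" using that by simp
    then have "real (nat \<lfloor>2 ^ k * x\<rfloor>) \<le> 2 ^ k * x" "2 ^ k * x - 1 \<le> real (nat \<lfloor>2 ^ k * x\<rfloor>)" by linarith+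
    then have "real (nat \<lfloor>2 ^ k * x\<rfloor>) / 2 ^ k \<le> 2 ^ k * x / 2 ^ k"
      "(2 ^ k * x - 1) / 2 ^ k \<le> real (nat \<lfloor>2 ^ k * x\<rfloor>) / 2 ^ k"
      by (intro divide_right_mono; simp)+
    then show "d k x \<le> x" "x - 1 / 2 ^ k \<le> d k x" "0 \<le> d k x"
      by (auto simp: d_def diff_divide_distrib)
  qed
  have step: "\<bar>c (d (Suc k) x) - c (d k x)\<bar> \<le> A * q ^ Suc k" if x: "x \<in> {0..1}" for k x
  proof -
    let ?n = "nat \<lfloor>2 ^ k * x\<rfloor>"
    have "nat \<lfloor>2 ^ Suc k * x\<rfloor> = 2 * ?n \<or> nat \<lfloor>2 ^ Suc k * x\<rfloor> = Suc (2 * ?n)"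
      using floor_double_cases[of "2 ^ k * x"] x by (simp add: mult.assoc)
    then show ?thesis
    proof
      assume "nat \<lfloor>2 ^ Suc k * x\<rfloor> = 2 * ?n"
      then have "d (Suc k) x = d k x" by (simp add: d_def)
      then show ?thesis using A q by simp
    next
      assume eq: "nat \<lfloor>2 ^ Suc k * x\<rfloor> = Suc (2 * ?n)"
      have "real (nat \<lfloor>2 ^ Suc k * x\<rfloor>) \<le> 2 ^ Suc k * x" using x by simp
      also have "\<dots> \<le> 2 ^ Suc k" using x by (simp add: mult_le_cancel_left1)
      finally have "real (Suc (2 * ?n)) \<le> 2 ^ Suc k" unfolding eq .
      then have "real (2 * ?n) < 2 ^ Suc k" by linarith
      then have "2 * ?n < 2 ^ Suc k" by (metis of_nat_less_numeral_power_cancel_iff)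
      from inc[OF this] show ?thesis by (simp add: d_def eq[simplified])
    qed
  qed
  have chain: "\<bar>c (d (k + m) x) - c (d k x)\<bar> \<le> A * q ^ k * (q / (1 - q)) * (1 - q ^ m)" if x: "x \<in> {0..1}" for k m x
  proof (induction m)
    case (Suc m)
    have "\<bar>c (d (k + Suc m) x) - c (d k x)\<bar> \<le> \<bar>c (d (Suc (k + m)) x) - c (d (k + m) x)\<bar> + \<bar>c (d (k + m) x) - c (d k x)\<bar>"
      by simp
    also have "\<dots> \<le> A * q ^ Suc (k + m) + A * q ^ k * (q / (1 - q)) * (1 - q ^ m)"
      by (intro add_mono step x Suc.IH)
    also have "\<dots> = A * q ^ k * (q / (1 - q)) * (1 - q ^ Suc m)"
      using q by (simp add: field_simps power_add)
    finally show ?case .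
  qed simp
  have limit: "\<bar>c x - c (d k x)\<bar> \<le> A * q ^ k * (q / (1 - q))" if x: "x \<in> {0..1}" for k x
  proof -
    have lim: "(\<lambda>m. d (k + m) x) \<longlonglongrightarrow> x"
    proof (rule real_tendsto_sandwich[where h="\<lambda>_. x"])
      have "(\<lambda>m. (1 / 2) ^ (k + m) :: real) \<longlonglongrightarrow> 0"
        using LIMSEQ_ignore_initial_segment[OF LIMSEQ_realpow_zero[of "1/2::real"], of k]
        by (simp add: add.commute)
      then have "(\<lambda>m. x - (1 / 2) ^ (k + m)) \<longlonglongrightarrow> x - 0" by (intro tendsto_intros)
      then show "(\<lambda>m. x - 1 / 2 ^ (k + m)) \<longlonglongrightarrow> x" by (simp add: power_one_over)
    qed (use d_le x in \<open>auto intro!: always_eventually\<close>)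
    have "(\<lambda>m. c (d (k + m) x)) \<longlonglongrightarrow> c x"
      by (rule continuous_on_tendsto_compose[OF cont lim x])
         (use d_le x in \<open>auto intro!: always_eventually intro: order_trans\<close>)
    then have l: "(\<lambda>m. \<bar>c (d (k + m) x) - c (d k x)\<bar>) \<longlonglongrightarrow> \<bar>c x - c (d k x)\<bar>"
      by (intro tendsto_intros)
    have "\<bar>c (d (k + m) x) - c (d k x)\<bar> \<le> A * q ^ k * (q / (1 - q))" for m
    proof -
      have "A * q ^ k * (q / (1 - q)) * (1 - q ^ m) \<le> A * q ^ k * (q / (1 - q)) * 1"
        using A q by (intro mult_left_mono) auto
      with chain[OF x, of k m] show ?thesis by simp
    qed
    then show ?thesis by (intro LIMSEQ_le_const2[OF l]) auto
  qed
  have main: "\<bar>c x - c y\<bar> \<le> A * ((1 + q) / (q * (1 - q))) * \<bar>x - y\<bar> powr g"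
    if xy: "x \<in> {0..1}" "y \<in> {0..1}" "x < y" for x y
  proof -
    have ex: "\<exists>n. 1 < 2 ^ n * (y - x)"
      using real_arch_pow[of 2 "1 / (y - x)"] xy by (auto simp: field_simps)
    \<comment> \<open>The predecessor \<open>k\<close> of \<open>n\<close> satisfies
      \<open>1 / 2 ^ Suc k < y - x\<close> and \<open>y - x \<le> 1 / 2 ^ k\<close>: the second
      bound makes the roundings equal or adjacent, the first bounds \<open>q ^ Suc k\<close> by
      \<open>(y - x) powr g\<close>.\<close>
    define n where "n = (LEAST n. 1 < 2 ^ n * (y - x))"
    have n: "1 < 2 ^ n * (y - x)" unfolding n_def by (rule LeastI_ex[OF ex])
    then have "n \<noteq> 0" using xy by (intro notI) simp
    then obtain k where k: "n = Suc k" by (cases n) auto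
    have k_le: "2 ^ k * (y - x) \<le> 1"
      using not_less_Least[of k "\<lambda>n. 1 < 2 ^ n * (y - x)"] k n_def by auto
    have mid: "\<bar>c (d k x) - c (d k y)\<bar> \<le> A * q ^ k"
    proof -
      let ?i = "nat \<lfloor>2 ^ k * x\<rfloor>" and ?j = "nat \<lfloor>2 ^ k * y\<rfloor>"
      have "2 ^ k * x < 2 ^ k * y" "2 ^ k * y \<le> 2 ^ k * x + 1" "0 \<le> 2 ^ k * x"
        using xy k_le by (auto simp: algebra_simps)
      then have "?j = ?i \<or> ?j = Suc ?i" by linarith
      then show ?thesis
      proof
        assume "?j = ?i"
        then show ?thesis using A q by (simp add: d_def)
      next
        assume eq: "?j = Suc ?i"
        have "real ?j \<le> 2 ^ k * y" using xy by simp
        also have "\<dots> \<le> 2 ^ k" using xy by (simp add: mult_le_cancel_left1)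
        finally have "real (Suc ?i) \<le> 2 ^ k" unfolding eq .
        then have "real ?i < 2 ^ k" by linarith
        then have "?i < 2 ^ k" by (metis of_nat_less_numeral_power_cancel_iff)
        from inc[OF this] show ?thesis by (simp add: d_def eq abs_minus_commute)
      qed
    qed
    have "q ^ Suc k = (1 / 2 ^ Suc k) powr g"
      by (simp add: q_def powr_divide powr_minus_divide powr_realpow[symmetric] powr_powr
          power_one_over[symmetric] del: power_Suc) (simp add: powr_power mult.commute powr_realpow[symmetric] powr_powr divide_simps)
    also have "\<dots> \<le> (y - x) powr g"
      using n g xy by (intro powr_mono2) (auto simp: k field_simps)
    finally have qk: "q ^ k \<le> (y - x) powr g / q" using q by (simp add: field_simps)
    have "\<bar>c x - c y\<bar> \<le> \<bar>c x - c (d k x)\<bar> + \<bar>c (d k x) - c (d k y)\<bar> + \<bar>c y - c (d k y)\<bar>" by linarith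
    also have "\<dots> \<le> A * q ^ k * (q / (1 - q)) + A * q ^ k + A * q ^ k * (q / (1 - q))"
      by (intro add_mono limit mid xy)
    also have "\<dots> = A * q ^ k * (2 * (q / (1 - q)) + 1)" by (simp add: algebra_simps)
    also have "2 * (q / (1 - q)) + 1 = (1 + q) / (1 - q)" using q by (simp add: field_simps)
    also have "A * q ^ k * ((1 + q) / (1 - q)) = A * ((1 + q) / (1 - q)) * q ^ k" by simp
    also have "\<dots> \<le> A * ((1 + q) / (1 - q)) * ((y - x) powr g / q)"
      using A q by (intro mult_left_mono qk) auto
    finally show ?thesis using xy by (simp add: mult_ac)
  qed
  show ?thesis
    using main[of x y] main[of y x] assms(6,7)
    by (cases x y rule: linorder_cases) (auto simp: abs_minus_commute)
qed

definition holder_factor :: "real \<Rightarrow> real" where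
  "holder_factor g = (1 + 2 powr (- g)) / (2 powr (- g) * (1 - 2 powr (- g)))"

lemma holder_factor_pos: "0 < g \<Longrightarrow> 0 < holder_factor g"
  by (auto simp: holder_factor_def powr_less_one intro!: divide_pos_pos mult_pos_pos add_pos_pos)

lemma dyadic_increments_imp_holder_interval:
  fixes b :: "real \<Rightarrow> real"
  assumes cont: "continuous_on {x0..x0 + L} b" and g: "0 < g" and A: "0 \<le> A" and L: "0 < L"
    and inc: "\<And>k j. j < 2 ^ k \<Longrightarrow>
       \<bar>b (x0 + L * (real (Suc j) / 2 ^ k)) - b (x0 + L * (real j / 2 ^ k))\<bar> \<le> A * (2 powr (- g)) ^ k"
    and x: "x \<in> {x0..x0 + L}" and y: "y \<in> {x0..x0 + L}"
  shows "\<bar>b x - b y\<bar> \<le> A * holder_factor g * (\<bar>x - y\<bar> / L) powr g"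
proof -
  have "continuous_on {0..1} (\<lambda>z. b (x0 + L * z))"
    by (rule continuous_on_compose2[OF cont]) (use L in \<open>auto intro!: continuous_intros mult_left_le\<close>)
  from dyadic_increments_imp_holder[OF this g A inc, of "(x - x0) / L" "(y - x0) / L"]
  have "\<bar>b x - b y\<bar> \<le> A * holder_factor g * \<bar>(x - x0) / L - (y - x0) / L\<bar> powr g"
    using L x y by (simp add: holder_factor_def)
  also have "\<bar>(x - x0) / L - (y - x0) / L\<bar> = \<bar>x - y\<bar> / L"
    using L by (simp add: diff_divide_distrib[symmetric])
  finally show ?thesis .
qed

lemma (in finite_measure) measure_UN_geometric:
  assumes F: "\<And>k. F k \<in> sets M" and le: "\<And>k. measure M (F k) \<le> c * (1 / 2) ^ k"
  shows "measure M (\<Union>k :: nat. F k) \<le> 2 * c"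
proof -
  have sm: "summable (\<lambda>k. c * (1 / 2 :: real) ^ k)" by (intro summable_mult summable_geometric) simp
  have sF: "summable (\<lambda>k. measure M (F k))"
    by (rule summable_comparison_test'[OF sm, of 0]) (use le in auto)
  have "measure M (\<Union>k. F k) \<le> (\<Sum>k. measure M (F k))"
    by (rule finite_measure_subadditive_countably[OF _ sF]) (use F in blast)
  also have "\<dots> \<le> (\<Sum>k. c * (1 / 2) ^ k)" by (rule suminf_le[OF le sF sm])
  also have "\<dots> = c * 2" using suminf_geometric[of "1/2::real"] by (subst suminf_mult) auto
  finally show ?thesis by simp
qed

section \<open>Tail bounds for the Hoelder constant and the growth of Brownian paths\<close>

context two_sided_brownian_motion
begin

text \<open>The hypothesis of the chaining lemma for the path on \<open>[x0, x0 + L]\<close>,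
  imposed on countably many increments so that measurability is immediate.\<close>

definition dyadic_event :: "real \<Rightarrow> real \<Rightarrow> real \<Rightarrow> real \<Rightarrow> 'a set" where
  "dyadic_event g x0 L A = {\<omega> \<in> space M. \<forall>k. \<forall>j<2 ^ k.
     \<bar>B (x0 + L * (real (Suc j) / 2 ^ k)) \<omega> - B (x0 + L * (real j / 2 ^ k)) \<omega>\<bar> \<le> A * (2 powr (- g)) ^ k}"

lemma dyadic_event_sets[measurable]: "dyadic_event g x0 L A \<in> sets M"
proof -
  note [measurable] = measurable_B
  show ?thesis unfolding dyadic_event_def by measurable
qed

text \<open>Markov's inequality for the power \<open>2 m\<close>, with \<open>m\<close> left free so
  that the decay in \<open>D\<close> can be made as fast as required.\<close>

lemma increment_tail:
  assumes "0 < D"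
  shows "measure M {\<omega> \<in> space M. D < \<bar>B t \<omega> - B s \<omega>\<bar>}
    \<le> fact (2 * m) / (2 ^ m * fact m) * \<bar>t - s\<bar> ^ m / D ^ (2 * m)"
proof -
  note [measurable] = measurable_B
  have int: "integrable M (\<lambda>\<omega>. (B t \<omega> - B s \<omega>) ^ (2 * m))"
    and val: "(\<integral>\<omega>. (B t \<omega> - B s \<omega>) ^ (2 * m) \<partial>M) = fact (2 * m) / (2 ^ m * fact m) * \<bar>t - s\<bar> ^ m"
    using increment_moment[of t s m] by (auto simp: has_bochner_integral_iff)
  have nn: "0 \<le> (B t \<omega> - B s \<omega>) ^ (2 * m)" for \<omega> by (simp add: power_mult)
  have "measure M {\<omega> \<in> space M. D < \<bar>B t \<omega> - B s \<omega>\<bar>}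
    \<le> measure M {\<omega> \<in> space M. D ^ (2 * m) \<le> (B t \<omega> - B s \<omega>) ^ (2 * m)}"
  proof (rule finite_measure_mono)
    have "D ^ (2 * m) \<le> z ^ (2 * m)" if "D < \<bar>z\<bar>" for z
    proof -
      have "D ^ (2 * m) \<le> \<bar>z\<bar> ^ (2 * m)" using that assms by (intro power_mono) auto
      then show ?thesis by (simp add: power_mult)
    qed
    then show "{\<omega> \<in> space M. D < \<bar>B t \<omega> - B s \<omega>\<bar>} \<subseteq> {\<omega> \<in> space M. D ^ (2 * m) \<le> (B t \<omega> - B s \<omega>) ^ (2 * m)}"
      by auto
  qed measurable
  also have "\<dots> \<le> (\<integral>\<omega>. (B t \<omega> - B s \<omega>) ^ (2 * m) \<partial>M) / D ^ (2 * m)"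
    by (rule integral_Markov_inequality_measure[OF int, of "{}"]) (use assms nn in auto)
  finally show ?thesis by (simp add: val)
qed

text \<open>At level \<open>k\<close> there are \<open>2 ^ k\<close> increments, and the condition
  on \<open>m\<close> makes the probability that one of them is too large at most a constant times
  \<open>(1/4) ^ k\<close>, so that the union bound is summable over the levels. The factor
  \<open>sqrt L\<close> is Brownian scaling; it makes the bound independent of \<open>x0\<close> and
  \<open>L\<close>.\<close>

lemma dyadic_event_tail:
  assumes g: "0 < g" "2 \<le> real m * (1 - 2 * g)" and L: "0 < L" and lam: "0 < lam"
  shows "measure M (space M - dyadic_event g x0 L (lam * sqrt L)) \<le> 2 * (fact (2 * m) / (2 ^ m * fact m)) / lam ^ (2 * m)"
proof -
  note [measurable] = measurable_B
  define q where "q = 2 powr (- g)"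
  define cm :: real where "cm = fact (2 * m) / (2 ^ m * fact m)"
  have q: "0 < q" by (simp add: q_def)
  define E where "E k j = {\<omega> \<in> space M. lam * sqrt L * q ^ k <
     \<bar>B (x0 + L * (real (Suc j) / 2 ^ k)) \<omega> - B (x0 + L * (real j / 2 ^ k)) \<omega>\<bar>}" for k j
  have E[measurable]: "E k j \<in> sets M" for k j unfolding E_def by measurable
  have Ele: "measure M (E k j) \<le> cm / lam ^ (2 * m) * (1 / 4) ^ k" for k j
  proof -
    have "x0 + L * (real (Suc j) / 2 ^ k) - (x0 + L * (real j / 2 ^ k)) = L * (real (Suc j) / 2 ^ k - real j / 2 ^ k)"
      by (simp only: right_diff_distrib)
    also have "\<dots> = L / 2 ^ k"
      by (simp add: diff_divide_distrib[symmetric])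
    finally have "measure M (E k j) \<le> cm * (L / 2 ^ k) ^ m / (lam * sqrt L * q ^ k) ^ (2 * m)"
      using increment_tail[of "lam * sqrt L * q ^ k" "x0 + L * (real (Suc j) / 2 ^ k)" "x0 + L * (real j / 2 ^ k)" m]
        L lam q by (simp add: E_def cm_def)
    also have "\<dots> = cm / lam ^ (2 * m) * ((1 / (2 * q\<^sup>2)) ^ m) ^ k"
    proof -
      have "(lam * sqrt L * q ^ k) ^ (2 * m) = lam ^ (2 * m) * L ^ m * (q\<^sup>2 ^ m) ^ k"
      proof -
        have "sqrt L ^ (2 * m) = L ^ m" using L by (simp add: power_mult)
        moreover have "(q ^ k) ^ (2 * m) = (q\<^sup>2 ^ m) ^ k" by (simp add: power_mult[symmetric] mult_ac)
        ultimately show ?thesis by (simp only: power_mult_distrib)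
      qed
      then show ?thesis using L lam q
        by (simp add: power_divide power_mult_distrib power_mult[symmetric] mult_ac)
    qed
    also have "(1 / (2 * q\<^sup>2)) ^ m \<le> 1 / 4"
    proof -
      have "q\<^sup>2 = 2 powr (- 2 * g)" by (simp add: q_def power2_eq_square powr_add[symmetric])
      then have "2 * q\<^sup>2 = 2 powr (1 - 2 * g)" by (simp add: powr_diff powr_minus field_simps)
      then have "(1 / (2 * q\<^sup>2)) ^ m = 2 powr - (real m * (1 - 2 * g))"
        by (simp add: powr_minus_divide power_one_over powr_power mult.commute)
      also have "\<dots> \<le> 2 powr (- 2)" using g by (intro powr_mono) auto
      finally show ?thesis by (simp add: powr_minus_divide)
    qed
    then have "cm / lam ^ (2 * m) * ((1 / (2 * q\<^sup>2)) ^ m) ^ k \<le> cm / lam ^ (2 * m) * (1 / 4) ^ k"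
      using lam q by (intro mult_left_mono power_mono) (auto simp: cm_def)
    finally show ?thesis .
  qed
  define Ek where "Ek k = (\<Union>j<2 ^ k. E k j)" for k :: nat
  have Ek[measurable]: "Ek k \<in> sets M" for k unfolding Ek_def by measurable
  have Ekle: "measure M (Ek k) \<le> cm / lam ^ (2 * m) * (1 / 2) ^ k" for k
  proof -
    have "measure M (Ek k) \<le> (\<Sum>j<2 ^ k. measure M (E k j))"
      unfolding Ek_def by (rule finite_measure_subadditive_finite) auto
    also have "\<dots> \<le> (\<Sum>j<(2::nat) ^ k. cm / lam ^ (2 * m) * (1 / 4) ^ k)" by (intro sum_mono Ele)
    also have "\<dots> = cm / lam ^ (2 * m) * (2 ^ k * (1 / 4) ^ k)" by simp
    also have "(2 ^ k * (1 / 4) ^ k :: real) = (1 / 2) ^ k" by (simp add: power_mult_distrib[symmetric])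
    finally show ?thesis .
  qed
  have "space M - dyadic_event g x0 L (lam * sqrt L) = (\<Union>k. Ek k)"
    unfolding dyadic_event_def Ek_def E_def q_def[symmetric]
    by (auto simp: set_eq_iff not_le Bex_def simp del: of_nat_Suc times_divide_eq_right)
  with measure_UN_geometric[OF Ek Ekle] show ?thesis by (simp add: cm_def)
qed

lemma dyadic_event_holder:
  assumes "\<omega> \<in> dyadic_event g x0 L A" and "0 < g" "0 \<le> A" "0 < L"
    and "x \<in> {x0..x0 + L}" and "y \<in> {x0..x0 + L}"
  shows "\<bar>B x \<omega> - B y \<omega>\<bar> \<le> A * holder_factor g * (\<bar>x - y\<bar> / L) powr g"
  using assms continuous_paths[of \<omega>]
  by (intro dyadic_increments_imp_holder_interval) (auto simp: dyadic_event_def intro: continuous_on_subset)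

text \<open>The factor \<open>(2 powr (1/2 - g)) ^ j\<close> makes the exceptional probabilities summable in \<open>j\<close>; it
  is what turns the growth exponent \<open>1/2\<close> into \<open>1 - g\<close>.\<close>

definition growth_event :: "real \<Rightarrow> real \<Rightarrow> real \<Rightarrow> 'a set" where
  "growth_event g a lam = (\<Inter>j. dyadic_event g (2 ^ Suc j * a) (2 ^ Suc j * (- a))
     (lam * (2 powr (1/2 - g)) ^ j * sqrt (2 ^ Suc j * (- a))))"

lemma growth_event_sets[measurable]: "growth_event g a lam \<in> sets M"
  unfolding growth_event_def by measurable

lemma growth_event_tail:
  assumes g: "0 < g" "2 \<le> real m * (1 - 2 * g)" and a: "a < 0" and lam: "0 < lam"
  shows "measure M (space M - growth_event g a lam) \<le> 4 * (fact (2 * m) / (2 ^ m * fact m)) / lam ^ (2 * m)"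
proof -
  define cm :: real where "cm = fact (2 * m) / (2 ^ m * fact m)"
  define r :: real where "r = 2 powr (1/2 - g)"
  have r: "0 < r" by (simp add: r_def)
  define F where "F j = space M - dyadic_event g (2 ^ Suc j * a) (2 ^ Suc j * (- a))
     (lam * r ^ j * sqrt (2 ^ Suc j * (- a)))" for j
  have F[measurable]: "F j \<in> sets M" for j unfolding F_def by measurable
  have Fle: "measure M (F j) \<le> 2 * cm / lam ^ (2 * m) * (1 / 2) ^ j" for j
  proof -
    have "measure M (F j) \<le> 2 * cm / (lam * r ^ j) ^ (2 * m)"
      unfolding F_def cm_def by (rule dyadic_event_tail) (use assms r in \<open>auto simp: mult_neg_pos\<close>)
    also have "\<dots> = 2 * cm / lam ^ (2 * m) * (1 / r ^ (2 * m)) ^ j"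
      by (simp add: power_mult_distrib power_mult[symmetric] power_one_over mult_ac)
    also have "1 / r ^ (2 * m) \<le> 1 / 2"
    proof -
      have "r ^ (2 * m) = 2 powr (real m * (1 - 2 * g))"
        by (simp add: r_def powr_power algebra_simps)
      moreover have "2 powr 1 \<le> 2 powr (real m * (1 - 2 * g))" using g by (intro powr_mono) auto
      ultimately show ?thesis by (simp add: field_simps)
    qed
    then have "2 * cm / lam ^ (2 * m) * (1 / r ^ (2 * m)) ^ j \<le> 2 * cm / lam ^ (2 * m) * (1 / 2) ^ j"
      using lam r by (intro mult_left_mono power_mono) (auto simp: cm_def)
    finally show ?thesis .
  qed
  have "space M - growth_event g a lam = (\<Union>k. F k)"
    unfolding growth_event_def F_def r_def by auto
  with measure_UN_geometric[OF F Fle] show ?thesis by (simp add: cm_def)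
qed

text \<open>Choose \<open>j\<close> with \<open>2 ^ j * (- a) \<le> - s\<close> and
  \<open>- s < 2 ^ Suc j * (- a)\<close>, and compare \<open>B s\<close> with \<open>B 0 = 0\<close>
  on the interval of length \<open>2 ^ Suc j * (- a)\<close>. There the Hoelder factor is at most 1,
  and the scale \<open>sqrt L\<close> times \<open>2 powr (j * (1/2 - g))\<close> is of order
  \<open>(2 ^ j) powr (1 - g)\<close>.\<close>

lemma growth_event_bound:
  assumes \<omega>: "\<omega> \<in> growth_event g a lam" and g: "0 < g" "g < 1/2" and a: "a < 0" and lam: "0 < lam"
    and s: "s \<le> a"
  shows "\<bar>B s \<omega>\<bar> \<le> lam * (holder_factor g * sqrt (2 * (- a)) * (- a) powr (g - 1)) * (- s) powr (1 - g)"
proof -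
  have ex: "\<exists>n. - s < 2 ^ n * (- a)"
    using real_arch_pow[of 2 "s / a"] a s by (auto simp: field_simps)
  define n where "n = (LEAST n. - s < 2 ^ n * (- a))"
  have n: "- s < 2 ^ n * (- a)" unfolding n_def by (rule LeastI_ex[OF ex])
  then have "n \<noteq> 0" using s by (intro notI) simp
  then obtain j where j: "n = Suc j" by (cases n) auto
  have j_le: "2 ^ j * (- a) \<le> - s"
    using not_less_Least[of j "\<lambda>n. - s < 2 ^ n * (- a)"] j n_def by auto
  let ?L = "2 ^ Suc j * (- a)"
  have L: "0 < ?L" using a by (simp add: mult_neg_pos)
  have "\<omega> \<in> dyadic_event g (2 ^ Suc j * a) ?L (lam * (2 powr (1/2 - g)) ^ j * sqrt ?L)"
    using \<omega> unfolding growth_event_def by blast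
  then have "\<omega> \<in> space M" and "\<bar>B s \<omega> - B 0 \<omega>\<bar> \<le> lam * (2 powr (1/2 - g)) ^ j * sqrt ?L * holder_factor g * (\<bar>s - 0\<bar> / ?L) powr g"
    using dyadic_event_holder[of \<omega> g "2 ^ Suc j * a" ?L "lam * (2 powr (1/2 - g)) ^ j * sqrt ?L" s 0] g lam a L n j s
    by (auto simp: dyadic_event_def)
  then have "\<bar>B s \<omega>\<bar> \<le> lam * (2 powr (1/2 - g)) ^ j * sqrt ?L * holder_factor g * (\<bar>s\<bar> / ?L) powr g"
    using B_zero by simp
  also have "\<dots> \<le> lam * (2 powr (1/2 - g)) ^ j * sqrt ?L * holder_factor g * 1 powr g"
    using g lam L n j s a holder_factor_pos[of g]
    by (intro mult_left_mono powr_mono2 mult_nonneg_nonneg) (auto simp: field_simps)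
  also have "\<dots> = lam * (holder_factor g * sqrt (2 * (- a))) * (2 ^ j) powr (1 - g)"
  proof -
    have "sqrt ?L = sqrt (2 * (- a)) * 2 powr (real j / 2)"
    proof -
      have "sqrt ?L = sqrt (2 * (- a)) * sqrt (2 ^ j)" by (simp add: real_sqrt_mult[symmetric] mult_ac)
      also have "sqrt (2 ^ j) = 2 powr (real j / 2)"
        by (simp add: powr_half_sqrt[symmetric] powr_realpow[symmetric] powr_powr)
      finally show ?thesis .
    qed
    moreover have "(2 powr (1/2 - g)) ^ j * 2 powr (real j / 2) = (2 ^ j) powr (1 - g)"
      by (simp add: powr_power powr_add[symmetric] powr_realpow[symmetric] powr_powr algebra_simps)
    ultimately show ?thesis by (simp add: mult_ac)
  qed
  also have "\<dots> \<le> lam * (holder_factor g * sqrt (2 * (- a))) * ((- s) / (- a)) powr (1 - g)"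
    using j_le a g lam holder_factor_pos[of g]
    by (intro mult_left_mono powr_mono2 mult_nonneg_nonneg) (auto simp: field_simps)
  also have "((- s) / (- a)) powr (1 - g) = (- a) powr (g - 1) * (- s) powr (1 - g)"
    using a s by (subst powr_divide) (auto simp: powr_diff powr_minus field_simps)
  finally show ?thesis by (simp add: mult_ac)
qed

definition regular_event :: "real \<Rightarrow> real \<Rightarrow> real \<Rightarrow> real \<Rightarrow> 'a set" where
  "regular_event g a T lam = dyadic_event g a (T - a) (lam * sqrt (T - a)) \<inter> growth_event g a lam"

lemma regular_event_sets[measurable]: "regular_event g a T lam \<in> sets M"
  unfolding regular_event_def by measurable

lemma regular_event_tail:
  assumes "0 < g" "2 \<le> real m * (1 - 2 * g)" and "a < 0" "a < T" and "0 < lam"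
  shows "measure M (space M - regular_event g a T lam) \<le> 6 * (fact (2 * m) / (2 ^ m * fact m)) / lam ^ (2 * m)"
proof -
  let ?G1 = "dyadic_event g a (T - a) (lam * sqrt (T - a))" and ?G2 = "growth_event g a lam"
    and ?cm = "fact (2 * m) / (2 ^ m * fact m) :: real"
  have "measure M (space M - regular_event g a T lam) = measure M ((space M - ?G1) \<union> (space M - ?G2))"
    by (simp add: regular_event_def Diff_Int)
  also have "\<dots> \<le> measure M (space M - ?G1) + measure M (space M - ?G2)"
    by (rule measure_Un_le) auto
  also have "\<dots> \<le> 2 * ?cm / lam ^ (2 * m) + 4 * ?cm / lam ^ (2 * m)"
    using assms by (intro add_mono dyadic_event_tail growth_event_tail) auto
  finally show ?thesis by (simp add: add_divide_distrib[symmetric])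
qed

definition regular_const :: "real \<Rightarrow> real \<Rightarrow> real \<Rightarrow> real" where
  "regular_const g a T = sqrt (T - a) * holder_factor g * (1 / (T - a)) powr g +
     holder_factor g * sqrt (2 * (- a)) * (- a) powr (g - 1)"

lemma regular_event_bounds:
  assumes w: "\<omega> \<in> regular_event g a T lam" and g: "0 < g" "g < 1/2" and a: "a < 0" "a < T" and lam: "0 < lam"
  shows "x \<in> {a..T} \<Longrightarrow> y \<in> {a..T} \<Longrightarrow> \<bar>B x \<omega> - B y \<omega>\<bar> \<le> regular_const g a T * lam * \<bar>x - y\<bar> powr g"
    and "s \<le> a \<Longrightarrow> \<bar>B s \<omega>\<bar> \<le> regular_const g a T * lam * (- s) powr (1 - g)"
proof -
  define k1 where "k1 = sqrt (T - a) * holder_factor g * (1 / (T - a)) powr g"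
  define k2 where "k2 = holder_factor g * sqrt (2 * (- a)) * (- a) powr (g - 1)"
  have c: "regular_const g a T = k1 + k2" by (simp add: regular_const_def k1_def k2_def)
  have pos: "0 < k1" "0 < k2" using a holder_factor_pos[OF g(1)] by (auto simp: k1_def k2_def)
  show "\<bar>B x \<omega> - B y \<omega>\<bar> \<le> regular_const g a T * lam * \<bar>x - y\<bar> powr g" if "x \<in> {a..T}" "y \<in> {a..T}"
  proof -
    have "\<bar>B x \<omega> - B y \<omega>\<bar> \<le> lam * sqrt (T - a) * holder_factor g * (\<bar>x - y\<bar> / (T - a)) powr g"
      using w that a g lam by (intro dyadic_event_holder[where ?x0.0=a]) (auto simp: regular_event_def)
    also have "\<dots> = k1 * lam * \<bar>x - y\<bar> powr g"
      using a by (simp add: k1_def powr_divide)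
    also have "\<dots> \<le> (k1 + k2) * lam * \<bar>x - y\<bar> powr g"
      using pos lam by (intro mult_right_mono) auto
    finally show ?thesis unfolding c .
  qed
  show "\<bar>B s \<omega>\<bar> \<le> regular_const g a T * lam * (- s) powr (1 - g)" if "s \<le> a"
  proof -
    have "\<bar>B s \<omega>\<bar> \<le> lam * k2 * (- s) powr (1 - g)"
      unfolding k2_def by (rule growth_event_bound) (use w g a lam that in \<open>auto simp: regular_event_def\<close>)
    also have "\<dots> \<le> (k1 + k2) * lam * (- s) powr (1 - g)"
      using pos lam by (simp add: distrib_right)
    finally show ?thesis unfolding c .
  qed
qed

end

section \<open>Lebesgue--Stieltjes integrals with Lipschitz integrators\<close>

lemma variation_sums:
  fixes G :: "real \<Rightarrow> real"
  assumes lip: "\<And>x y. x \<in> {l..u} \<Longrightarrow> y \<in> {l..u} \<Longrightarrow> \<bar>G x - G y\<bar> \<le> K * \<bar>x - y\<bar>"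
    and xs: "l \<le> x" "x \<le> u" and p: "mono p" "range p \<subseteq> {l..x}"
  shows "(\<Sum>i<N. \<bar>G (p (Suc i)) - G (p i)\<bar>) \<le> K * (p N - p 0)"
proof -
  have "(\<Sum>i<N. \<bar>G (p (Suc i)) - G (p i)\<bar>) \<le> (\<Sum>i<N. K * (p (Suc i) - p i))"
  proof (rule sum_mono)
    fix i
    have "p i \<in> {l..u}" "p (Suc i) \<in> {l..u}" "p i \<le> p (Suc i)" using p xs by (auto simp: image_subset_iff mono_def intro: order_trans)
    then show "\<bar>G (p (Suc i)) - G (p i)\<bar> \<le> K * (p (Suc i) - p i)" using lip[of "p (Suc i)" "p i"] by simp
  qed
  also have "\<dots> = K * (p N - p 0)" by (simp add: sum_distrib_left[symmetric] sum_lessThan_telescope)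
  finally show ?thesis .
qed

lemma total_variation_upper:
  fixes G :: "real \<Rightarrow> real"
  assumes "l \<le> x"
    and "\<And>N p. mono p \<Longrightarrow> range p \<subseteq> {l..x} \<Longrightarrow> (\<Sum>i<N. \<bar>G (p (Suc i)) - G (p i)\<bar>) \<le> b"
  shows "total_variation G l x \<le> b"
  unfolding total_variation_def
proof (rule cSUP_least)
  have "(0, \<lambda>_. l) \<in> {(N, p). mono p \<and> range p \<subseteq> {l..x}}" using assms(1) by (auto simp: mono_def)
  then show "{(N :: nat, p :: nat \<Rightarrow> real). mono p \<and> range p \<subseteq> {l..x}} \<noteq> {}" by blast
qed (use assms in auto)

text \<open>The Lipschitz bound \<open>K * (x - l)\<close> on all variation sums makes the real
  supremum in \<open>total_variation\<close> a genuine upper bound.\<close>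

lemma total_variation_lower:
  fixes G :: "real \<Rightarrow> real"
  assumes lip: "\<And>x y. x \<in> {l..u} \<Longrightarrow> y \<in> {l..u} \<Longrightarrow> \<bar>G x - G y\<bar> \<le> K * \<bar>x - y\<bar>"
    and K: "0 \<le> K" and xs: "l \<le> x" "x \<le> u" and p: "mono p" "range p \<subseteq> {l..x}"
  shows "(\<Sum>i<N. \<bar>G (p (Suc i)) - G (p i)\<bar>) \<le> total_variation G l x"
proof -
  have "bdd_above ((\<lambda>(N, p). \<Sum>i<N. \<bar>G (p (Suc i)) - G (p i)\<bar>) ` {(N :: nat, p :: nat \<Rightarrow> real). mono p \<and> range p \<subseteq> {l..x}})"
  proof (rule bdd_aboveI2[of _ _ "K * (x - l)"], clarify)
    fix N :: nat and q :: "nat \<Rightarrow> real" assume q: "mono q" "range q \<subseteq> {l..x}"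
    have "(\<Sum>i<N. \<bar>G (q (Suc i)) - G (q i)\<bar>) \<le> K * (q N - q 0)"
      by (rule variation_sums[OF lip xs q])
    also have "\<dots> \<le> K * (x - l)"
    proof -
      have "q N \<le> x" "l \<le> q 0" using q by (auto simp: image_subset_iff)
      then show ?thesis using K by (intro mult_left_mono) auto
    qed
    finally show "(\<Sum>i<N. \<bar>G (q (Suc i)) - G (q i)\<bar>) \<le> K * (x - l)" .
  qed
  from cSUP_upper[OF _ this, of "(N, p)"] p show ?thesis by (simp add: total_variation_def)
qed

text \<open>Halved, this says that the positive and the negative variation are both nondecreasing,
  as \<open>interval_measure\<close> demands.\<close>

lemma total_variation_superadditive:
  fixes G :: "real \<Rightarrow> real"
  assumes lip: "\<And>x y. x \<in> {l..u} \<Longrightarrow> y \<in> {l..u} \<Longrightarrow> \<bar>G x - G y\<bar> \<le> K * \<bar>x - y\<bar>"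
    and K: "0 \<le> K" and xy: "l \<le> x" "x \<le> y" "y \<le> u"
  shows "total_variation G l x + \<bar>G y - G x\<bar> \<le> total_variation G l y"
proof -
  have "total_variation G l x \<le> total_variation G l y - \<bar>G y - G x\<bar>"
  proof (rule total_variation_upper[OF xy(1)])
    fix N and p :: "nat \<Rightarrow> real" assume p: "mono p" "range p \<subseteq> {l..x}"
    \<comment> \<open>The sum only sees \<open>p\<close> up to index \<open>N\<close>; from there
      the partition is continued by \<open>x\<close> and then stays at \<open>y\<close>, which adds
      the increment from \<open>x\<close> to \<open>y\<close> as the last of \<open>N + 2\<close>
      terms.\<close>
    define q where "q i = (if i \<le> N then p i else if i = Suc N then x else y)" for i
    have px: "p i \<le> x" "l \<le> p i" "p i \<le> y" for i
      using p xy by (auto simp: image_subset_iff intro: order_trans)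
    have "mono q"
      using p px xy by (intro monoI) (auto simp: q_def mono_def intro: order_trans)
    moreover have "range q \<subseteq> {l..y}" using px xy by (auto simp: q_def intro: order_trans)
    ultimately have "(\<Sum>i<Suc (Suc N). \<bar>G (q (Suc i)) - G (q i)\<bar>) \<le> total_variation G l y"
      using xy by (intro total_variation_lower[OF lip K]) auto
    moreover have "(\<Sum>i<N. \<bar>G (q (Suc i)) - G (q i)\<bar>) = (\<Sum>i<N. \<bar>G (p (Suc i)) - G (p i)\<bar>)"
      by (intro sum.cong) (auto simp: q_def)
    moreover have "q (Suc N) = x" "q (Suc (Suc N)) = y" by (auto simp: q_def)
    ultimately show "(\<Sum>i<N. \<bar>G (p (Suc i)) - G (p i)\<bar>) \<le> total_variation G l y - \<bar>G y - G x\<bar>"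
      by simp
  qed
  then show ?thesis by simp
qed

text \<open>Each partition of \<open>[l, y]\<close> is cut at \<open>x\<close>: the points
  \<open>min (p i) x\<close> form a partition of \<open>[l, x]\<close>, and the rest costs at most
  \<open>K\<close> per unit length of \<open>max (p i) x\<close>. Together with monotonicity this
  yields the right-continuity required by \<open>interval_measure\<close>.\<close>

lemma total_variation_lipschitz:
  fixes G :: "real \<Rightarrow> real"
  assumes lip: "\<And>x y. x \<in> {l..u} \<Longrightarrow> y \<in> {l..u} \<Longrightarrow> \<bar>G x - G y\<bar> \<le> K * \<bar>x - y\<bar>"
    and K: "0 \<le> K" and xy: "l \<le> x" "x \<le> y" "y \<le> u"
  shows "total_variation G l y \<le> total_variation G l x + K * (y - x)"
proof (rule total_variation_upper)
  show "l \<le> y" using xy by simp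
  fix N and p :: "nat \<Rightarrow> real" assume p: "mono p" "range p \<subseteq> {l..y}"
  define q where "q i = min (p i) x" for i
  have pl: "l \<le> p i" "p i \<le> y" "p i \<le> p (Suc i)" for i using p by (auto simp: mono_def image_subset_iff)
  have "mono q" using p(1) by (intro monoI) (auto simp: q_def mono_def min_le_iff_disj)
  moreover have "range q \<subseteq> {l..x}" using pl xy by (auto simp: q_def)
  ultimately have q: "(\<Sum>i<N. \<bar>G (q (Suc i)) - G (q i)\<bar>) \<le> total_variation G l x"
    using xy by (intro total_variation_lower[OF lip K]) auto
  have "(\<Sum>i<N. \<bar>G (p (Suc i)) - G (p i)\<bar>) \<le>
     (\<Sum>i<N. \<bar>G (q (Suc i)) - G (q i)\<bar> + K * (max (p (Suc i)) x - max (p i) x))"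
  proof (rule sum_mono)
    fix i
    consider "p (Suc i) \<le> x" | "p i \<le> x" "x < p (Suc i)" | "x < p i" using pl[of i] by linarith
    then show "\<bar>G (p (Suc i)) - G (p i)\<bar> \<le> \<bar>G (q (Suc i)) - G (q i)\<bar> + K * (max (p (Suc i)) x - max (p i) x)"
    proof cases
      case 1 then show ?thesis using pl[of i] by (simp add: q_def)
    next
      case 2
      have "\<bar>G (p (Suc i)) - G x\<bar> \<le> K * \<bar>p (Suc i) - x\<bar>" using lip[of "p (Suc i)" x] pl[of "Suc i"] xy by auto
      then show ?thesis using 2 by (simp add: q_def)
    next
      case 3
      have "\<bar>G (p (Suc i)) - G (p i)\<bar> \<le> K * \<bar>p (Suc i) - p i\<bar>" using lip[of "p (Suc i)" "p i"] pl[of i] pl[of "Suc i"] xy by auto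
      then show ?thesis using 3 pl[of i] by (simp add: q_def)
    qed
  qed
  also have "\<dots> = (\<Sum>i<N. \<bar>G (q (Suc i)) - G (q i)\<bar>) + K * (max (p N) x - max (p 0) x)"
    by (simp add: sum.distrib sum_distrib_left[symmetric] sum_lessThan_telescope[of "\<lambda>i. max (p i) x"])
  also have "\<dots> \<le> total_variation G l x + K * (y - x)"
    using q pl[of N] xy K by (intro add_mono mult_left_mono) auto
  finally show "(\<Sum>i<N. \<bar>G (p (Suc i)) - G (p i)\<bar>) \<le> total_variation G l x + K * (y - x)" .
qed

text \<open>Integration by parts in the form of Fubini on the region \<open>u - s < x\<close>: for
  fixed \<open>s\<close> the section in \<open>x\<close> gives \<open>h s - k\<close>, for fixed
  \<open>x\<close> the section in \<open>s\<close> is \<open>(u - x, u]\<close>, whose measure is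
  the increment of \<open>P\<close>.\<close>

lemma interval_measure_superposition:
  fixes P :: "real \<Rightarrow> real" and eta :: "real \<Rightarrow> real"
  assumes mono: "\<And>x y. x \<le> y \<Longrightarrow> P x \<le> P y" and cont: "\<And>x. continuous (at_right x) P"
    and L: "0 \<le> L" and eta: "set_integrable lborel {0<..<L} eta"
    and h: "\<And>s. s \<in> {u - L<..u} \<Longrightarrow> h s = k + (LBINT x:{u - s<..<L}. eta x)"
  shows "(LINT s:{u - L<..u}|interval_measure P. h s) =
     k * (P u - P (u - L)) + (LBINT x:{0<..<L}. eta x * (P u - P (u - x)))"
    and "set_integrable lborel {0<..<L} (\<lambda>x. eta x * (P u - P (u - x)))"
proof -
  let ?m = "interval_measure P" and ?I = "{u - L<..u}"
  interpret m: sigma_finite_measure ?m by (rule sigma_finite_interval_measure[OF mono cont])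
  interpret p: pair_sigma_finite ?m lborel ..
  have em: "emeasure ?m {a<..b} = ennreal (P b - P a)" if "a \<le> b" for a b
    by (rule emeasure_interval_measure_Ioc[OF that mono cont])
  have mm: "measure ?m {a<..b} = P b - P a" if "a \<le> b" for a b
    using em[OF that] mono[OF that] by (simp add: measure_def)
  define e where "e x = indicator {0<..<L} x * eta x" for x
  have e: "integrable lborel e" using eta by (simp add: set_integrable_def e_def[abs_def])
  then have [measurable]: "e \<in> borel_measurable borel" by auto
  define f where "f = (\<lambda>(s, x). indicator ?I s * (e x * indicator {x. u - s < x} x))"
  have f_meas[measurable]: "f \<in> borel_measurable (?m \<Otimes>\<^sub>M lborel)" unfolding f_def by measurable
  have iI: "integrable ?m (indicator ?I :: real \<Rightarrow> real)"
    using em[of "u - L" u] L by (intro integrable_real_indicator) auto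
  have f_int: "integrable (?m \<Otimes>\<^sub>M lborel) f"
  proof (rule Bochner_Integration.integrable_bound[of _ "\<lambda>(s, x). indicator ?I s * e x"])
    show "integrable (?m \<Otimes>\<^sub>M lborel) (\<lambda>(s, x). indicator ?I s * e x)"
    proof (rule p.Fubini_integrable)
      have "(\<lambda>s. \<integral>y. norm (case (s, y) of (s, x) \<Rightarrow> indicator ?I s * e x) \<partial>lborel) = (\<lambda>s. indicator ?I s * (\<integral>y. \<bar>e y\<bar> \<partial>lborel))"
        by (simp add: abs_mult)
      then show "integrable ?m (\<lambda>s. \<integral>y. norm (case (s, y) of (s, x) \<Rightarrow> indicator ?I s * e x) \<partial>lborel)"
        using iI by simp
      show "AE s in ?m. integrable lborel (\<lambda>y. case (s, y) of (s, x) \<Rightarrow> indicator ?I s * e x)"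
        using e by simp
    qed measurable
  qed (auto simp: f_def indicator_def abs_mult)
  have inner1: "(\<integral>x. f (s, x) \<partial>lborel) = indicator ?I s * (h s - k)" for s
  proof (cases "s \<in> ?I")
    case True
    then have "h s - k = (\<integral>x. e x * indicator {x. u - s < x} x \<partial>lborel)"
      using h[OF True] by (auto simp: set_lebesgue_integral_def e_def indicator_def intro!: Bochner_Integration.integral_cong)
    then show ?thesis by (simp add: f_def)
  qed (simp add: f_def)
  have inner2: "(\<integral>s. f (s, x) \<partial>?m) = e x * (P u - P (u - x))" for x
  proof (cases "x \<in> {0<..<L}")
    case True
    then have eq: "indicator ?I s * (e x * indicator {x. u - s < x} x) = e x * indicator {u - x<..u} s" for s
      by (auto simp: indicator_def)
    have "(\<integral>s. f (s, x) \<partial>?m) = e x * measure ?m {u - x<..u}"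
      unfolding f_def prod.case eq by simp
    also have "measure ?m {u - x<..u} = P u - P (u - x)" using True by (intro mm) auto
    finally show ?thesis .
  qed (simp add: f_def e_def)
  have int1: "integrable ?m (\<lambda>s. indicator ?I s * (h s - k))"
    using p.integrable_fst'[OF f_int] by (simp add: inner1)
  have "(LINT s:?I|?m. h s) = (\<integral>s. indicator ?I s * (h s - k) + k * indicator ?I s \<partial>?m)"
    by (simp add: set_lebesgue_integral_def algebra_simps)
  also have "\<dots> = (\<integral>s. indicator ?I s * (h s - k) \<partial>?m) + k * measure ?m ?I"
    using int1 iI by simp
  also have "(\<integral>s. indicator ?I s * (h s - k) \<partial>?m) = (\<integral>s. (\<integral>x. f (s, x) \<partial>lborel) \<partial>?m)"
    by (simp add: inner1)
  also have "\<dots> = (\<integral>x. (\<integral>s. f (s, x) \<partial>?m) \<partial>lborel)"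
    using p.Fubini_integral[of "\<lambda>s x. f (s, x)"] f_int by simp
  also have "\<dots> = (LBINT x:{0<..<L}. eta x * (P u - P (u - x)))"
    by (simp add: inner2 set_lebesgue_integral_def e_def mult.assoc)
  finally show "(LINT s:?I|?m. h s) = k * (P u - P (u - L)) + (LBINT x:{0<..<L}. eta x * (P u - P (u - x)))"
    using mm[of "u - L" u] L by simp
  have "integrable lborel (\<lambda>x. \<integral>s. f (s, x) \<partial>?m)"
    using p.integrable_snd[of "\<lambda>s x. f (s, x)"] f_int by simp
  then show "set_integrable lborel {0<..<L} (\<lambda>x. eta x * (P u - P (u - x)))"
    by (simp add: inner2 set_integrable_def e_def mult.assoc)
qed

text \<open>Only the difference of the positive and the negative variation enters the result, so that
  Lipschitz continuity of the variation is all that has to be known about it.\<close>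

lemma ls_integral_superposition:
  fixes z :: "real \<Rightarrow> real"
  assumes lip: "\<And>x y. x \<in> {u - L..u} \<Longrightarrow> y \<in> {u - L..u} \<Longrightarrow> \<bar>z x - z y\<bar> \<le> K * \<bar>x - y\<bar>"
    and K: "0 \<le> K" and L: "0 \<le> L" and eta: "set_integrable lborel {0<..<L} eta"
    and h: "\<And>s. s \<in> {u - L<..u} \<Longrightarrow> h s = k + (LBINT x:{u - s<..<L}. eta x)"
  shows "ls_integral (u - L) u h z = k * (z u - z (u - L)) + (LBINT x:{0<..<L}. eta x * (z u - z (u - x)))"
proof -
  let ?l = "u - L"
  define c where "c x = max ?l (min u x)" for x
  have c: "c x \<in> {?l..u}" "x \<le> y \<Longrightarrow> c x \<le> c y" "x \<le> y \<Longrightarrow> c y - c x \<le> y - x" for x y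
    using L by (auto simp: c_def)
  define P where "P = (\<lambda>x. (total_variation z ?l (c x) + z (c x)) / 2)"
  define N where "N = (\<lambda>x. (total_variation z ?l (c x) - z (c x)) / 2)"
  have tv: "\<bar>z (c y) - z (c x)\<bar> \<le> total_variation z ?l (c y) - total_variation z ?l (c x)"
    "total_variation z ?l (c y) - total_variation z ?l (c x) \<le> K * (y - x)"
    if "x \<le> y" for x y
  proof -
    have "c x \<in> {?l..u}" "c y \<in> {?l..u}" "c x \<le> c y" "K * (c y - c x) \<le> K * (y - x)"
      using c K that by (auto intro: mult_left_mono)
    then show "\<bar>z (c y) - z (c x)\<bar> \<le> total_variation z ?l (c y) - total_variation z ?l (c x)"
      "total_variation z ?l (c y) - total_variation z ?l (c x) \<le> K * (y - x)"
      using total_variation_superadditive[of ?l u z K "c x" "c y", OF lip K]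
       total_variation_lipschitz[of ?l u z K "c x" "c y", OF lip K] by auto
  qed
  have lipcont: "continuous (at_right x) Q"
    if Q: "\<And>x y. x \<le> y \<Longrightarrow> 0 \<le> Q y - Q x \<and> Q y - Q x \<le> K * (y - x)" for Q :: "real \<Rightarrow> real" and x
  proof -
    have "(Q \<longlongrightarrow> Q x) (at_right x)"
    proof (rule tendsto_sandwich)
      show "\<forall>\<^sub>F y in at_right x. Q x \<le> Q y" "\<forall>\<^sub>F y in at_right x. Q y \<le> Q x + K * (y - x)"
        using Q[of x] by (auto simp: eventually_at_filter intro!: always_eventually) (smt (verit))+
      have "((\<lambda>y. Q x + K * (y - x)) \<longlongrightarrow> Q x + K * (x - x)) (at_right x)" by (intro tendsto_intros)
      then show "((\<lambda>y. Q x + K * (y - x)) \<longlongrightarrow> Q x) (at_right x)" by simp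
    qed simp
    then show ?thesis by (simp add: continuous_within)
  qed
  have P: "0 \<le> P y - P x \<and> P y - P x \<le> K * (y - x)" if "x \<le> y" for x y
    using tv[OF that] unfolding P_def by (simp add: field_simps abs_le_iff) linarith
  have N: "0 \<le> N y - N x \<and> N y - N x \<le> K * (y - x)" if "x \<le> y" for x y
    using tv[OF that] unfolding N_def by (simp add: field_simps abs_le_iff) linarith
  have Pm: "\<And>x y. x \<le> y \<Longrightarrow> P x \<le> P y" and Nm: "\<And>x y. x \<le> y \<Longrightarrow> N x \<le> N y"
    using P N by fastforce+
  note PI = interval_measure_superposition[OF Pm lipcont[OF P] L eta h]
  note NI = interval_measure_superposition[OF Nm lipcont[OF N] L eta h]
  have PN: "P u - P (u - x) - (N u - N (u - x)) = z u - z (u - x)" if "x \<in> {0..L}" for x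
    using that by (cases "x = 0") (simp_all add: P_def N_def c_def field_simps min_def max_def)
  have "ls_integral ?l u h z = (LINT s:{?l<..u}|interval_measure P. h s) - (LINT s:{?l<..u}|interval_measure N. h s)"
    by (simp add: ls_integral_def Let_def P_def N_def c_def)
  also have "\<dots> = k * (P u - P ?l - (N u - N ?l)) + ((LBINT x:{0<..<L}. eta x * (P u - P (u - x)))
      - (LBINT x:{0<..<L}. eta x * (N u - N (u - x))))"
    using PI(1) NI(1) by (simp only: right_diff_distrib[of k])
  also have "(LBINT x:{0<..<L}. eta x * (P u - P (u - x))) - (LBINT x:{0<..<L}. eta x * (N u - N (u - x)))
    = (LBINT x:{0<..<L}. eta x * (P u - P (u - x)) - eta x * (N u - N (u - x)))"
    by (rule set_integral_diff(2)[symmetric, OF PI(2) NI(2)])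
  also have "\<dots> = (LBINT x:{0<..<L}. eta x * (z u - z (u - x)))"
  proof (rule set_lebesgue_integral_cong)
    show "\<forall>x. x \<in> {0<..<L} \<longrightarrow> eta x * (P u - P (u - x)) - eta x * (N u - N (u - x)) = eta x * (z u - z (u - x))"
      using PN by (metis greaterThanLessThan_subseteq_atLeastAtMost_iff order_refl right_diff_distrib subsetD)
  qed simp
  also have "P u - P ?l - (N u - N ?l) = z u - z ?l" using PN[of L] L by simp
  finally show ?thesis .
qed

section \<open>Power kernels integrated by parts\<close>

lemma set_integral_abs_le:
  fixes f g :: "real \<Rightarrow> real"
  assumes g: "set_integrable lborel A g" and le: "\<And>x. x \<in> A \<Longrightarrow> \<bar>f x\<bar> \<le> g x"
  shows "\<bar>LBINT x:A. f x\<bar> \<le> (LBINT x:A. g x)"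
proof -
  have "\<bar>LBINT x:A. f x\<bar> \<le> (\<integral>x. \<bar>indicator A x *\<^sub>R f x\<bar> \<partial>lborel)"
    unfolding set_lebesgue_integral_def by (rule integral_abs_bound)
  also have "\<dots> \<le> (LBINT x:A. g x)"
    unfolding set_lebesgue_integral_def
    by (rule integral_mono') (use assms in \<open>auto simp: set_integrable_def indicator_def intro: order_trans[OF abs_ge_zero]\<close>)
  finally show ?thesis .
qed

text \<open>Because the integrand is nonnegative, the fundamental theorem of calculus delivers
  integrability together with the value. If \<open>c + y = 0\<close>, the antiderivative still has a
  limit at the left end since \<open>p + 1\<close> is positive.\<close>

lemma powr_integral:
  fixes c p y L :: real
  assumes "0 \<le> c" "0 \<le> y" "y \<le> L" and p: "p \<noteq> - 1" and sing: "0 < c + y \<or> - 1 < p"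
  shows "set_integrable lborel {y<..<L} (\<lambda>x. (c + x) powr p)"
    and "(LBINT x:{y<..<L}. (c + x) powr p) = ((c + L) powr (p + 1) - (c + y) powr (p + 1)) / (p + 1)"
proof -
  define F where "F x = (c + x) powr (p + 1) / (p + 1)" for x
  have lim: "(F \<longlongrightarrow> F x0) (at x0 within S)" if "y \<le> x0" "S \<subseteq> {y..}" for x0 S
    unfolding F_def
  proof (intro tendsto_divide tendsto_powr' tendsto_intros)
    show "c + x0 \<noteq> 0 \<or> 0 < p + 1 \<and> (\<forall>\<^sub>F x in at x0 within S. 0 \<le> c + x)"
      using assms that by (auto simp: eventually_at_filter intro!: always_eventually)
  qed (use p in auto)
  have main: "set_integrable lborel (einterval y L) (\<lambda>x. (c + x) powr p)"
    "(LBINT x=y..L. (c + x) powr p) = F L - F y" if yL: "y < L"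
  proof -
    have 1: "ereal y < ereal L" using yL by simp
    have 2: "DERIV F x :> (c + x) powr p" if "ereal y < ereal x" "ereal x < ereal L" for x
      unfolding F_def by (rule derivative_eq_intros refl | use assms that in simp)+
    have 3: "isCont (\<lambda>x. (c + x) powr p) x" if "ereal y < ereal x" "ereal x < ereal L" for x
      using assms that by (intro continuous_intros) auto
    have 4: "AE x in lborel. ereal y < ereal x \<longrightarrow> ereal x < ereal L \<longrightarrow> 0 \<le> (c + x) powr p" by simp
    have 5: "((F \<circ> real_of_ereal) \<longlongrightarrow> F y) (at_right (ereal y))"
      unfolding ereal_tendsto_simps by (rule lim) auto
    have 6: "((F \<circ> real_of_ereal) \<longlongrightarrow> F L) (at_left (ereal L))"
    proof -
      have "isCont F L"
        unfolding F_def using assms yL by (intro continuous_intros) auto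
      then show ?thesis unfolding ereal_tendsto_simps
        by (auto simp: isCont_def intro: filterlim_at_split[THEN iffD1, THEN conjunct1])
    qed
    show "set_integrable lborel (einterval y L) (\<lambda>x. (c + x) powr p)"
      "(LBINT x=y..L. (c + x) powr p) = F L - F y"
      using interval_integral_FTC_nonneg[OF 1 2 3 4 5 6] by blast+
  qed
  show "set_integrable lborel {y<..<L} (\<lambda>x. (c + x) powr p)"
    using main(1) assms by (cases "y < L") (auto simp: set_integrable_def)
  show "(LBINT x:{y<..<L}. (c + x) powr p) = ((c + L) powr (p + 1) - (c + y) powr (p + 1)) / (p + 1)"
    using main(2) assms p by (cases "y < L") (auto simp: interval_lebesgue_integral_def F_def diff_divide_distrib set_lebesgue_integral_def)
qed

text \<open>The integral of \<open>(c + u - s) powr al\<close> over \<open>[u - L, u]\<close> with respect to \<open>b\<close>, integrated by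
  parts so that the increments of \<open>b\<close> vanish at the singularity \<open>s = u\<close>.\<close>

definition powr_increment :: "real \<Rightarrow> real \<Rightarrow> real \<Rightarrow> real \<Rightarrow> (real \<Rightarrow> real) \<Rightarrow> real" where
  "powr_increment al c u L b = (c + L) powr al * (b u - b (u - L)) +
     (LBINT x:{0<..<L}. - al * (c + x) powr (al - 1) * (b u - b (u - x)))"

text \<open>With \<open>y = u - s\<close> this represents \<open>(c + u - s) powr al\<close> as the
  constant \<open>(c + L) powr al\<close> plus the integral of a density over
  \<open>(u - s, L)\<close>, the form required for integration by parts.\<close>

lemma kernel_integral:
  fixes al c y L :: real
  assumes "0 \<le> c" "0 \<le> y" "y \<le> L" "al \<noteq> 0" and "0 < c + y \<or> 0 < al"
  shows "set_integrable lborel {y<..<L} (\<lambda>x. - al * (c + x) powr (al - 1))"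
    and "(LBINT x:{y<..<L}. - al * (c + x) powr (al - 1)) = (c + y) powr al - (c + L) powr al"
proof -
  have h: "al - 1 \<noteq> - 1" "0 < c + y \<or> - 1 < al - 1" using assms by auto
  note I = powr_integral[OF assms(1-3) h]
  show "set_integrable lborel {y<..<L} (\<lambda>x. - al * (c + x) powr (al - 1))"
    by (rule set_integrable_mult_right) (rule I(1))
  have "(LBINT x:{y<..<L}. - al * (c + x) powr (al - 1)) = - al * (LBINT x:{y<..<L}. (c + x) powr (al - 1))"
    by (rule set_integral_mult_right)
  also have "\<dots> = (c + y) powr al - (c + L) powr al"
    unfolding I(2) using assms(4) by (simp add: field_simps)
  finally show "(LBINT x:{y<..<L}. - al * (c + x) powr (al - 1)) = (c + y) powr al - (c + L) powr al" .
qed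

section \<open>Hoelder paths against power kernels\<close>

definition holder_on :: "real \<Rightarrow> real \<Rightarrow> real \<Rightarrow> real \<Rightarrow> (real \<Rightarrow> real) \<Rightarrow> bool" where
  "holder_on g K l u b \<longleftrightarrow> 0 \<le> K \<and> (\<forall>x\<in>{l..u}. \<forall>y\<in>{l..u}. \<bar>b x - b y\<bar> \<le> K * \<bar>x - y\<bar> powr g)"

lemma holder_onD: "holder_on g K l u b \<Longrightarrow> x \<in> {l..u} \<Longrightarrow> y \<in> {l..u} \<Longrightarrow> \<bar>b x - b y\<bar> \<le> K * \<bar>x - y\<bar> powr g"
  by (simp add: holder_on_def)

lemma holder_on_subset: "holder_on g K l u b \<Longrightarrow> l \<le> l' \<Longrightarrow> u' \<le> u \<Longrightarrow> holder_on g K l' u' b"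
  by (auto simp: holder_on_def)

lemma holder_on_continuous:
  assumes "holder_on g K l u b" "0 < g"
  shows "continuous_on {l..u} b"
  unfolding continuous_on_def
proof
  fix x assume x: "x \<in> {l..u}"
  have "((\<lambda>y. K * \<bar>y - x\<bar> powr g) \<longlongrightarrow> K * \<bar>x - x\<bar> powr g) (at x within {l..u})"
    using assms(2) by (intro tendsto_intros tendsto_powr') auto
  then have "((\<lambda>y. K * \<bar>y - x\<bar> powr g) \<longlongrightarrow> 0) (at x within {l..u})" by simp
  moreover have "\<forall>\<^sub>F y in at x within {l..u}. norm (b y - b x) \<le> K * \<bar>y - x\<bar> powr g"
    using holder_onD[OF assms(1)] x by (auto simp: eventually_at_filter)
  ultimately have "((\<lambda>y. b y - b x) \<longlongrightarrow> 0) (at x within {l..u})"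
    by (rule Lim_null_comparison[rotated])
  then show "(b \<longlongrightarrow> b x) (at x within {l..u})" by (simp add: LIM_zero_iff)
qed

text \<open>Puts transport paths, which are Hoelder of order 1, on the same footing as Brownian
  paths. The constant, which grows with \<open>K\<close>, serves integrability and stays out of the
  error estimates.\<close>

lemma lipschitz_imp_holder_on:
  assumes lip: "\<And>x y. x \<in> {l..u} \<Longrightarrow> y \<in> {l..u} \<Longrightarrow> \<bar>z x - z y\<bar> \<le> K * \<bar>x - y\<bar>" and "0 \<le> K"
    and g: "0 < g" "g < 1"
  shows "holder_on g (K * \<bar>u - l\<bar> powr (1 - g)) l u z"
  unfolding holder_on_def
proof (intro conjI ballI)
  fix x y assume xy: "x \<in> {l..u}" "y \<in> {l..u}"
  have "\<bar>z x - z y\<bar> \<le> K * \<bar>x - y\<bar>" by (rule lip[OF xy])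
  also have "\<bar>x - y\<bar> = \<bar>x - y\<bar> powr (1 - g) * \<bar>x - y\<bar> powr g"
    by (cases "x = y") (simp_all add: powr_add[symmetric])
  also have "K * (\<bar>x - y\<bar> powr (1 - g) * \<bar>x - y\<bar> powr g) \<le> K * (\<bar>u - l\<bar> powr (1 - g) * \<bar>x - y\<bar> powr g)"
    using assms xy by (intro mult_left_mono mult_right_mono powr_mono2) auto
  finally show "\<bar>z x - z y\<bar> \<le> K * \<bar>u - l\<bar> powr (1 - g) * \<bar>x - y\<bar> powr g" by simp
qed (use assms in auto)

text \<open>A shift \<open>c \<ge> 0\<close> only lowers the power with negative exponent
  \<open>al - 1\<close>, so the majorant is uniform in \<open>c\<close>. It is integrable at 0 as
  soon as \<open>0 < al + g\<close>.\<close>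

lemma increment_kernel_bound:
  assumes b: "holder_on g K (u - L) u b" and c: "0 \<le> c" and al: "al < 1" and x: "x \<in> {0<..<L}"
  shows "\<bar>- al * (c + x) powr (al - 1) * (b u - b (u - x))\<bar> \<le> \<bar>al\<bar> * K * x powr (al + g - 1)"
proof -
  have "\<bar>b u - b (u - x)\<bar> \<le> K * \<bar>u - (u - x)\<bar> powr g" by (rule holder_onD[OF b]) (use x in auto)
  then have b': "\<bar>b u - b (u - x)\<bar> \<le> K * x powr g" using x by simp
  have k: "(c + x) powr (al - 1) \<le> x powr (al - 1)"
    using c al x by (intro powr_mono2') auto
  have K: "0 \<le> K" using b by (simp add: holder_on_def)
  have "\<bar>- al * (c + x) powr (al - 1) * (b u - b (u - x))\<bar> = \<bar>al\<bar> * ((c + x) powr (al - 1) * \<bar>b u - b (u - x)\<bar>)"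
    by (simp add: abs_mult)
  also have "\<dots> \<le> \<bar>al\<bar> * (x powr (al - 1) * (K * x powr g))"
    using k b' by (intro mult_left_mono mult_mono) auto
  also have "\<dots> = \<bar>al\<bar> * K * x powr (al + g - 1)"
    by (simp add: powr_add[symmetric] algebra_simps)
  finally show ?thesis .
qed

lemma increment_kernel_integrable:
  assumes b: "holder_on g K (u - L) u b" and c: "0 \<le> c" and L: "0 \<le> L"
    and al: "al < 1" "0 < al + g" "0 < g"
  shows "set_integrable lborel {0<..<L} (\<lambda>x. - al * (c + x) powr (al - 1) * (b u - b (u - x)))"
proof (rule set_integrable_bound)
  have h: "al + g - 1 \<noteq> - 1" "0 < 0 + 0 \<or> - 1 < al + g - 1" using al by auto
  show "set_integrable lborel {0<..<L} (\<lambda>x. \<bar>al\<bar> * K * x powr (al + g - 1))"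
    using powr_integral(1)[OF order_refl order_refl L h] by (intro set_integrable_mult_right) simp
  have "continuous_on {0<..<L} (\<lambda>x. b (u - x))"
    by (rule continuous_on_compose2[OF holder_on_continuous[OF b al(3)]]) (auto intro!: continuous_intros)
  then have "continuous_on {0<..<L} (\<lambda>x. - al * (c + x) powr (al - 1) * (b u - b (u - x)))"
    using c by (intro continuous_intros) auto
  then show "set_borel_measurable lborel {0<..<L} (\<lambda>x. - al * (c + x) powr (al - 1) * (b u - b (u - x)))"
    unfolding set_borel_measurable_def measurable_lborel2
    by (rule borel_measurable_continuous_on_indicator[rotated]) simp
  show "AE x in lborel. x \<in> {0<..<L} \<longrightarrow> norm (- al * (c + x) powr (al - 1) * (b u - b (u - x)))
      \<le> norm (\<bar>al\<bar> * K * x powr (al + g - 1))"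
    unfolding real_norm_def
    by (intro AE_I2 impI order_trans[OF increment_kernel_bound[OF b c al(1)] abs_ge_self])
qed

lemma powr_increment_diff:
  assumes "holder_on g K (u - L) u b" "holder_on g K' (u - L) u z" "0 \<le> c" "0 \<le> L" "al < 1" "0 < al + g" "0 < g"
  shows "powr_increment al c u L b - powr_increment al c u L z = powr_increment al c u L (\<lambda>s. b s - z s)"
proof -
  note I = increment_kernel_integrable[OF assms(1,3-7)] increment_kernel_integrable[OF assms(2,3-7)]
  have "(LBINT x:{0<..<L}. - al * (c + x) powr (al - 1) * (b u - z u - (b (u - x) - z (u - x))))
   = (LBINT x:{0<..<L}. - al * (c + x) powr (al - 1) * (b u - b (u - x)) - - al * (c + x) powr (al - 1) * (z u - z (u - x)))"
    by (intro set_lebesgue_integral_cong) (auto simp: algebra_simps)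
  also have "\<dots> = (LBINT x:{0<..<L}. - al * (c + x) powr (al - 1) * (b u - b (u - x)))
    - (LBINT x:{0<..<L}. - al * (c + x) powr (al - 1) * (z u - z (u - x)))"
    by (rule set_integral_diff(2)[OF I])
  finally show ?thesis unfolding powr_increment_def by (simp add: right_diff_distrib)
qed

text \<open>The price of omitting or altering a kernel on the last stretch of length
  \<open>L\<close> before its singularity: boundary term and integral both scale like
  \<open>L powr (al + g)\<close>.\<close>

lemma powr_increment_holder_bound:
  assumes b: "holder_on g K (u - L) u b" and c: "0 \<le> c" and L: "0 \<le> L" and al: "al < 0" "0 < al + g"
  shows "\<bar>powr_increment al c u L b\<bar> \<le> K * (1 + \<bar>al\<bar> / (al + g)) * L powr (al + g)"
proof -
  have K: "0 \<le> K" using b by (simp add: holder_on_def)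
  have h: "al + g - 1 \<noteq> - 1" "0 < 0 + 0 \<or> - 1 < al + g - 1" using al by auto
  have i: "set_integrable lborel {0<..<L} (\<lambda>x. \<bar>al\<bar> * K * x powr (al + g - 1))"
    using powr_integral(1)[OF order_refl order_refl L h] by (intro set_integrable_mult_right) simp
  have "\<bar>LBINT x:{0<..<L}. - al * (c + x) powr (al - 1) * (b u - b (u - x))\<bar>
    \<le> (LBINT x:{0<..<L}. \<bar>al\<bar> * K * x powr (al + g - 1))"
    using al by (intro set_integral_abs_le i increment_kernel_bound[OF b c]) auto
  also have "\<dots> = \<bar>al\<bar> * K * (L powr (al + g) / (al + g))"
    using powr_integral(2)[OF order_refl order_refl L h] al by (subst set_integral_mult_right) simp
  finally have 1: "\<bar>LBINT x:{0<..<L}. - al * (c + x) powr (al - 1) * (b u - b (u - x))\<bar>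
    \<le> \<bar>al\<bar> * K * (L powr (al + g) / (al + g))" .
  have 2: "\<bar>(c + L) powr al * (b u - b (u - L))\<bar> \<le> K * L powr (al + g)"
  proof (cases "L = 0")
    case False
    have "\<bar>b u - b (u - L)\<bar> \<le> K * \<bar>u - (u - L)\<bar> powr g" by (rule holder_onD[OF b]) (use L in auto)
    then have "\<bar>b u - b (u - L)\<bar> \<le> K * L powr g" using L by simp
    moreover have "(c + L) powr al \<le> L powr al" using c al L False by (intro powr_mono2') auto
    ultimately have "(c + L) powr al * \<bar>b u - b (u - L)\<bar> \<le> L powr al * (K * L powr g)"
      by (intro mult_mono) auto
    then show ?thesis by (simp add: abs_mult powr_add mult_ac)
  qed simp
  have "\<bar>powr_increment al c u L b\<bar> \<le> K * L powr (al + g) + \<bar>al\<bar> * K * (L powr (al + g) / (al + g))"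
    unfolding powr_increment_def by (rule order_trans[OF abs_triangle_ineq add_mono[OF 2 1]])
  then show ?thesis using al by (simp add: field_simps)
qed

text \<open>The bracket is the value of the kernel at the far end plus its total variation over the
  interval; increments of \<open>d\<close> are bounded by \<open>2 * D\<close>.\<close>

lemma powr_increment_sup_bound:
  assumes d: "\<And>s. s \<in> {u - L..u} \<Longrightarrow> \<bar>d s\<bar> \<le> D" and c: "0 \<le> c" and L: "0 \<le> L"
    and al: "al \<noteq> 0" "0 < c \<or> 0 < al"
  shows "\<bar>powr_increment al c u L d\<bar> \<le> 2 * D * ((c + L) powr al + \<bar>c powr al - (c + L) powr al\<bar>)"
proof -
  have D: "\<bar>d u - d (u - x)\<bar> \<le> 2 * D" if "x \<in> {0..L}" for x
    using d[of u] d[of "u - x"] that L by auto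
  have h: "al - 1 \<noteq> - 1" "0 < c + 0 \<or> - 1 < al - 1" using al by auto
  have i: "set_integrable lborel {0<..<L} (\<lambda>x. 2 * D * \<bar>al\<bar> * (c + x) powr (al - 1))"
    using powr_integral(1)[OF c order_refl L h] by (intro set_integrable_mult_right)
  have "\<bar>LBINT x:{0<..<L}. - al * (c + x) powr (al - 1) * (d u - d (u - x))\<bar>
    \<le> (LBINT x:{0<..<L}. 2 * D * \<bar>al\<bar> * (c + x) powr (al - 1))"
  proof (rule set_integral_abs_le[OF i])
    fix x assume "x \<in> {0<..<L}"
    then have "\<bar>d u - d (u - x)\<bar> * (\<bar>al\<bar> * (c + x) powr (al - 1)) \<le> 2 * D * (\<bar>al\<bar> * (c + x) powr (al - 1))"
      using D[of x] by (intro mult_right_mono) auto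
    then show "\<bar>- al * (c + x) powr (al - 1) * (d u - d (u - x))\<bar> \<le> 2 * D * \<bar>al\<bar> * (c + x) powr (al - 1)"
      by (simp add: abs_mult mult_ac)
  qed
  also have "\<dots> = 2 * D * \<bar>al\<bar> * (((c + L) powr al - c powr al) / al)"
    using powr_integral(2)[OF c order_refl L h] by simp
  also have "\<bar>al\<bar> * (((c + L) powr al - c powr al) / al) = \<bar>c powr al - (c + L) powr al\<bar>"
  proof (cases "0 < al")
    case True
    then have "c powr al \<le> (c + L) powr al" using c L by (intro powr_mono2) auto
    then show ?thesis using True by simp
  next
    case False
    then have "(c + L) powr al \<le> c powr al" using c L al by (intro powr_mono2') auto
    then show ?thesis using False al by (simp add: field_simps)
  qed
  then have "2 * D * \<bar>al\<bar> * (((c + L) powr al - c powr al) / al) = 2 * D * \<bar>c powr al - (c + L) powr al\<bar>"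
    by (simp only: mult.assoc)
  finally have 1: "\<bar>LBINT x:{0<..<L}. - al * (c + x) powr (al - 1) * (d u - d (u - x))\<bar>
    \<le> 2 * D * \<bar>c powr al - (c + L) powr al\<bar>" .
  have 2: "\<bar>(c + L) powr al * (d u - d (u - L))\<bar> \<le> 2 * D * (c + L) powr al"
  proof -
    have "(c + L) powr al * \<bar>d u - d (u - L)\<bar> \<le> (c + L) powr al * (2 * D)"
      using D[of L] L by (intro mult_left_mono) auto
    then show ?thesis by (simp add: abs_mult mult_ac)
  qed
  have "\<bar>powr_increment al c u L d\<bar> \<le> 2 * D * (c + L) powr al + 2 * D * \<bar>c powr al - (c + L) powr al\<bar>"
    unfolding powr_increment_def by (rule order_trans[OF abs_triangle_ineq add_mono[OF 2 1]])
  then show ?thesis by (simp add: distrib_left)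
qed

lemma powr_increment_sup_bound_neg:
  assumes "\<And>s. s \<in> {u - L..u} \<Longrightarrow> \<bar>d s\<bar> \<le> D" and "0 < c" and "0 \<le> L" and "al < 0"
  shows "\<bar>powr_increment al c u L d\<bar> \<le> 2 * D * c powr al"
proof -
  have "(c + L) powr al \<le> c powr al" using assms by (intro powr_mono2') auto
  then show ?thesis using powr_increment_sup_bound[of u L d D c al] assms by simp
qed

lemma powr_increment_sup_bound_pos:
  assumes "\<And>s. s \<in> {u - L..u} \<Longrightarrow> \<bar>d s\<bar> \<le> D" and "0 \<le> c" and "0 \<le> L" and "0 < al"
  shows "\<bar>powr_increment al c u L d\<bar> \<le> 4 * D * (c + L) powr al"
proof -
  have "c powr al \<le> (c + L) powr al" using assms by (intro powr_mono2) auto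
  then have *: "(c + L) powr al + \<bar>c powr al - (c + L) powr al\<bar> \<le> 2 * (c + L) powr al" by simp
  have "0 \<le> D" using assms(1)[of u] assms(3) by force
  with mult_left_mono[OF *, of "2 * D"] show ?thesis
    using powr_increment_sup_bound[of u L d D c al] assms by simp
qed

text \<open>Additivity of the integral at the point \<open>u - e\<close>, from which the singularity
  appears at distance \<open>c + e\<close>. For \<open>x > e\<close> the increment is split at
  \<open>u - e\<close>; the density integrates to \<open>(c + e) powr al - (c + L) powr al\<close>
  against the common part \<open>b u - b (u - e)\<close>, which adjusts the boundary term.\<close>

lemma powr_increment_split:
  assumes b: "holder_on g K (u - L) u b" and c: "0 \<le> c" and e: "0 \<le> e" "e \<le> L"
    and al: "al < 1" "al \<noteq> 0" "0 < al + g" "0 < g"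
  shows "powr_increment al c u L b = powr_increment al c u e b + powr_increment al (c + e) (u - e) (L - e) b"
proof (cases "e = 0")
  case True
  then show ?thesis by (simp add: powr_increment_def set_lebesgue_integral_def)
next
  case False
  then have e0: "0 < e" using e by simp
  define k where "k x = - al * (c + x) powr (al - 1)" for x
  have kI: "set_integrable lborel {e<..<L} k" "(LBINT x:{e<..<L}. k x) = (c + e) powr al - (c + L) powr al"
    unfolding k_def[abs_def] using kernel_integral[of c e L al] c e e0 al by auto
  have I: "set_integrable lborel {0<..<L} (\<lambda>x. k x * (b u - b (u - x)))"
    unfolding k_def using increment_kernel_integrable[OF b c _ al(1,3,4)] e by simp
  have Ie: "set_integrable lborel {0<..<e} (\<lambda>x. k x * (b u - b (u - x)))"
    "set_integrable lborel {e<..<L} (\<lambda>x. k x * (b u - b (u - x)))"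
    by (rule set_integrable_subset[OF I]; use e in force)+
  have "(LBINT x:{0<..<L}. k x * (b u - b (u - x))) = (LBINT x:{0<..<e} \<union> {e<..<L}. k x * (b u - b (u - x)))"
    by (rule set_integral_discrete_difference[where X="{e}"]) (use e e0 in auto)
  also have "\<dots> = (LBINT x:{0<..<e}. k x * (b u - b (u - x))) + (LBINT x:{e<..<L}. k x * (b u - b (u - x)))"
    by (rule set_integral_Un[OF _ Ie]) auto
  also have "(LBINT x:{e<..<L}. k x * (b u - b (u - x))) =
    (LBINT x:{e<..<L}. k x * (b u - b (u - e))) + (LBINT x:{e<..<L}. k x * (b (u - e) - b (u - x)))"
  proof -
    have kc: "set_integrable lborel {e<..<L} (\<lambda>x. k x * (b u - b (u - e)))"
      by (rule set_integrable_mult_left) (rule kI(1))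
    have "set_integrable lborel {e<..<L} (\<lambda>x. k x * (b u - b (u - x)) - k x * (b u - b (u - e)))"
      by (rule set_integral_diff(1)[OF Ie(2) kc])
    then have "set_integrable lborel {e<..<L} (\<lambda>x. k x * (b (u - e) - b (u - x)))"
      by (simp add: algebra_simps)
    from set_integral_add(2)[OF kc this] show ?thesis by (simp add: algebra_simps)
  qed
  also have "(LBINT x:{e<..<L}. k x * (b u - b (u - e))) = ((c + e) powr al - (c + L) powr al) * (b u - b (u - e))"
    unfolding kI(2)[symmetric] by (rule set_integral_mult_left)
  also have "(LBINT x:{e<..<L}. k x * (b (u - e) - b (u - x))) =
    (LBINT x:{0<..<L - e}. - al * (c + e + x) powr (al - 1) * (b (u - e) - b (u - e - x)))"
    unfolding set_lebesgue_integral_def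
    by (subst lborel_integral_real_affine[where c=1 and t=e])
       (auto simp: k_def indicator_def algebra_simps intro!: Bochner_Integration.integral_cong)
  finally show ?thesis
    unfolding powr_increment_def k_def by (simp add: algebra_simps)
qed

section \<open>The Wiener integral of the kernel as a functional of the path\<close>

text \<open>Covers single powers with \<open>q = 0\<close> and the differences in
  \<open>f_fun\<close> and \<open>F_fun\<close> with \<open>r = q = 1\<close>. For
  \<open>al < 0\<close> both shifts are positive, since otherwise the density is not integrable at
  0; the truncation by \<open>e\<close> provides exactly this.\<close>

lemma ls_integral_powr_diff:
  assumes lip: "\<And>x y. x \<in> {u - L..u} \<Longrightarrow> y \<in> {u - L..u} \<Longrightarrow> \<bar>z x - z y\<bar> \<le> K * \<bar>x - y\<bar>"
    and K: "0 \<le> K" and L: "0 \<le> L" and c: "0 \<le> c" "0 \<le> d"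
    and al: "al \<noteq> 0" "al < 1" "(0 < c \<and> 0 < d) \<or> 0 < al" and g: "0 < g" "g < 1" "0 < al + g"
    and h: "\<And>s. s \<in> {u - L<..u} \<Longrightarrow> h s = r * (c + u - s) powr al - q * (d + u - s) powr al"
  shows "ls_integral (u - L) u h z = r * powr_increment al c u L z - q * powr_increment al d u L z"
proof -
  have hol: "holder_on g (K * \<bar>u - (u - L)\<bar> powr (1 - g)) (u - L) u z"
    by (rule lipschitz_imp_holder_on[OF lip K g(1,2)])
  note I = increment_kernel_integrable[OF hol c(1) L al(2) g(3,1)] increment_kernel_integrable[OF hol c(2) L al(2) g(3,1)]
  define k where "k c x = - al * (c + x) powr (al - 1)" for c x
  have k: "set_integrable lborel {y<..<L} (k c')" "(LBINT x:{y<..<L}. k c' x) = (c' + y) powr al - (c' + L) powr al"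
    if "0 \<le> y" "y \<le> L" "c' \<in> {c, d}" for y c'
    unfolding k_def[abs_def] using kernel_integral[of c' y L al] that c al by auto
  have kint: "set_integrable lborel {y<..<L} (\<lambda>x. r * k c x - q * k d x)" if "0 \<le> y" "y \<le> L" for y
    by (intro set_integral_diff(1) set_integrable_mult_right k that) auto
  have "ls_integral (u - L) u h z = (r * (c + L) powr al - q * (d + L) powr al) * (z u - z (u - L)) +
     (LBINT x:{0<..<L}. (r * k c x - q * k d x) * (z u - z (u - x)))"
  proof (rule ls_integral_superposition[OF lip K L])
    show "set_integrable lborel {0<..<L} (\<lambda>x. r * k c x - q * k d x)" using L by (intro kint) auto
    fix s assume s: "s \<in> {u - L<..u}"
    then have us: "0 \<le> u - s" "u - s \<le> L" by auto
    have "(LBINT x:{u - s<..<L}. r * k c x - q * k d x) =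
      r * ((c + (u - s)) powr al - (c + L) powr al) - q * ((d + (u - s)) powr al - (d + L) powr al)"
      using k[OF us] by (subst set_integral_diff(2)) (auto intro!: set_integrable_mult_right)
    then show "h s = r * (c + L) powr al - q * (d + L) powr al + (LBINT x:{u - s<..<L}. r * k c x - q * k d x)"
      using h[OF s] by (simp add: algebra_simps)
  qed
  also have "(LBINT x:{0<..<L}. (r * k c x - q * k d x) * (z u - z (u - x))) =
     (LBINT x:{0<..<L}. r * (k c x * (z u - z (u - x))) - q * (k d x * (z u - z (u - x))))"
    by (intro set_lebesgue_integral_cong) (auto simp: algebra_simps)
  also have "\<dots> = r * (LBINT x:{0<..<L}. k c x * (z u - z (u - x))) - q * (LBINT x:{0<..<L}. k d x * (z u - z (u - x)))"
    using I[folded k_def] by (subst set_integral_diff(2)) (auto intro!: set_integrable_mult_right)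
  finally show ?thesis by (simp add: powr_increment_def k_def algebra_simps)
qed

text \<open>Mean value theorem. The intermediate point is at least \<open>y - T\<close>, hence at
  least \<open>(1 - T / A) * y\<close>, whatever the sign of \<open>t\<close>, so that the kernels
  with \<open>t\<close> and with \<open>- t\<close> obey one bound.\<close>

lemma powr_diff_bound:
  fixes p t T A y :: real
  assumes p: "p < 1" and t: "\<bar>t\<bar> \<le> T" and T: "T < A" and y: "A \<le> y"
  shows "\<bar>(t + y) powr p - y powr p\<bar> \<le> \<bar>p\<bar> * T * (1 - T / A) powr (p - 1) * y powr (p - 1)"
proof -
  have A: "0 < A" "0 \<le> T" using t T by linarith+
  have "T * (A / A) \<le> T * (y / A)" using A y by (intro mult_left_mono divide_right_mono) auto
  then have "T / A * y \<ge> T" using A T by simp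
  then have lower: "(1 - T / A) * y \<le> y - T" by (simp add: algebra_simps)
  have pos: "0 < (1 - T / A) * y" using A T y by (intro mult_pos_pos) auto
  define l where "l = min y (t + y)"
  define u where "u = max y (t + y)"
  have l: "(1 - T / A) * y \<le> l" using lower t A by (auto simp: l_def)
  show ?thesis
  proof (cases "t = 0")
    case False
    then have lu: "l < u" by (auto simp: l_def u_def)
    have "\<exists>x>l. x < u \<and> u powr p - l powr p = (u - l) * (p * x powr (p - 1))"
      by (rule MVT2[OF lu]) (use pos l in \<open>auto intro!: derivative_eq_intros\<close>)
    then obtain x where x: "l < x" "u powr p - l powr p = (u - l) * (p * x powr (p - 1))" by blast
    have "\<bar>(t + y) powr p - y powr p\<bar> = \<bar>u powr p - l powr p\<bar>" by (auto simp: l_def u_def max_def min_def)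
    also have "\<dots> = \<bar>t\<bar> * (\<bar>p\<bar> * x powr (p - 1))"
      unfolding x(2) by (auto simp: abs_mult l_def u_def max_def min_def)
    also have "\<dots> \<le> T * (\<bar>p\<bar> * ((1 - T / A) * y) powr (p - 1))"
      using pos l x t p by (intro mult_mono powr_mono2') auto
    also have "((1 - T / A) * y) powr (p - 1) = (1 - T / A) powr (p - 1) * y powr (p - 1)"
      by (rule powr_mult)
    finally show ?thesis by (simp add: mult_ac)
  qed (use A in simp)
qed

section \<open>The kernel near minus infinity in the coordinate \<open>x = - 1 / s\<close>\<close>

definition tail_density :: "real \<Rightarrow> real \<Rightarrow> real \<Rightarrow> real" where
  "tail_density al t x = al * ((1 / x) powr (al - 1) - (t + 1 / x) powr (al - 1)) / x\<^sup>2"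

definition tail_const :: "real \<Rightarrow> real \<Rightarrow> real \<Rightarrow> real" where
  "tail_const al A T = \<bar>al\<bar> * (\<bar>al - 1\<bar> * T * (1 - T / A) powr (al - 2))"

lemma tail_density_measurable[measurable]: "tail_density al t \<in> borel_measurable borel"
  unfolding tail_density_def by measurable

text \<open>The difference of two powers gains one order at infinity, and
  \<open>(1 / x) powr (al - 2) / x^2 = x powr (- al)\<close>. Multiplied by the Brownian growth
  \<open>x powr (g - 1)\<close> this remains integrable at 0 as long as
  \<open>al < g\<close>.\<close>

lemma tail_density_bound:
  assumes al: "al < 1" and t: "\<bar>t\<bar> \<le> T" and T: "T < A" and x: "x \<in> {0<..1 / A}"
  shows "\<bar>tail_density al t x\<bar> \<le> tail_const al A T * x powr (- al)"
proof -
  have A: "0 < A" using t T by linarith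
  have "A \<le> 1 / x" using x A by (simp add: field_simps)
  from powr_diff_bound[OF _ t T this, of "al - 1"]
  have b: "\<bar>(t + 1 / x) powr (al - 1) - (1 / x) powr (al - 1)\<bar> \<le> \<bar>al - 1\<bar> * T * (1 - T / A) powr (al - 2) * (1 / x) powr (al - 2)"
    using al by simp
  have "\<bar>tail_density al t x\<bar> = \<bar>al\<bar> * \<bar>(t + 1 / x) powr (al - 1) - (1 / x) powr (al - 1)\<bar> / x\<^sup>2"
    by (simp add: tail_density_def abs_mult abs_minus_commute)
  also have "\<dots> \<le> \<bar>al\<bar> * (\<bar>al - 1\<bar> * T * (1 - T / A) powr (al - 2) * (1 / x) powr (al - 2)) / x\<^sup>2"
    using b by (intro divide_right_mono mult_left_mono) auto
  also have "\<dots> = tail_const al A T * ((1 / x) powr (al - 2) / x\<^sup>2)"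
    by (simp add: tail_const_def)
  also have "(1 / x) powr (al - 2) / x\<^sup>2 = x powr (- al)"
  proof -
    have "(1 / x) powr (al - 2) = x powr (2 - al)" using x by (simp add: powr_divide powr_diff powr_minus field_simps)
    moreover have "x\<^sup>2 = x powr 2" using x by simp
    ultimately show ?thesis using x by (simp add: powr_diff[symmetric] del: powr_numeral)
  qed
  finally show ?thesis .
qed

lemma tail_const_nonneg: "0 \<le> T \<Longrightarrow> 0 \<le> tail_const al A T"
  by (simp add: tail_const_def)

text \<open>The exponent \<open>r\<close> takes four values: 0 for the density itself,
  \<open>- 1/2\<close> for mean square norms of increments, \<open>- 1\<close> for the factor of
  time inversion, and \<open>g - 1\<close> for Brownian growth. With \<open>r = - 1\<close> and
  \<open>y = 0\<close> the condition becomes \<open>al < 0\<close>, so for \<open>al > 0\<close> the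
  tail has to be cut off.\<close>

lemma tail_density_mult_integrable:
  assumes al: "al < 1" and t: "\<bar>t\<bar> \<le> T" and T: "T < A"
    and f: "f \<in> borel_measurable borel" "\<And>x. x \<in> {y<..<Y} \<Longrightarrow> \<bar>f x\<bar> \<le> K * x powr r"
    and y: "0 \<le> y" "y \<le> Y" "Y \<le> 1 / A" and r: "0 < y \<or> al < 1 + r" "al \<noteq> 1 + r"
  shows "set_integrable lborel {y<..<Y} (\<lambda>x. tail_density al t x * f x)"
    and "\<bar>LBINT x:{y<..<Y}. tail_density al t x * f x\<bar> \<le>
       tail_const al A T * K * ((Y powr (r - al + 1) - y powr (r - al + 1)) / (r - al + 1))"
proof -
  have h: "r - al \<noteq> - 1" "0 < 0 + y \<or> - 1 < r - al" using r by auto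
  note P = powr_integral[OF order_refl y(1,2) h]
  have T0: "0 \<le> T" using t by linarith
  have le: "\<bar>tail_density al t x * f x\<bar> \<le> tail_const al A T * K * x powr (r - al)" if x: "x \<in> {y<..<Y}" for x
  proof -
    have "\<bar>tail_density al t x * f x\<bar> \<le> tail_const al A T * x powr (- al) * (K * x powr r)"
      unfolding abs_mult using f(2)[OF x] x y tail_const_nonneg[OF T0]
      by (intro mult_mono tail_density_bound[OF al t T]) auto
    also have "tail_const al A T * x powr (- al) * (K * x powr r) = tail_const al A T * K * x powr (r - al)"
      by (simp add: powr_add[symmetric] mult_ac)
    finally show ?thesis .
  qed
  have i: "set_integrable lborel {y<..<Y} (\<lambda>x. tail_const al A T * K * x powr (r - al))"
    using P(1) by (intro set_integrable_mult_right) simp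
  show "set_integrable lborel {y<..<Y} (\<lambda>x. tail_density al t x * f x)"
    by (rule set_integrable_bound[OF i])
       (use f(1) in \<open>auto simp: set_borel_measurable_def intro!: AE_I2 order_trans[OF le abs_ge_self]\<close>)
  have "\<bar>LBINT x:{y<..<Y}. tail_density al t x * f x\<bar> \<le> (LBINT x:{y<..<Y}. tail_const al A T * K * x powr (r - al))"
    by (rule set_integral_abs_le[OF i le])
  also have "\<dots> = tail_const al A T * K * ((Y powr (r - al + 1) - y powr (r - al + 1)) / (r - al + 1))"
    using P(2) by (subst set_integral_mult_right) simp
  finally show "\<bar>LBINT x:{y<..<Y}. tail_density al t x * f x\<bar> \<le>
       tail_const al A T * K * ((Y powr (r - al + 1) - y powr (r - al + 1)) / (r - al + 1))" .
qed

lemma tail_density_integrable: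
  assumes al: "al < 1" and t: "\<bar>t\<bar> \<le> T" and T: "T < A" and y: "y \<le> 1 / A"
  shows "set_integrable lborel {0<..<y} (tail_density al t)"
proof -
  have "set_integrable lborel {0<..<1 / A} (\<lambda>x. tail_density al t x * 1)"
    using al by (intro tail_density_mult_integrable[OF al t T, where K=1 and r=0]) (use t T in auto)
  then have "set_integrable lborel {0<..<1 / A} (tail_density al t)" by simp
  then show ?thesis by (rule set_integrable_subset) (use y in auto)
qed

text \<open>\<open>tail_density\<close> is the derivative of \<open>f_fun\<close> in the coordinate \<open>x = - 1 / s\<close>.\<close>

lemma tail_density_integral:
  assumes al: "al < 1" and t: "\<bar>t\<bar> \<le> T" and T: "T < A" and y: "0 < y" "y \<le> 1 / A"
  shows "(LBINT x:{0<..<y}. tail_density al t x) = (t + 1 / y) powr al - (1 / y) powr al"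
proof -
  define F where "F x = (t + 1 / x) powr al - (1 / x) powr al" for x :: real
  have A: "0 < A" "0 \<le> T" using t T by linarith+
  have pos: "A \<le> 1 / x" "0 < t + 1 / x" if "0 < x" "x \<le> y" for x
  proof -
    have "x \<le> 1 / A" using that y by simp
    then show "A \<le> 1 / x" using that A by (simp add: field_simps)
    then show "0 < t + 1 / x" using t T by linarith
  qed
  have 1: "ereal 0 < ereal y" using y by simp
  have 2: "(F has_vector_derivative tail_density al t x) (at x)" if "ereal 0 < ereal x" "ereal x < ereal y" for x
  proof -
    have "x \<noteq> 0" using that by simp
    then have "DERIV F x :> al * (t + 1 / x) powr (al - 1) * (- (1 / x\<^sup>2)) - al * (1 / x) powr (al - 1) * (- (1 / x\<^sup>2))"
      unfolding F_def using pos[of x] that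
      by (auto intro!: derivative_eq_intros simp: power2_eq_square)
    also have "al * (t + 1 / x) powr (al - 1) * (- (1 / x\<^sup>2)) - al * (1 / x) powr (al - 1) * (- (1 / x\<^sup>2)) = tail_density al t x"
      by (simp add: tail_density_def right_diff_distrib diff_divide_distrib)
    finally show ?thesis by (simp add: has_real_derivative_iff_has_vector_derivative)
  qed
  have 3: "isCont (tail_density al t) x" if "ereal 0 < ereal x" "ereal x < ereal y" for x
    unfolding tail_density_def[abs_def] using pos[of x] that by (intro continuous_intros) auto
  have 4: "set_integrable lborel (einterval 0 y) (tail_density al t)"
    using tail_density_integrable[OF al t T y(2)] by (simp add: zero_ereal_def)
  have 5: "((F \<circ> real_of_ereal) \<longlongrightarrow> 0) (at_right (ereal 0))"
    unfolding ereal_tendsto_simps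
  proof (rule Lim_null_comparison)
    have le: "\<bar>F x\<bar> \<le> \<bar>al\<bar> * T * (1 - T / A) powr (al - 1) * x powr (1 - al)" if "0 < x" "x < y" for x
    proof -
      have "(1 / x) powr (al - 1) = x powr (1 - al)" using that by (simp add: powr_divide powr_diff field_simps)
      then show ?thesis using powr_diff_bound[OF al t T pos(1)[of x]] that by (simp add: F_def)
    qed
    then show "\<forall>\<^sub>F x in at_right 0. norm (F x) \<le> \<bar>al\<bar> * T * (1 - T / A) powr (al - 1) * x powr (1 - al)"
      unfolding eventually_at_right_field using y by (intro exI[of _ y]) auto
    have "((\<lambda>x. \<bar>al\<bar> * T * (1 - T / A) powr (al - 1) * x powr (1 - al)) \<longlongrightarrow> \<bar>al\<bar> * T * (1 - T / A) powr (al - 1) * 0 powr (1 - al)) (at_right 0)"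
      by (intro tendsto_intros tendsto_powr') (use al in \<open>auto simp: eventually_at_filter\<close>)
    then show "((\<lambda>x. \<bar>al\<bar> * T * (1 - T / A) powr (al - 1) * x powr (1 - al)) \<longlongrightarrow> 0) (at_right 0)" by simp
  qed
  have 6: "((F \<circ> real_of_ereal) \<longlongrightarrow> F y) (at_left (ereal y))"
  proof -
    have "isCont F y"
      unfolding F_def[abs_def] using pos[of y] y by (intro continuous_intros) auto
    then show ?thesis unfolding ereal_tendsto_simps
      by (auto simp: isCont_def intro: filterlim_at_split[THEN iffD1, THEN conjunct1])
  qed
  have "(LBINT x=ereal 0..ereal y. tail_density al t x) = F y - 0"
    by (rule interval_integral_FTC_integrable[OF 1 2 3 _ 5 6]) (use 4 in \<open>auto simp: zero_ereal_def\<close>)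
  then show ?thesis using y by (simp add: F_def interval_lebesgue_integral_def)
qed

text \<open>The integral of the kernel difference \<open>f_fun\<close> over
  \<open>(- \<infinity>, - A]\<close> by parts. The difference vanishes at minus infinity, so no
  boundary term arises there.\<close>

definition tail_increment :: "real \<Rightarrow> real \<Rightarrow> real \<Rightarrow> (real \<Rightarrow> real) \<Rightarrow> real" where
  "tail_increment al A t b = (LBINT x:{0<..<1 / A}. tail_density al t x * (b (- A) - b (- 1 / x)))"

text \<open>The integral of \<open>subfbm_kernel\<close> with respect to \<open>b\<close>.\<close>

definition subfbm_functional :: "real \<Rightarrow> real \<Rightarrow> real \<Rightarrow> (real \<Rightarrow> real) \<Rightarrow> real" where
  "subfbm_functional al A t b =
     powr_increment al 0 t t b + (powr_increment al t 0 A b - powr_increment al 0 0 A b) + tail_increment al A t b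
     - powr_increment al 0 0 t b + (powr_increment al 0 (- t) (A - t) b - powr_increment al t (- t) (A - t) b)
     + tail_increment al A (- t) b"

text \<open>The boundary term of \<open>powr_increment\<close> is one interval, spread over a dummy
  parameter in \<open>[0, 1]\<close>; in the second entry the parameter is the length of the
  interval.\<close>

definition powr_pieces :: "real \<Rightarrow> real \<Rightarrow> real \<Rightarrow> real \<Rightarrow> real \<Rightarrow> weighted_intervals list" where
  "powr_pieces al q c u L =
    [(\<lambda>r. q * (c + L) powr al * indicator {0..1} r, \<lambda>_. u - L, \<lambda>_. u),
     (\<lambda>x. q * (indicator {0<..<L} x * (- al * (c + x) powr (al - 1))), \<lambda>x. u - x, \<lambda>_. u)]"

definition tail_pieces :: "real \<Rightarrow> real \<Rightarrow> real \<Rightarrow> weighted_intervals list" where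
  "tail_pieces al A t = [(\<lambda>x. indicator {0<..<1 / A} x * tail_density al t x, \<lambda>x. - 1 / x, \<lambda>_. - A)]"

text \<open>The weighted norm is at most a multiple of \<open>x powr (al - 1/2)\<close>, integrable
  at 0 because \<open>- 1/2 < al\<close>, that is \<open>H > 0\<close>.\<close>

lemma powr_pieces_admissible:
  assumes c: "0 \<le> c" and L: "0 \<le> L" and al: "- 1 / 2 < al" "al < 1" and x: "x \<in> set (powr_pieces al q c u L)"
  shows "admissible x"
proof -
  have h: "al - 1 / 2 \<noteq> - 1" "0 < 0 + 0 \<or> - 1 < al - 1 / 2" using al by auto
  have "integrable lborel (\<lambda>x. q * (indicator {0<..<L} x * (- al * (c + x) powr (al - 1))) * sqrt \<bar>x\<bar>)"
  proof (rule Bochner_Integration.integrable_bound)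
    have "set_integrable lborel {0<..<L} (\<lambda>x. (0 + x) powr (al - 1 / 2))"
      by (rule powr_integral(1)[OF order_refl order_refl L h])
    then show "integrable lborel (\<lambda>x. \<bar>q\<bar> * \<bar>al\<bar> * (indicator {0<..<L} x * x powr (al - 1 / 2)))"
      by (simp add: set_integrable_def)
    show "AE x in lborel. norm (q * (indicator {0<..<L} x * (- al * (c + x) powr (al - 1))) * sqrt \<bar>x\<bar>)
        \<le> norm (\<bar>q\<bar> * \<bar>al\<bar> * (indicator {0<..<L} x * x powr (al - 1 / 2)))"
    proof (rule AE_I2)
      fix x :: real
      show "norm (q * (indicator {0<..<L} x * (- al * (c + x) powr (al - 1))) * sqrt \<bar>x\<bar>)
        \<le> norm (\<bar>q\<bar> * \<bar>al\<bar> * (indicator {0<..<L} x * x powr (al - 1 / 2)))"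
      proof (cases "x \<in> {0<..<L}")
        case True
        have "(c + x) powr (al - 1) * sqrt x \<le> x powr (al - 1) * sqrt x"
          using c al True by (intro mult_right_mono powr_mono2') auto
        also have "\<dots> = x powr (al - 1 / 2)"
          using True by (simp add: powr_half_sqrt[symmetric] powr_add[symmetric])
        finally have "\<bar>q\<bar> * \<bar>al\<bar> * ((c + x) powr (al - 1) * sqrt x) \<le> \<bar>q\<bar> * \<bar>al\<bar> * x powr (al - 1 / 2)"
          by (intro mult_left_mono) auto
        then show ?thesis using True by (simp add: abs_mult mult_ac)
      qed simp
    qed
  qed measurable
  then have "admissible (\<lambda>x. q * (indicator {0<..<L} x * (- al * (c + x) powr (al - 1))), \<lambda>x. u - x, \<lambda>_. u)"
    by (simp add: admissible_def)
  moreover have "admissible (\<lambda>r. q * (c + L) powr al * indicator {0..1} r, \<lambda>_. u - L, \<lambda>_. u)"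
    by (auto simp: admissible_def intro!: integrable_real_indicator)
  ultimately show ?thesis using x by (auto simp: powr_pieces_def)
qed

text \<open>The interval belonging to \<open>x\<close> is shorter than \<open>1 / x\<close>, so the
  weighted norm is of order \<open>x powr (- al - 1/2)\<close>, integrable at 0 because
  \<open>al < 1/2\<close>, that is \<open>H < 1\<close>.\<close>

lemma tail_pieces_admissible:
  assumes al: "al < 1 / 2" and t: "\<bar>t\<bar> \<le> T" and T: "T < A" and x: "x \<in> set (tail_pieces al A t)"
  shows "admissible x"
proof -
  have A: "0 < A" using t T by linarith
  have al1: "al < 1" using al by simp
  have "set_integrable lborel {0<..<1 / A} (\<lambda>x. tail_density al t x * sqrt \<bar>- A - - 1 / x\<bar>)"
  proof (rule tail_density_mult_integrable[OF al1 t T, where K=1 and r="- 1 / 2"])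
    fix x assume "x \<in> {0<..<1 / A}"
    then have x: "0 < x" "A < 1 / x" using A by (auto simp: field_simps)
    have "sqrt \<bar>- A - - 1 / x\<bar> \<le> sqrt (1 / x)" using x A by (intro real_sqrt_le_mono) auto
    also have "sqrt (1 / x) = x powr (- 1 / 2)"
      using x by (simp add: powr_minus_divide powr_half_sqrt real_sqrt_divide)
    finally show "\<bar>sqrt \<bar>- A - - 1 / x\<bar>\<bar> \<le> 1 * x powr (- 1 / 2)" by simp
  qed (use al A in auto)
  then show ?thesis using x
    by (auto simp: tail_pieces_def admissible_def set_integrable_def mult.assoc)
qed

lemma superposition_powr_pieces:
  "(\<Sum>x\<leftarrow>powr_pieces al q c u L. superposition b x w) = q * powr_increment al c u L (\<lambda>s. b s w)"
proof -
  have "(LBINT x. q * (indicator {0<..<L} x * (- al * (c + x) powr (al - 1))) * (b u w - b (u - x) w)) =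
    (LBINT x. q * (indicator {0<..<L} x *\<^sub>R (- al * (c + x) powr (al - 1) * (b u w - b (u - x) w))))"
    by (intro Bochner_Integration.integral_cong) auto
  also have "\<dots> = q * (LBINT x:{0<..<L}. - al * (c + x) powr (al - 1) * (b u w - b (u - x) w))"
    unfolding set_lebesgue_integral_def by (rule integral_mult_right_zero)
  finally show ?thesis
    by (simp add: powr_pieces_def superposition_def powr_increment_def algebra_simps)
qed

lemma superposition_tail_pieces:
  "(\<Sum>x\<leftarrow>tail_pieces al A t. superposition b x w) = tail_increment al A t (\<lambda>s. b s w)"
  by (simp add: tail_pieces_def superposition_def tail_increment_def set_lebesgue_integral_def mult.assoc)

text \<open>Along the path \<open>r \<mapsto> signed_indicator r s\<close> only the lengths
  \<open>x > u - s\<close> contribute, and their integral combines with the boundary term to the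
  value of the kernel at \<open>s\<close>. At \<open>s = u\<close> the density may fail to be
  integrable; this point is a null set.\<close>

lemma powr_increment_signed_indicator:
  assumes c: "0 \<le> c" and L: "0 \<le> L" and al: "al \<noteq> 0" and s: "s \<noteq> u"
  shows "powr_increment al c u L (\<lambda>r. signed_indicator r s) = (c + u - s) powr al * indicator {u - L<..u} s"
proof (cases "s \<in> {u - L<..<u}")
  case True
  have "(LBINT x:{0<..<L}. - al * (c + x) powr (al - 1) * (signed_indicator u s - signed_indicator (u - x) s))
     = (LBINT x:{u - s<..<L}. - al * (c + x) powr (al - 1))"
    unfolding set_lebesgue_integral_def
  proof (intro Bochner_Integration.integral_cong refl)
    fix x :: real
    show "indicator {0<..<L} x *\<^sub>R (- al * (c + x) powr (al - 1) * (signed_indicator u s - signed_indicator (u - x) s))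
      = indicator {u - s<..<L} x *\<^sub>R (- al * (c + x) powr (al - 1))"
    proof (cases "0 < x")
      case x: True
      then have "signed_indicator u s - signed_indicator (u - x) s = indicator {u - x<..u} s"
        by (intro signed_indicator_diff) simp
      then show ?thesis using x True by (auto simp: indicator_def)
    qed (use True in simp)
  qed
  also have "\<dots> = (c + (u - s)) powr al - (c + L) powr al"
    by (rule kernel_integral(2)) (use True c al in auto)
  finally show ?thesis using True L by (simp add: powr_increment_def signed_indicator_diff algebra_simps)
next
  case False
  have "(LBINT x:{0<..<L}. - al * (c + x) powr (al - 1) * (signed_indicator u s - signed_indicator (u - x) s)) = (LBINT x:{0<..<L}. 0)"
    by (intro set_lebesgue_integral_cong) (use False s in \<open>auto simp: signed_indicator_diff indicator_def\<close>)
  then show ?thesis using False s L by (auto simp: powr_increment_def signed_indicator_diff indicator_def)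
qed

lemma tail_increment_signed_indicator:
  assumes al: "al < 1" and t: "\<bar>t\<bar> \<le> T" and T: "T < A"
  shows "tail_increment al A t (\<lambda>r. signed_indicator r s) = ((t - s) powr al - (- s) powr al) * indicator {..- A} s"
proof (cases "s \<le> - A")
  case True
  have A: "0 < A" using t T by linarith
  have "tail_increment al A t (\<lambda>r. signed_indicator r s) = (LBINT x:{0<..<- 1 / s}. tail_density al t x)"
    unfolding tail_increment_def set_lebesgue_integral_def
  proof (intro Bochner_Integration.integral_cong refl)
    fix x :: real
    consider "x \<le> 0" | "1 / A \<le> x" | "0 < x" "x < 1 / A" by linarith
    then show "indicator {0<..<1 / A} x *\<^sub>R (tail_density al t x * (signed_indicator (- A) s - signed_indicator (- 1 / x) s))
      = indicator {0<..<- 1 / s} x *\<^sub>R tail_density al t x"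
    proof cases
      case 2
      moreover have "- 1 / s \<le> 1 / A" using True A by (simp add: field_simps)
      ultimately show ?thesis by simp
    next
      case 3
      then have "A < 1 / x" using A by (simp add: field_simps)
      then have "signed_indicator (- A) s - signed_indicator (- 1 / x) s = indicator {- 1 / x<..- A} s"
        by (intro signed_indicator_diff) simp
      moreover have "- 1 / x < s \<longleftrightarrow> x < - 1 / s" using 3 True A by (simp add: field_simps)
      ultimately show ?thesis using 3 True by (simp add: indicator_def)
    qed simp
  qed
  also have "\<dots> = (t + 1 / (- 1 / s)) powr al - (1 / (- 1 / s)) powr al"
    by (rule tail_density_integral[OF al t T]) (use True A in \<open>auto simp: field_simps\<close>)
  finally show ?thesis using True by simp
next
  case False
  have A: "0 < A" using t T by linarith
  have "tail_increment al A t (\<lambda>r. signed_indicator r s) = (LBINT x:{0<..<1 / A}. 0)"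
    unfolding tail_increment_def
  proof (intro set_lebesgue_integral_cong allI impI)
    fix x assume "x \<in> {0<..<1 / A}"
    then have "A < 1 / x" using A by (simp add: field_simps)
    then have "signed_indicator (- A) s - signed_indicator (- 1 / x) s = indicator {- 1 / x<..- A} s"
      by (intro signed_indicator_diff) simp
    then show "tail_density al t x * (signed_indicator (- A) s - signed_indicator (- 1 / x) s) = 0"
      using False by simp
  qed simp
  then show ?thesis using False by simp
qed

text \<open>The two subtracted powers in the kernel are shared out: one goes with
  \<open>t - s\<close>, the other with \<open>- t - s\<close>. The first difference is cut at 0 and
  \<open>- A\<close>, the second at \<open>- t\<close> and \<open>- A\<close>; on each piece the
  kernel is a power, a difference of powers or a tail. Comparing with \<open>subfbm_kernel\<close>
  on these pieces, away from the three singular points, suffices.\<close>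

theorem (in two_sided_brownian_motion) wiener_integral_subfbm_kernel:
  assumes X: "has_wiener_integral M B (subfbm_kernel H t) X"
    and H: "H - 1/2 \<noteq> 0" "0 < H" "H < 1" and t: "0 \<le> t" "t < A"
  shows "AE \<omega> in M. X \<omega> = subfbm_functional (H - 1/2) A t (\<lambda>s. B s \<omega>)"
proof -
  define al where "al = H - 1/2"
  have al: "al \<noteq> 0" "- 1/2 < al" "al < 1/2" "al < 1" using H by (auto simp: al_def)
  define xs where "xs = powr_pieces al 1 0 t t @ powr_pieces al 1 t 0 A @ powr_pieces al (- 1) 0 0 A @ tail_pieces al A t
    @ powr_pieces al (- 1) 0 0 t @ powr_pieces al 1 0 (- t) (A - t) @ powr_pieces al (- 1) t (- t) (A - t) @ tail_pieces al A (- t)"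
  have sum: "(\<Sum>x\<leftarrow>xs. superposition b x w) = subfbm_functional al A t (\<lambda>s. b s w)" for w and b :: "real \<Rightarrow> 'n \<Rightarrow> real"
    unfolding xs_def map_append sum_list_append superposition_powr_pieces superposition_tail_pieces subfbm_functional_def by simp
  have adm: "\<forall>x\<in>set xs. admissible x"
  proof -
    have pa: "\<forall>x\<in>set (powr_pieces al q c u L). admissible x" if "0 \<le> c" "0 \<le> L" for q c u L
      using powr_pieces_admissible[OF that, of al] al by auto
    have ta: "\<forall>x\<in>set (tail_pieces al A t'). admissible x" if "\<bar>t'\<bar> \<le> t" for t'
      using tail_pieces_admissible[OF al(3) that t(2)] by auto
    show ?thesis
      unfolding xs_def set_append ball_Un by (intro conjI pa ta) (use t in auto)
  qed
  have "AE s in lborel. s \<noteq> t" "AE s in lborel. s \<noteq> 0" "AE s in lborel. s \<noteq> - t"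
    by (rule AE_lborel_singleton)+
  then have "AE s in lborel. subfbm_kernel H t s = (\<Sum>x\<leftarrow>xs. superposition signed_indicator x s)"
  proof eventually_elim
    case (elim s)
    have tail: "tail_increment al A t (\<lambda>r. signed_indicator r s) = ((t - s) powr al - (- s) powr al) * indicator {..- A} s"
      "tail_increment al A (- t) (\<lambda>r. signed_indicator r s) = ((- t - s) powr al - (- s) powr al) * indicator {..- A} s"
      using t by (intro tail_increment_signed_indicator[OF al(4), of _ t]; simp)+
    have pw: "powr_increment al 0 t t (\<lambda>r. signed_indicator r s) = (t - s) powr al * indicator {0<..t} s"
      "powr_increment al t 0 A (\<lambda>r. signed_indicator r s) = (t - s) powr al * indicator {- A<..0} s"
      "powr_increment al 0 0 A (\<lambda>r. signed_indicator r s) = (- s) powr al * indicator {- A<..0} s"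
      "powr_increment al 0 0 t (\<lambda>r. signed_indicator r s) = (- s) powr al * indicator {- t<..0} s"
      "powr_increment al 0 (- t) (A - t) (\<lambda>r. signed_indicator r s) = (- t - s) powr al * indicator {- A<..- t} s"
      "powr_increment al t (- t) (A - t) (\<lambda>r. signed_indicator r s) = (- s) powr al * indicator {- A<..- t} s"
      using powr_increment_signed_indicator[of 0 t al s t] powr_increment_signed_indicator[of t A al s 0]
        powr_increment_signed_indicator[of 0 A al s 0] powr_increment_signed_indicator[of 0 t al s 0]
        powr_increment_signed_indicator[of 0 "A - t" al s "- t"] powr_increment_signed_indicator[of t "A - t" al s "- t"]
        al t elim by simp_all
    consider "s > t" | "0 < s" "s \<le> t" | "- t < s" "s \<le> 0" | "- A < s" "s \<le> - t" | "s \<le> - A" using t by linarith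
    then show ?case unfolding sum subfbm_functional_def tail pw subfbm_kernel_def al_def[symmetric]
      using t elim by cases (simp_all add: indicator_def max_def)
  qed
  from wiener_integral_superposition[OF X adm this] show ?thesis by (simp add: sum al_def)
qed

section \<open>Pathwise error of the approximation\<close>

lemma ls_integral_empty: "u \<le> l \<Longrightarrow> ls_integral l u h z = 0"
  by (simp add: ls_integral_def Let_def set_lebesgue_integral_def)

lemma powr_increment_0 [simp]: "powr_increment al c u 0 b = 0"
  by (simp add: powr_increment_def set_lebesgue_integral_def)

lemma ls_integral_powr_difference:
  assumes z: "holder_on 1 K l u z" and l: "l \<le> u" and c: "0 \<le> c" "0 \<le> d"
    and al: "al \<noteq> 0" "\<bar>al\<bar> < 1" "(0 < c \<and> 0 < d) \<or> 0 < al"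
    and h: "\<And>s. s \<in> {l<..u} \<Longrightarrow> h s = (c + u - s) powr al - (d + u - s) powr al"
  shows "ls_integral l u h z = powr_increment al c u (u - l) z - powr_increment al d u (u - l) z"
proof -
  \<comment> \<open>The order \<open>(1 + \<bar>al\<bar>) / 2\<close> is an arbitrary choice
    strictly between \<open>\<bar>al\<bar>\<close> and 1.\<close>
  have "ls_integral (u - (u - l)) u h z = 1 * powr_increment al c u (u - l) z - 1 * powr_increment al d u (u - l) z"
    by (rule ls_integral_powr_diff[where K=K and g="(1 + \<bar>al\<bar>) / 2"])
       (use assms in \<open>auto simp: holder_on_def field_simps\<close>)
  then show ?thesis by simp
qed

lemma ls_integral_powr:
  assumes z: "holder_on 1 K l u z" and l: "l \<le> u" and c: "0 \<le> c"
    and al: "al \<noteq> 0" "\<bar>al\<bar> < 1" "0 < c \<or> 0 < al"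
    and h: "\<And>s. s \<in> {l<..u} \<Longrightarrow> h s = (c + u - s) powr al"
  shows "ls_integral l u h z = powr_increment al c u (u - l) z"
proof -
  have "ls_integral (u - (u - l)) u h z = 1 * powr_increment al c u (u - l) z - 0 * powr_increment al c u (u - l) z"
    by (rule ls_integral_powr_diff[where K=K and g="(1 + \<bar>al\<bar>) / 2"])
       (use assms in \<open>auto simp: holder_on_def field_simps\<close>)
  then show ?thesis by simp
qed

lemma deriv_f_fun:
  assumes "s < 0" "s < t"
  shows "deriv (f_fun H t) s = (H - 1/2) * ((- s) powr (H - 1/2 - 1) - (t - s) powr (H - 1/2 - 1))"
proof -
  have "DERIV (f_fun H t) s :> (H - 1/2) * ((- s) powr (H - 1/2 - 1) - (t - s) powr (H - 1/2 - 1))"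
    unfolding f_fun_def[abs_def] using assms
    by (auto intro!: derivative_eq_intros simp: algebra_simps)
  then show ?thesis by (rule DERIV_imp_deriv)
qed

text \<open>Reflection \<open>v = - x\<close>. Of the factor \<open>1 / v ^ 3\<close>, two powers
  belong to the change of coordinate in \<open>tail_density\<close>; the remaining
  \<open>1 / x\<close> converts the time-inverted path back into the path.\<close>

lemma inv_integral_f_fun:
  assumes t: "\<bar>t\<bar> \<le> T" "T < A" and s: "- 1 / A \<le> s" "s \<le> 0"
  shows "inv_integral (f_fun H t) (- 1 / A) s = - (LBINT x:{- s<..<1 / A}. tail_density (H - 1/2) t x * (1 / x))"
proof -
  have A: "0 < A" using t by linarith
  have "inv_integral (f_fun H t) (- 1 / A) s = (\<integral>v. indicator {- 1 / A<..<s} v * (deriv (f_fun H t) (1 / v) * (1 / v ^ 3)) \<partial>lborel)"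
    using s by (simp add: inv_integral_def interval_lebesgue_integral_def set_lebesgue_integral_def)
  also have "\<dots> = (\<integral>x. indicator {- 1 / A<..<s} (- x) * (deriv (f_fun H t) (1 / (- x)) * (1 / (- x) ^ 3)) \<partial>lborel)"
    by (subst lborel_integral_real_affine[where c="-1" and t=0]) auto
  also have "\<dots> = (\<integral>x. - (indicator {- s<..<1 / A} x * (tail_density (H - 1/2) t x * (1 / x))) \<partial>lborel)"
  proof (intro Bochner_Integration.integral_cong refl)
    fix x :: real
    show "indicator {- 1 / A<..<s} (- x) * (deriv (f_fun H t) (1 / (- x)) * (1 / (- x) ^ 3)) =
      - (indicator {- s<..<1 / A} x * (tail_density (H - 1/2) t x * (1 / x)))"
    proof (cases "x \<in> {- s<..<1 / A}")
      case True
      then have x: "0 < x" "A < 1 / x" using s A by (auto simp: field_simps)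
      then have d: "deriv (f_fun H t) (1 / (- x)) = (H - 1/2) * ((1 / x) powr (H - 1/2 - 1) - (t + 1 / x) powr (H - 1/2 - 1))"
        using t by (subst deriv_f_fun) auto
      have "deriv (f_fun H t) (1 / (- x)) * (1 / (- x) ^ 3) = - (tail_density (H - 1/2) t x * (1 / x))"
        unfolding d tail_density_def by (simp add: power2_eq_square power3_eq_cube)
      moreover have "indicator {- 1 / A<..<s} (- x) = (1 :: real)" using True by auto
      ultimately show ?thesis using True by simp
    next
      case False
      moreover have "- x \<notin> {- 1 / A<..<s}" using False by auto
      ultimately show ?thesis by simp
    qed
  qed
  finally show ?thesis by (simp add: set_lebesgue_integral_def)
qed

text \<open>The integrand vanishes at \<open>- 1 / A\<close>, so there is no boundary term. Freezing
  it at \<open>- e\<close> removes the density on \<open>x < e\<close>, and \<open>z 0 = 0\<close>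
  turns increments of \<open>z\<close> into values.\<close>

lemma ls_integral_tail:
  assumes t: "\<bar>t\<bar> \<le> T" "T < A" and e: "0 \<le> e" "e < 1 / A" and al: "H - 1/2 < 1" "H - 1/2 \<noteq> 0" "0 < e \<or> H - 1/2 < 0"
    and z: "holder_on 1 K (- 1 / A) 0 z" "z 0 = 0"
    and h: "\<And>s. s \<in> {- 1 / A<..0} \<Longrightarrow> h s = - inv_integral (f_fun H t) (- 1 / A) (min s (- e))"
  shows "ls_integral (- 1 / A) 0 h z = - (LBINT x:{e<..<1 / A}. tail_density (H - 1/2) t x * (z (- x) / x))"
proof -
  have A: "0 < A" using t by linarith
  define al where "al = H - 1/2"
  define eta where "eta x = (if e < x then tail_density al t x * (1 / x) else 0)" for x
  have ieta: "set_integrable lborel {e<..<1 / A} (\<lambda>x. tail_density al t x * (1 / x))"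
    by (rule tail_density_mult_integrable[where K=1 and r="-1" and T=T])
       (use assms A in \<open>auto simp: al_def powr_minus_divide\<close>)
  have eta_e: "(LBINT x:{y<..<1 / A}. eta x * f x) = (LBINT x:{max y e<..<1 / A}. tail_density al t x * (1 / x) * f x)" for y f
    unfolding set_lebesgue_integral_def
    by (intro Bochner_Integration.integral_cong) (auto simp: eta_def indicator_def)
  have "ls_integral (0 - 1 / A) 0 h z = 0 * (z 0 - z (0 - 1 / A)) + (LBINT x:{0<..<1 / A}. eta x * (z 0 - z (0 - x)))"
  proof (rule ls_integral_superposition[where K=K])
    show "set_integrable lborel {0<..<1 / A} eta"
    proof -
      have "set_integrable lborel {0<..<1 / A} eta \<longleftrightarrow> set_integrable lborel {e<..<1 / A} (\<lambda>x. tail_density al t x * (1 / x))"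
        unfolding set_integrable_def
        by (intro Bochner_Integration.integrable_cong) (use e in \<open>auto simp: eta_def indicator_def\<close>)
      then show ?thesis using ieta by simp
    qed
    fix s assume s: "s \<in> {0 - 1 / A<..0}"
    then have "h s = (LBINT x:{- min s (- e)<..<1 / A}. tail_density al t x * (1 / x))"
      using inv_integral_f_fun[OF t, of "min s (- e)" H] e by (subst h) (auto simp: al_def)
    also have "- min s (- e) = max (- s) e" by (simp add: min_def max_def)
    finally show "h s = 0 + (LBINT x:{0 - s<..<1 / A}. eta x)"
      using eta_e[of "- s" "\<lambda>_. 1"] by simp
  qed (use z A in \<open>auto simp: holder_on_def\<close>)
  also have "\<dots> = (LBINT x:{e<..<1 / A}. - (tail_density al t x * (z (- x) / x)))"
    using eta_e[of 0 "\<lambda>x. - z (- x)"] z(2) e by (simp add: max_def)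
  also have "\<dots> = - (LBINT x:{e<..<1 / A}. tail_density al t x * (z (- x) / x))"
    by (simp add: set_lebesgue_integral_def)
  finally show ?thesis by (simp add: al_def)
qed

section \<open>Error estimate for one fixed path\<close>

definition f_end_const :: "real \<Rightarrow> real \<Rightarrow> real \<Rightarrow> real" where
  "f_end_const al A T = (2 * A) powr al + (A - T) powr al"

text \<open>The deterministic properties of a Brownian path on \<open>regular_event\<close>. The
  condition \<open>\<bar>al\<bar> < g\<close> makes both \<open>x powr (al + g - 1)\<close>, at the
  finite singularities, and \<open>x powr (g - 1 - al)\<close>, in the tail, integrable at
  0.\<close>

locale regular_path =
  fixes al A T g K :: real and b :: "real \<Rightarrow> real"
  assumes al: "al \<noteq> 0" "\<bar>al\<bar> < g" and g: "g < 1/2" and T: "0 < T" "T < A"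
    and b_holder: "holder_on g K (- A) T b"
    and b_cont: "continuous_on UNIV b"
    and b_growth: "\<And>s. s \<le> - A \<Longrightarrow> \<bar>b s\<bar> \<le> K * (- s) powr (1 - g)"
begin

abbreviation "J \<equiv> powr_increment al"
abbreviation "tc \<equiv> tail_const al A T"
abbreviation "fc \<equiv> f_end_const al A T"

lemma A_pos: "0 < A" and K_nonneg: "0 \<le> K" and g_pos: "0 < g" and al_g: "0 < al + g" "al < g"
  and al_half: "\<bar>al\<bar> < 1/2"
  using T b_holder al g by (auto simp: holder_on_def)

definition "near = 1 + \<bar>al\<bar> / (al + g)"

lemma near_nonneg: "0 \<le> near" using al_g by (simp add: near_def)

lemma b_holder_sub: "- A \<le> l \<Longrightarrow> u \<le> T \<Longrightarrow> holder_on g K l u b"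
  using holder_on_subset[OF b_holder] .

lemma b_measurable[measurable]: "b \<in> borel_measurable borel"
  by (rule borel_measurable_continuous_onI[OF b_cont])

lemma b_inv_bound: "x \<in> {0<..<1 / A} \<Longrightarrow> \<bar>b (- 1 / x)\<bar> \<le> K * x powr (g - 1)"
proof -
  assume "x \<in> {0<..<1 / A}"
  then have x: "0 < x" "A < 1 / x" using A_pos by (auto simp: field_simps)
  have "\<bar>b (- 1 / x)\<bar> \<le> K * (1 / x) powr (1 - g)" using b_growth[of "- 1 / x"] x by simp
  also have "(1 / x) powr (1 - g) = x powr (g - 1)" using x by (simp add: powr_divide powr_diff field_simps)
  finally show ?thesis .
qed

lemma tail_b_integrable:
  assumes "\<bar>t\<bar> \<le> T" "0 \<le> y" "y \<le> Y" "Y \<le> 1 / A"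
  shows "set_integrable lborel {y<..<Y} (\<lambda>x. tail_density al t x * b (- 1 / x))"
  by (rule tail_density_mult_integrable(1)[where K=K and r="g - 1" and T=T])
     (use assms al_half al_g T b_inv_bound in auto)

text \<open>Isolates the value at \<open>- A\<close>, the counterpart of the summand
  \<open>f_fun H t a * z2 a\<close> in \<open>W_approx\<close> and, with \<open>- t\<close>, of
  \<open>F_fun H t a * z2 a\<close> in \<open>Y_approx\<close>.\<close>

lemma tail_increment_eq:
  assumes t: "\<bar>t\<bar> \<le> T"
  shows "tail_increment al A t b = ((t + A) powr al - A powr al) * b (- A) -
    (LBINT x:{0<..<1 / A}. tail_density al t x * b (- 1 / x))"
proof -
  have i: "set_integrable lborel {0<..<1 / A} (tail_density al t)"
    using al_half by (intro tail_density_integrable[OF _ t T(2)]) auto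
  have v: "(LBINT x:{0<..<1 / A}. tail_density al t x) = (t + A) powr al - A powr al"
    using tail_density_integral[OF _ t T(2), of al "1 / A"] al_half A_pos by simp
  have "tail_increment al A t b = (LBINT x:{0<..<1 / A}. tail_density al t x * b (- A) - tail_density al t x * b (- 1 / x))"
    by (simp add: tail_increment_def right_diff_distrib)
  also have "\<dots> = (LBINT x:{0<..<1 / A}. tail_density al t x * b (- A)) - (LBINT x:{0<..<1 / A}. tail_density al t x * b (- 1 / x))"
    using A_pos by (intro set_integral_diff(2) set_integrable_mult_left i tail_b_integrable t) auto
  also have "(LBINT x:{0<..<1 / A}. tail_density al t x * b (- A)) = ((t + A) powr al - A powr al) * b (- A)"
    unfolding v[symmetric] by (rule set_integral_mult_left)
  finally show ?thesis .
qed


lemma f_end_bound: "\<bar>t\<bar> \<le> T \<Longrightarrow> \<bar>(t + A) powr al - A powr al\<bar> \<le> fc"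
proof -
  assume t: "\<bar>t\<bar> \<le> T"
  have "x powr al \<le> fc" if "A - T \<le> x" "x \<le> 2 * A" for x
  proof (cases "0 < al")
    case True
    then have "x powr al \<le> (2 * A) powr al" using that T by (intro powr_mono2) auto
    then show ?thesis unfolding f_end_const_def using powr_ge_zero[of "A - T" al] by linarith
  next
    case False
    then have "x powr al \<le> (A - T) powr al" using that T by (intro powr_mono2') auto
    then show ?thesis unfolding f_end_const_def using powr_ge_zero[of "2 * A" al] by linarith
  qed
  from this[of "t + A"] this[of A] show ?thesis
    using t T powr_ge_zero[of "t + A" al] powr_ge_zero[of A al] by linarith
qed

end

text \<open>Lipschitz continuity gives the Stieltjes integrals their meaning, while closeness is
  measured by \<open>D\<close>, for the third path after time inversion. The bounds on
  \<open>e\<close> keep the cut points \<open>- t - e\<close> to the right of \<open>- A\<close> and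
  \<open>- e\<close> to the right of \<open>- 1 / A\<close>.\<close>

locale approximated_path = regular_path +
  fixes D e :: real and z1 z2 z3 :: "real \<Rightarrow> real" and K1 K2 K3 :: real
  assumes z1: "holder_on 1 K1 0 T z1" and z2: "holder_on 1 K2 (- A) 0 z2" and z3: "holder_on 1 K3 (- 1 / A) 0 z3" "z3 0 = 0"
    and d1: "\<And>s. s \<in> {0..T} \<Longrightarrow> \<bar>b s - z1 s\<bar> \<le> D"
    and d2: "\<And>s. s \<in> {- A..0} \<Longrightarrow> \<bar>b s - z2 s\<bar> \<le> D"
    and d3: "\<And>s. s \<in> {- 1 / A..<0} \<Longrightarrow> \<bar>s * b (1 / s) - z3 s\<bar> \<le> D"
    and e: "0 < e" "e < 1" "e < A - T" "e < 1 / A"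
begin

abbreviation "approx H t \<equiv> W_approx 1 H (- A) (- e) z1 z2 z3 t + Y_approx 1 H (- A) (- e) z2 z3 t"

lemma D_nonneg: "0 \<le> D"
  using d1[of 0] T by auto

text \<open>There are three sources of error: the value at \<open>- A\<close>, within
  \<open>D\<close>; the range \<open>x > y\<close>, where time inversion magnifies \<open>D\<close>
  to \<open>D / x\<close>; and the omitted range \<open>x < y\<close>, where the growth of
  \<open>b\<close> leaves \<open>K * y powr (g - al)\<close>. The cut-off is \<open>y = e\<close>
  for \<open>al > 0\<close> and \<open>y = 0\<close> for \<open>al < 0\<close>.\<close>

lemma tail_error:
  assumes t: "\<bar>t\<bar> \<le> T" and y: "0 \<le> y" "y < 1 / A" "0 < y \<or> al < 0"
    and H: "al = H - 1/2"
    and h: "\<And>s. s \<in> {- 1 / A<..0} \<Longrightarrow> h s = - inv_integral (f_fun H t) (- 1 / A) (min s (- y))"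
  shows "\<bar>tail_increment al A t b - (f_fun H t (- A) * z2 (- A) - ls_integral (- 1 / A) 0 h z3)\<bar> \<le>
     (fc + tc * (((1 / A) powr (- al) - y powr (- al)) / (- al))) * D +
     tc * K * (y powr (g - al) / (g - al))"
proof -
  let ?td = "tail_density al t"
  have ls: "ls_integral (- 1 / A) 0 h z3 = - (LBINT x:{y<..<1 / A}. ?td x * (z3 (- x) / x))"
    unfolding H by (rule ls_integral_tail[OF t T(2) y(1,2) _ _ _ z3 h]) (use al_half al(1) y(3) in \<open>auto simp: H[symmetric]\<close>)
  have f: "f_fun H t (- A) = (t + A) powr al - A powr al" by (simp add: f_fun_def H)
  have al1: "al < 1" using al_half by simp
  have z3m: "(\<lambda>x. z3 (- x) / x * indicator {y<..<1 / A} x) \<in> borel_measurable borel"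
  proof -
    have "continuous_on {y<..<1 / A} (\<lambda>x. z3 (- x) / x)"
      using y by (intro continuous_intros continuous_on_compose2[OF holder_on_continuous[OF z3(1)], of _ uminus]) auto
    from borel_measurable_continuous_on_indicator[OF _ this] show ?thesis by (simp add: mult.commute)
  qed
  \<comment> \<open>The substitute for \<open>b (- 1 / x)\<close> is \<open>- z3 (- x) / x\<close>,
    and \<open>w\<close> is the difference; the indicator restricts it to the range where
    \<open>z3\<close> is known to be continuous.\<close>
  define w where "w x = (b (- 1 / x) + z3 (- x) / x) * indicator {y<..<1 / A} x" for x
  have wm: "w \<in> borel_measurable borel"
  proof -
    have "w = (\<lambda>x. b (- 1 / x) * indicator {y<..<1 / A} x + z3 (- x) / x * indicator {y<..<1 / A} x)"
      by (auto simp: w_def distrib_right)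
    then show ?thesis using z3m by simp
  qed
  have wb: "\<bar>w x\<bar> \<le> D * x powr (- 1)" if x: "x \<in> {y<..<1 / A}" for x
  proof -
    have x0: "0 < x" using x y by auto
    have "\<bar>- x * b (1 / (- x)) - z3 (- x)\<bar> \<le> D" by (rule d3) (use x x0 in auto)
    then have "\<bar>x * w x\<bar> \<le> D" using x x0 by (simp add: w_def distrib_left abs_le_iff)
    then show ?thesis using x0 by (simp add: abs_mult powr_minus_divide field_simps)
  qed
  note W = tail_density_mult_integrable[OF al1 t T(2) wm wb y(1) less_imp_le[OF y(2)] order_refl]
  have W2: "\<bar>LBINT x:{y<..<1 / A}. ?td x * w x\<bar> \<le> tc * D * (((1 / A) powr (- al) - y powr (- al)) / (- al))"
    using W(2) al y by simp
  have bI: "set_integrable lborel {0<..<1 / A} (\<lambda>x. ?td x * b (- 1 / x))"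
    "set_integrable lborel {0<..<y} (\<lambda>x. ?td x * b (- 1 / x))"
    "set_integrable lborel {y<..<1 / A} (\<lambda>x. ?td x * b (- 1 / x))"
    using tail_b_integrable[OF t, of 0 "1 / A"] tail_b_integrable[OF t, of 0 y] tail_b_integrable[OF t, of y "1 / A"] y A_pos by auto
  have "(LBINT x:{0<..<1 / A}. ?td x * b (- 1 / x)) = (LBINT x:{0<..<y} \<union> {y<..<1 / A}. ?td x * b (- 1 / x))"
    by (rule set_integral_discrete_difference[where X="{y}"]) (use y in auto)
  also have "\<dots> = (LBINT x:{0<..<y}. ?td x * b (- 1 / x)) + (LBINT x:{y<..<1 / A}. ?td x * b (- 1 / x))"
    by (rule set_integral_Un[OF _ bI(2,3)]) auto
  finally have split: "(LBINT x:{0<..<1 / A}. ?td x * b (- 1 / x)) =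
    (LBINT x:{0<..<y}. ?td x * b (- 1 / x)) + (LBINT x:{y<..<1 / A}. ?td x * b (- 1 / x))" .
  have small: "\<bar>LBINT x:{0<..<y}. ?td x * b (- 1 / x)\<bar> \<le> tc * K * (y powr (g - al) / (g - al))"
  proof -
    have "\<bar>LBINT x:{0<..<y}. ?td x * b (- 1 / x)\<bar> \<le>
       tc * K * ((y powr (g - 1 - al + 1) - 0 powr (g - 1 - al + 1)) / (g - 1 - al + 1))"
      by (rule tail_density_mult_integrable(2)[OF al1 t T(2)]) (use y al_g b_inv_bound in auto)
    then show ?thesis by simp
  qed
  have comb: "(LBINT x:{y<..<1 / A}. ?td x * w x) =
     (LBINT x:{y<..<1 / A}. ?td x * b (- 1 / x)) + (LBINT x:{y<..<1 / A}. ?td x * (z3 (- x) / x))"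
  proof -
    have wI: "set_integrable lborel {y<..<1 / A} (\<lambda>x. ?td x * w x)" using W(1) al y by simp
    have eq: "(LBINT x:{y<..<1 / A}. ?td x * (z3 (- x) / x)) = (LBINT x:{y<..<1 / A}. ?td x * w x - ?td x * b (- 1 / x))"
      by (intro set_lebesgue_integral_cong) (auto simp: w_def algebra_simps)
    show ?thesis unfolding eq by (subst set_integral_diff(2)[OF wI bI(3)]) simp
  qed
  have "tail_increment al A t b - (f_fun H t (- A) * z2 (- A) - ls_integral (- 1 / A) 0 h z3) =
    f_fun H t (- A) * (b (- A) - z2 (- A)) - (LBINT x:{0<..<y}. ?td x * b (- 1 / x)) - (LBINT x:{y<..<1 / A}. ?td x * w x)"
    unfolding tail_increment_eq[OF t] ls split comb f by (simp add: algebra_simps)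
  moreover have "\<bar>f_fun H t (- A) * (b (- A) - z2 (- A))\<bar> \<le> fc * D"
    unfolding abs_mult f using A_pos by (intro mult_mono f_end_bound t d2) (auto intro: order_trans[OF abs_ge_zero f_end_bound[OF t]])
  moreover have distr: "(fc + tc * q) * D + r = fc * D + tc * D * q + r" for q r
    by (simp add: algebra_simps)
  ultimately show ?thesis using small W2 unfolding distr by linarith
qed


lemma z_holder:
  assumes "holder_on 1 Kz l u z"
  shows "holder_on g (Kz * \<bar>u - l\<bar> powr (1 - g)) l u z"
  using assms g_pos g by (intro lipschitz_imp_holder_on) (auto simp: holder_on_def)

lemma path_diff:
  assumes z: "holder_on 1 Kz (u - L) u z" and u: "- A \<le> u - L" "u \<le> T" and L: "0 \<le> L" and c: "0 \<le> c"
  shows "J c u L b - J c u L z = J c u L (\<lambda>s. b s - z s)"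
  by (rule powr_increment_diff[OF b_holder_sub[OF u] z_holder[OF z] c L]) (use al_half al_g g_pos in auto)

lemma holder_part:
  assumes u: "- A \<le> u - L" "u \<le> T" and L: "0 \<le> L" "L \<le> e" and c: "0 \<le> c" and neg: "al < 0"
  shows "\<bar>J c u L b\<bar> \<le> near * K * e powr (al + g)"
proof -
  have "\<bar>J c u L b\<bar> \<le> K * near * L powr (al + g)"
    unfolding near_def by (rule powr_increment_holder_bound[OF b_holder_sub[OF u] c L(1) neg al_g(1)])
  also have "\<dots> \<le> K * near * e powr (al + g)"
    using K_nonneg near_nonneg L al_g by (intro mult_left_mono powr_mono2) auto
  finally show ?thesis by (simp add: mult_ac)
qed

lemma sup_part:
  assumes z: "holder_on 1 Kz (u - L) u z" and dz: "\<And>s. s \<in> {u - L..u} \<Longrightarrow> \<bar>b s - z s\<bar> \<le> D"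
    and u: "- A \<le> u - L" "u \<le> T" and L: "0 \<le> L" and d: "e \<le> d" and neg: "al < 0"
  shows "\<bar>J d u L b - J d u L z\<bar> \<le> 2 * D * e powr al"
proof -
  have "\<bar>J d u L (\<lambda>s. b s - z s)\<bar> \<le> 2 * D * d powr al"
    by (rule powr_increment_sup_bound_neg) (use dz d e L neg in auto)
  also have "\<dots> \<le> 2 * D * e powr al"
    using D_nonneg d e neg by (intro mult_left_mono powr_mono2') auto
  finally show ?thesis using path_diff[OF z u L, of d] d e by simp
qed

text \<open>On a stretch of length at most \<open>e\<close> the kernels with shifts \<open>c\<close>
  and \<open>d\<close> need not be compared: on \<open>b\<close> the Hoelder property makes each
  integral small by itself. Only then is \<open>b\<close> exchanged for \<open>z\<close>, with the
  singularity at distance at least \<open>e\<close>.\<close>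

lemma near_bound:
  assumes z: "holder_on 1 Kz (u - L) u z" and dz: "\<And>s. s \<in> {u - L..u} \<Longrightarrow> \<bar>b s - z s\<bar> \<le> D"
    and u: "- A \<le> u - L" "u \<le> T" and L: "0 \<le> L" "L \<le> e" and c: "0 \<le> c" and d: "e \<le> d" and neg: "al < 0"
  shows "\<bar>J c u L b - J d u L z\<bar> \<le> 2 * (near * K * e powr (al + g)) + 2 * D * e powr al"
  using holder_part[OF u L c neg] holder_part[OF u L _ neg, of d] sup_part[OF z dz u L(1) d neg] d e
  unfolding abs_le_iff by linarith

text \<open>For kernels that the approximating process integrates only up to distance
  \<open>e\<close> from the end: the omitted stretch is paid for by the Hoelder property, the rest
  by the uniform distance.\<close>

lemma far_bound:
  assumes z: "holder_on 1 Kz (u - L) (u - e) z" and dz: "\<And>s. s \<in> {u - L..u - e} \<Longrightarrow> \<bar>b s - z s\<bar> \<le> D"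
    and u: "- A \<le> u - L" "u \<le> T" and L: "e \<le> L" and c: "0 \<le> c" and neg: "al < 0"
  shows "\<bar>J c u L b - J (c + e) (u - e) (L - e) z\<bar> \<le> near * K * e powr (al + g) + 2 * D * e powr al"
proof -
  have "J c u L b = J c u e b + J (c + e) (u - e) (L - e) b"
    by (rule powr_increment_split[OF b_holder_sub[OF u] c]) (use e L al_half al al_g g_pos in auto)
  moreover have "\<bar>J c u e b\<bar> \<le> near * K * e powr (al + g)"
    by (rule holder_part) (use u L e c neg in auto)
  moreover have "\<bar>J (c + e) (u - e) (L - e) b - J (c + e) (u - e) (L - e) z\<bar> \<le> 2 * D * e powr al"
    by (rule sup_part) (use z dz u L c neg e in auto)
  ultimately show ?thesis unfolding abs_le_iff by linarith
qed

lemma sup_part_pos: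
  assumes z: "holder_on 1 Kz (u - L) u z" and dz: "\<And>s. s \<in> {u - L..u} \<Longrightarrow> \<bar>b s - z s\<bar> \<le> D"
    and u: "- A \<le> u - L" "u \<le> T" and L: "0 \<le> L" and c: "0 \<le> c" "c + L \<le> 2 * A" and pos: "0 < al"
  shows "\<bar>J c u L b - J c u L z\<bar> \<le> 4 * D * (2 * A) powr al"
proof -
  have "\<bar>J c u L (\<lambda>s. b s - z s)\<bar> \<le> 4 * D * (c + L) powr al"
    by (rule powr_increment_sup_bound_pos) (use dz c L pos in auto)
  also have "\<dots> \<le> 4 * D * (2 * A) powr al"
    using D_nonneg c L pos by (intro mult_left_mono powr_mono2) auto
  finally show ?thesis using path_diff[OF z u L c(1)] by simp
qed

text \<open>The tail estimates admit times of either sign, so through this identity they apply to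
  \<open>Y_approx\<close> as well.\<close>

lemma F_fun_eq: "F_fun H t = f_fun H (- t)"
  by (simp add: F_fun_def f_fun_def fun_eq_iff)

text \<open>For \<open>al > 0\<close> the power kernels are bounded and \<open>e\<close> only enters
  the tails. The 24 is six power terms at \<open>4 * D * (2 * A) powr al\<close> each; the remaining
  summand counts the two tails.\<close>

lemma approximation_error_pos:
  assumes H: "al = H - 1/2" and pos: "0 < al" and t: "0 \<le> t" "t \<le> T"
  shows "\<bar>subfbm_functional al A t b - approx H t\<bar> \<le>
     24 * D * (2 * A) powr al + 2 * ((fc + tc * (((1 / A) powr (- al) - e powr (- al)) / (- al))) * D +
     tc * K * (e powr (g - al) / (g - al)))"
proof -
  have al1: "\<bar>al\<bar> < 1" using al_half by linarith
  have inv: "1 / - A = - 1 / A" by simp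
  have H12: "H > 1/2" using pos H by simp
  have tA: "t < A" using t T by linarith
  let ?h = "\<lambda>s. - inv_integral (f_fun H t) (- 1 / A) (min s (- e))"
  let ?h' = "\<lambda>s. - inv_integral (f_fun H (- t)) (- 1 / A) (min (max (- e) (- 1 / A)) s)"
  have me: "max (- e) (- 1 / A) = - e" using e by (simp add: max_def)
  have z1': "holder_on 1 K1 0 t z1" using holder_on_subset[OF z1] t by simp
  have z2': "holder_on 1 K2 (- t) 0 z2" "holder_on 1 K2 (- A) (- t) z2"
    using holder_on_subset[OF z2] t tA by auto
  have ls: "ls_integral 0 t (g_fun H t) z1 = J 0 t t z1"
    "ls_integral (- A) 0 (f_fun H t) z2 = J t 0 A z2 - J 0 0 A z2"
    "ls_integral (- t) 0 (\<lambda>s. (- s) powr (H - 1/2)) z2 = J 0 0 t z2"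
    "ls_integral (- A) (- t) (F_fun H t) z2 = J 0 (- t) (A - t) z2 - J t (- t) (A - t) z2"
    using ls_integral_powr[OF z1', of 0 al "g_fun H t"]
      ls_integral_powr_difference[OF z2, of t 0 al "f_fun H t"]
      ls_integral_powr[OF z2'(1), of 0 al "\<lambda>s. (- s) powr (H - 1/2)"]
      ls_integral_powr_difference[OF z2'(2), of 0 t al "F_fun H t"] pos al1 t tA A_pos
    by (simp_all add: H g_fun_def f_fun_def F_fun_def)
  have W: "W_approx 1 H (- A) (- e) z1 z2 z3 t = J 0 t t z1 + (J t 0 A z2 - J 0 0 A z2)
     + (f_fun H t (- A) * z2 (- A) - ls_integral (- 1 / A) 0 ?h z3)"
    using H12 by (simp only: W_approx_def inv ls if_True) simp
  have Y: "Y_approx 1 H (- A) (- e) z2 z3 t = - J 0 0 t z2 + (J 0 (- t) (A - t) z2 - J t (- t) (A - t) z2)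
     + (f_fun H (- t) (- A) * z2 (- A) - ls_integral (- 1 / A) 0 ?h' z3)"
    using H12 by (simp only: Y_approx_def inv ls if_True F_fun_eq[symmetric]) simp
  define R where "R = (fc + tc * (((1 / A) powr (- al) - e powr (- al)) / (- al))) * D +
     tc * K * (e powr (g - al) / (g - al))"
  define S where "S = 4 * D * (2 * A) powr al"
  have "\<bar>tail_increment al A t b - (f_fun H t (- A) * z2 (- A) - ls_integral (- 1 / A) 0 ?h z3)\<bar> \<le> R"
    unfolding R_def by (rule tail_error) (use t e H in auto)
  moreover have "\<bar>tail_increment al A (- t) b - (f_fun H (- t) (- A) * z2 (- A) - ls_integral (- 1 / A) 0 ?h' z3)\<bar> \<le> R"
    unfolding R_def by (rule tail_error) (use t e H me in \<open>auto simp: min.commute\<close>)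
  moreover have "\<bar>J 0 t t b - J 0 t t z1\<bar> \<le> S"
    unfolding S_def by (rule sup_part_pos) (use z1' d1 t T pos in auto)
  moreover have "\<bar>J t 0 A b - J t 0 A z2\<bar> \<le> S"
    "\<bar>J 0 0 A b - J 0 0 A z2\<bar> \<le> S"
    unfolding S_def by (rule sup_part_pos; use z2 d2 t T pos in auto)+
  moreover have "\<bar>J 0 0 t b - J 0 0 t z2\<bar> \<le> S"
    unfolding S_def by (rule sup_part_pos) (use z2' d2 t T pos in auto)
  moreover have "\<bar>J 0 (- t) (A - t) b - J 0 (- t) (A - t) z2\<bar> \<le> S"
    "\<bar>J t (- t) (A - t) b - J t (- t) (A - t) z2\<bar> \<le> S"
    unfolding S_def by (rule sup_part_pos; use z2' d2 t T pos in auto)+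
  ultimately have "\<bar>subfbm_functional al A t b - approx H t\<bar> \<le> 6 * S + 2 * R"
    unfolding W Y subfbm_functional_def abs_le_iff by linarith
  then show ?thesis by (simp add: R_def S_def)
qed

text \<open>For \<open>al < 0\<close> the tails are complete and all truncations lie at finite
  singularities. The Hoelder cost is counted 2 + 2 for the single powers at \<open>t\<close> and 0,
  1 + 1 for \<open>f_fun\<close> and 4 for \<open>F_fun\<close>, in all 10; so is the cost
  \<open>2 * D * e powr al\<close>, whence 20.\<close>

lemma approximation_error_neg:
  assumes H: "al = H - 1/2" and neg: "al < 0" and t: "0 \<le> t" "t \<le> T"
  shows "\<bar>subfbm_functional al A t b - approx H t\<bar> \<le>
     10 * (near * K * e powr (al + g)) + 20 * (D * e powr al) +
     2 * ((fc + tc * (1 / A) powr (- al) / (- al)) * D)"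
proof -
  have al1: "\<bar>al\<bar> < 1" using al_half by linarith
  have inv: "1 / - A = - 1 / A" by simp
  have H12: "\<not> H > 1/2" using neg H by simp
  have tA: "t < A" "t + e < A" using t T e by linarith+
  let ?R = "near * K * e powr (al + g)" and ?S = "2 * D * e powr al"
  have RS: "0 \<le> ?R" "0 \<le> ?S" using near_nonneg K_nonneg D_nonneg by auto
  have z1': "holder_on 1 K1 l u z1" if "0 \<le> l" "u \<le> T" for l u using holder_on_subset[OF z1] that by simp
  have z2': "holder_on 1 K2 l u z2" if "- A \<le> l" "u \<le> 0" for l u using holder_on_subset[OF z2] that by simp
  \<comment> \<open>Used with \<open>u = t\<close> for \<open>z1\<close> and with
    \<open>u = 0\<close> for \<open>z2\<close>. Up to distance \<open>e\<close> from
    \<open>u\<close> the singularity is moved to \<open>u + e\<close>; for \<open>t \<le> e\<close>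
    this concerns the whole interval.\<close>
  have gpart: "\<bar>J 0 u t b -
      (ls_integral (u - t) (max (u - t) (u - e)) (\<lambda>s. (u - s) powr al) z + ls_integral (max (u - t) (u - e)) u (\<lambda>s. (u + e - s) powr al) z)\<bar>
      \<le> 2 * ?R + 2 * ?S"
    if z: "holder_on 1 Kz (u - t) u z" and dz: "\<And>s. s \<in> {u - t..u} \<Longrightarrow> \<bar>b s - z s\<bar> \<le> D" and u: "0 \<le> u" "u \<le> T" for u z Kz
  proof (cases "t \<le> e")
    case True
    have "ls_integral (u - t) u (\<lambda>s. (u + e - s) powr al) z = J e u t z"
      using ls_integral_powr[OF z, of e al "\<lambda>s. (u + e - s) powr al"] t e al al1 by (simp add: add.commute)
    moreover have "\<bar>J 0 u t b - J e u t z\<bar> \<le> 2 * ?R + ?S"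
      by (rule near_bound) (use z dz u t T True neg in auto)
    moreover have "max (u - t) (u - e) = u - t" using True by simp
    ultimately show ?thesis using RS(2) by (simp add: ls_integral_empty)
  next
    case False
    have m: "max (u - t) (u - e) = u - e" using False by simp
    have z': "holder_on 1 Kz (u - t) (u - e) z" "holder_on 1 Kz (u - e) u z"
      using holder_on_subset[OF z] False e by auto
    have 1: "ls_integral (u - t) (u - e) (\<lambda>s. (u - s) powr al) z = J e (u - e) (t - e) z"
      using ls_integral_powr[OF z'(1), of e al "\<lambda>s. (u - s) powr al"] False e al al1 by simp
    have 2: "ls_integral (u - e) u (\<lambda>s. (u + e - s) powr al) z = J e u e z"
      using ls_integral_powr[OF z'(2), of e al "\<lambda>s. (u + e - s) powr al"] False e al al1 by (simp add: add.commute)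
    have "J 0 u t b = J 0 u e b + J (0 + e) (u - e) (t - e) b"
      by (rule powr_increment_split[OF b_holder_sub]) (use u t T e False al_half al al_g g_pos in auto)
    moreover have "\<bar>J 0 u e b - J e u e z\<bar> \<le> 2 * ?R + ?S"
      by (rule near_bound) (use z' dz u t T e False neg in auto)
    moreover have "\<bar>J e (u - e) (t - e) b - J e (u - e) (t - e) z\<bar> \<le> ?S"
      by (rule sup_part) (use z' dz u t T e False neg in auto)
    ultimately show ?thesis unfolding m 1 2 abs_le_iff by simp
  qed
  have f: "ls_integral (- A) (- e) (f_fun H t) z2 = J (t + e) (0 - e) (A - e) z2 - J (0 + e) (0 - e) (A - e) z2"
    using ls_integral_powr_difference[OF z2'[of "- A" "- e"], of "t + e" e al "f_fun H t"] t e T al al1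
    by (simp add: H f_fun_def)
  have fb: "\<bar>J c 0 A b - J (c + e) (0 - e) (A - e) z2\<bar> \<le> ?R + ?S" if "0 \<le> c" for c
    by (rule far_bound) (use z2'[of "- A" "- e"] d2 T e that neg in auto)
  have F: "ls_integral (- A) (- t - e) (F_fun H t) z2 =
      J (0 + e) (- t - e) (A - t - e) z2 - J (t + e) (- t - e) (A - t - e) z2"
    using ls_integral_powr_difference[OF z2'[of "- A" "- t - e"], of e "t + e" al "F_fun H t"] t e tA al al1
    by (simp add: H F_fun_def algebra_simps)
  have Fb: "\<bar>J c (- t) (A - t) b - J (c + e) (- t - e) (A - t - e) z2\<bar> \<le> ?R + ?S" if "0 \<le> c" for c
    by (rule far_bound) (use z2'[of "- A" "- t - e"] d2 T t tA e that neg in auto)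
  \<comment> \<open>Replacing \<open>t\<close> by \<open>t - e\<close> in \<open>F_fun\<close> moves
    the singularity from \<open>- t\<close> to \<open>e - t\<close>. For \<open>t < e\<close> the
    piece is absent, and the Hoelder property pays for the omission.\<close>
  define X where "X = (if - (- e) \<le> t then ls_integral (- t - e) (- t) (F_fun H (t + - e)) z2 else 0)"
  have X: "\<bar>J 0 (- t) (A - t) b - J t (- t) (A - t) b - (ls_integral (- A) (- t - e) (F_fun H t) z2 + X)\<bar>
    \<le> 4 * ?R + 4 * ?S"
  proof (cases "e \<le> t")
    case False
    then show ?thesis using Fb[of 0] Fb[of t] t RS unfolding X_def F abs_le_iff by simp
  next
    case True
    have "ls_integral (- t - e) (- t) (F_fun H (t + - e)) z2 = J e (- t) e z2 - J t (- t) e z2"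
      using ls_integral_powr_difference[OF z2'[of "- t - e" "- t"], of e t al "F_fun H (t + - e)"] True t e tA al al1
      by (simp add: H F_fun_def algebra_simps)
    then have Xe: "X = J e (- t) e z2 - J t (- t) e z2"
      using True by (simp add: X_def)
    have sp: "J c (- t) (A - t) b = J c (- t) e b + J (c + e) (- t - e) (A - t - e) b" if "0 \<le> c" for c
      by (rule powr_increment_split[OF b_holder_sub]) (use that t T tA e al_half al al_g g_pos in auto)
    have n: "\<bar>J 0 (- t) e b - J e (- t) e z2\<bar> \<le> 2 * ?R + ?S"
      "\<bar>J t (- t) e b - J t (- t) e z2\<bar> \<le> 2 * ?R + ?S"
      by (rule near_bound; use z2'[of "- t - e" "- t"] d2 T t tA e neg True in auto)+
    have s: "\<bar>J (c + e) (- t - e) (A - t - e) b - J (c + e) (- t - e) (A - t - e) z2\<bar> \<le> ?S" if "0 \<le> c" for c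
      by (rule sup_part) (use z2'[of "- A" "- t - e"] d2 T t tA e neg that in auto)
    show ?thesis using n s[of 0] s[of t] sp[of 0] sp[of t] t unfolding Xe F abs_le_iff by simp
  qed
  let ?h = "\<lambda>s. - inv_integral (f_fun H t) (- 1 / A) s"
  let ?h' = "\<lambda>s. - inv_integral (f_fun H (- t)) (- 1 / A) s"
  have mx: "max (- A) (- t + - e) = - t - e" using tA by simp
  have gf: "g_fun H t = (\<lambda>s. (t - s) powr al)" by (simp add: fun_eq_iff g_fun_def H)
  have W: "W_approx 1 H (- A) (- e) z1 z2 z3 t =
     (ls_integral (t - t) (max (t - t) (t - e)) (\<lambda>s. (t - s) powr al) z1 + ls_integral (max (t - t) (t - e)) t (\<lambda>s. (t + e - s) powr al) z1)
     + (J (t + e) (0 - e) (A - e) z2 - J (0 + e) (0 - e) (A - e) z2)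
     + (f_fun H t (- A) * z2 (- A) - ls_integral (- 1 / A) 0 ?h z3)"
    using H12 unfolding W_approx_def inv f gf by (simp add: max.commute algebra_simps)
  have Y: "Y_approx 1 H (- A) (- e) z2 z3 t =
     - (ls_integral (0 - t) (max (0 - t) (0 - e)) (\<lambda>s. (0 - s) powr al) z2 + ls_integral (max (0 - t) (0 - e)) 0 (\<lambda>s. (0 + e - s) powr al) z2)
     + (ls_integral (- A) (- t - e) (F_fun H t) z2 + X)
     + (f_fun H (- t) (- A) * z2 (- A) - ls_integral (- 1 / A) 0 ?h' z3)"
    using H12 unfolding Y_approx_def inv mx X_def[symmetric] F_fun_eq[of H t] by (simp add: H max.commute algebra_simps)
  \<comment> \<open>Cut-off \<open>y = 0\<close>: the tail is complete, and since
    \<open>0 powr x = 0\<close> the omitted part contributes nothing.\<close>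
  have T1: "\<bar>tail_increment al A t b - (f_fun H t (- A) * z2 (- A) - ls_integral (- 1 / A) 0 ?h z3)\<bar> \<le>
     (fc + tc * (((1 / A) powr (- al) - 0 powr (- al)) / (- al))) * D +
     tc * K * (0 powr (g - al) / (g - al))"
    by (rule tail_error) (use t A_pos H neg in auto)
  have T2: "\<bar>tail_increment al A (- t) b - (f_fun H (- t) (- A) * z2 (- A) - ls_integral (- 1 / A) 0 ?h' z3)\<bar> \<le>
     (fc + tc * (((1 / A) powr (- al) - 0 powr (- al)) / (- al))) * D +
     tc * K * (0 powr (g - al) / (g - al))"
    by (rule tail_error) (use t A_pos H neg in auto)
  have T0: "(fc + tc * (((1 / A) powr (- al) - 0 powr (- al)) / (- al))) * D +
     tc * K * (0 powr (g - al) / (g - al)) = (fc + tc * (1 / A) powr (- al) / (- al)) * D"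
    by simp
  have G1: "\<bar>J 0 t t b - (ls_integral (t - t) (max (t - t) (t - e)) (\<lambda>s. (t - s) powr al) z1 + ls_integral (max (t - t) (t - e)) t (\<lambda>s. (t + e - s) powr al) z1)\<bar> \<le> 2 * ?R + 2 * ?S"
    by (rule gpart) (use z1'[of 0 t] d1 t in auto)
  have G2: "\<bar>J 0 0 t b - (ls_integral (0 - t) (max (0 - t) (0 - e)) (\<lambda>s. (0 - s) powr al) z2 + ls_integral (max (0 - t) (0 - e)) 0 (\<lambda>s. (0 + e - s) powr al) z2)\<bar> \<le> 2 * ?R + 2 * ?S"
    by (rule gpart) (use z2'[of "- t" 0] d2 t tA T in auto)
  define R S U where "R = ?R" and "S = ?S" and
    "U = (fc + tc * (1 / A) powr (- al) / (- al)) * D"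
  have fb': "\<bar>J t 0 A b - J (t + e) (0 - e) (A - e) z2\<bar> \<le> R + S"
    "\<bar>J 0 0 A b - J (0 + e) (0 - e) (A - e) z2\<bar> \<le> R + S"
    using fb[of t] fb[of 0] t by (simp_all add: R_def S_def)
  have "\<bar>subfbm_functional al A t b - approx H t\<bar> \<le> 10 * R + 10 * S + 2 * U"
    using G1[folded R_def S_def] G2[folded R_def S_def] fb' X[folded R_def S_def]
      T1[unfolded T0, folded U_def] T2[unfolded T0, folded U_def]
    unfolding W Y subfbm_functional_def abs_le_iff by linarith
  then show ?thesis by (simp add: R_def S_def U_def)
qed

end

text \<open>Large enough for both signs of \<open>al\<close> and free of \<open>D\<close>,
  \<open>K\<close>, \<open>e\<close> and \<open>t\<close>; 44 is the sum of the numerical constants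
  24 and 20 of \<open>E1\<close> and \<open>E2\<close> in the next proof.\<close>

definition error_const :: "real \<Rightarrow> real \<Rightarrow> real \<Rightarrow> real \<Rightarrow> real" where
  "error_const al A T g = 44 + 24 * (2 * A) powr al + 2 * f_end_const al A T + 10 * (1 + \<bar>al\<bar> / (g - \<bar>al\<bar>))
     + 2 * tail_const al A T * ((1 + (1 / A) powr \<bar>al\<bar>) / \<bar>al\<bar> + 1 / (g - \<bar>al\<bar>))"

lemma (in approximated_path) approximation_error:
  assumes H: "al = H - 1/2" and t: "0 \<le> t" "t \<le> T"
  shows "\<bar>subfbm_functional al A t b - approx H t\<bar> \<le>
     error_const al A T g * (D * e powr (- \<bar>al\<bar>) + K * e powr (g - \<bar>al\<bar>))"
proof -
  let ?P = "e powr (- \<bar>al\<bar>)" and ?Q = "e powr (g - \<bar>al\<bar>)"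
  \<comment> \<open>Since \<open>e < 1\<close>, this factor absorbs every term that carries
    \<open>D\<close> alone.\<close>
  have P: "1 \<le> ?P" using e powr_mono'[of "- \<bar>al\<bar>" 0 e] by simp
  have Q: "0 \<le> ?Q" by simp
  have tc: "0 \<le> tc" using T by (intro tail_const_nonneg) simp
  have f: "0 \<le> fc" by (simp add: f_end_const_def)
  have al0: "0 < \<bar>al\<bar>" "0 < g - \<bar>al\<bar>" using al by auto
  have DP: "D \<le> D * ?P" using mult_left_mono[OF P D_nonneg] by simp
  define E1 where "E1 = 24 + 24 * (2 * A) powr al + 2 * fc + 2 * tc * ((1 + (1 / A) powr \<bar>al\<bar>) / \<bar>al\<bar>)"
  define E2 where "E2 = 20 + 10 * (1 + \<bar>al\<bar> / (g - \<bar>al\<bar>)) + 2 * tc * (1 / (g - \<bar>al\<bar>))"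
  have E: "error_const al A T g = E1 + E2" "0 \<le> E1" "0 \<le> E2"
    using tc f al0 by (auto simp: E1_def E2_def error_const_def distrib_left)
  have "E1 * (D * ?P) + E2 * (K * ?Q) \<le> (E1 + E2) * (D * ?P + K * ?Q)"
    using E(2,3) D_nonneg K_nonneg P Q by (simp add: algebra_simps)
  moreover have "\<bar>subfbm_functional al A t b - approx H t\<bar>
     \<le> E1 * (D * ?P) + E2 * (K * ?Q)"
  proof (cases "0 < al")
    case True
    have a: "\<bar>al\<bar> = al" using True by simp
    have "24 * D * (2 * A) powr al + 2 * ((fc + tc * (((1 / A) powr (- al) - e powr (- al)) / (- al))) * D +
       tc * K * (e powr (g - al) / (g - al))) \<le>
       24 * (2 * A) powr al * (D * ?P) + 2 * fc * (D * ?P) + 2 * tc * (1 / al) * (D * ?P) + 2 * tc * (1 / (g - al)) * (K * ?Q)"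
    proof -
      define q where "q = ((1 / A) powr (- al) - e powr (- al)) / (- al)"
      have "q = (e powr (- al) - (1 / A) powr (- al)) / al"
        using True by (simp add: q_def field_simps)
      also have "\<dots> \<le> e powr (- al) / al" using True by (intro divide_right_mono) auto
      finally have "tc * D * q \<le> tc * D * (e powr (- al) / al)"
        using tc D_nonneg by (intro mult_left_mono) auto
      then have "tc * D * q \<le> tc * (1 / al) * (D * ?P)" unfolding a by (simp add: mult_ac)
      moreover have "(2 * A) powr al * D \<le> (2 * A) powr al * (D * ?P)" "fc * D \<le> fc * (D * ?P)"
        using DP f by (auto intro: mult_left_mono)
      moreover have "2 * ((fc + tc * q) * D + tc * K * (e powr (g - al) / (g - al))) =
        2 * (fc * D) + 2 * (tc * D * q) + 2 * tc * (1 / (g - al)) * (K * ?Q)"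
        unfolding a by (simp add: algebra_simps)
      moreover have "24 * D * (2 * A) powr al = 24 * ((2 * A) powr al * D)"
        "24 * (2 * A) powr al * (D * ?P) = 24 * ((2 * A) powr al * (D * ?P))" "2 * fc * (D * ?P) = 2 * (fc * (D * ?P))"
        "2 * tc * (1 / al) * (D * ?P) = 2 * (tc * (1 / al) * (D * ?P))"
        by (simp_all only: mult_ac)
      ultimately show ?thesis unfolding q_def[symmetric] by linarith
    qed
    also have "\<dots> \<le> E1 * (D * ?P) + E2 * (K * ?Q)"
    proof -
      have "24 * (2 * A) powr al + 2 * fc + 2 * tc * (1 / al) \<le> E1"
        unfolding E1_def a using True tc
        by (simp add: add_divide_distrib distrib_left)
      moreover have "2 * tc * (1 / (g - al)) \<le> E2"
        unfolding E2_def a using True al0 by simp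
      moreover have "0 \<le> D * ?P" "0 \<le> K * ?Q" using D_nonneg K_nonneg by simp_all
      ultimately have "(24 * (2 * A) powr al + 2 * fc + 2 * tc * (1 / al)) * (D * ?P) \<le> E1 * (D * ?P)"
        "2 * tc * (1 / (g - al)) * (K * ?Q) \<le> E2 * (K * ?Q)"
        by (blast intro: mult_right_mono)+
      then show ?thesis by (simp add: distrib_right)
    qed
    finally show ?thesis using approximation_error_pos[OF H True t] by linarith
  next
    case False
    then have neg: "al < 0" using al by simp
    then have a: "\<bar>al\<bar> = - al" by simp
    have n: "near = 1 + \<bar>al\<bar> / (g - \<bar>al\<bar>)" using a by (simp add: near_def add.commute)
    have "10 * (near * K * e powr (al + g)) + 20 * (D * e powr al) +
       2 * ((fc + tc * (1 / A) powr (- al) / (- al)) * D) \<le>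
       10 * near * (K * ?Q) + 20 * (D * ?P) + 2 * (fc + tc * (1 / A) powr (- al) / (- al)) * (D * ?P)"
    proof -
      have "(fc + tc * (1 / A) powr (- al) / (- al)) * D \<le> (fc + tc * (1 / A) powr (- al) / (- al)) * (D * ?P)"
        using DP f tc neg by (intro mult_left_mono add_nonneg_nonneg divide_nonneg_pos mult_nonneg_nonneg) auto
      moreover have "2 * v * (D * ?P) = 2 * (v * (D * ?P))" for v by simp
      moreover have "10 * (near * K * e powr (al + g)) = 10 * near * (K * ?Q)" "e powr al = ?P"
        using a by (simp_all add: add.commute)
      ultimately show ?thesis by (simp only:)
    qed
    also have "\<dots> \<le> E1 * (D * ?P) + E2 * (K * ?Q)"
    proof -
      have "20 + 2 * (fc + tc * (1 / A) powr (- al) / (- al)) \<le> E1"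
      proof -
        have "E1 = 24 + 24 * (2 * A) powr al + 2 * fc + 2 * tc * (1 / \<bar>al\<bar>) + 2 * (tc * (1 / A) powr (- al) / (- al))"
          unfolding E1_def a by (simp add: add_divide_distrib distrib_left diff_divide_distrib right_diff_distrib)
        moreover have "0 \<le> 2 * tc * (1 / \<bar>al\<bar>)" "0 \<le> 24 * (2 * A) powr al" using tc by auto
        ultimately show ?thesis by (simp only: distrib_left)
      qed
      moreover have "10 * near \<le> E2" unfolding E2_def n using tc al0 by simp
      moreover have "0 \<le> D * ?P" "0 \<le> K * ?Q" using D_nonneg K_nonneg by simp_all
      ultimately have "(20 + 2 * (fc + tc * (1 / A) powr (- al) / (- al))) * (D * ?P) \<le> E1 * (D * ?P)"
        "10 * near * (K * ?Q) \<le> E2 * (K * ?Q)"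
        by (blast intro: mult_right_mono)+
      then show ?thesis by (simp add: distrib_right)
    qed
    finally show ?thesis using approximation_error_neg[OF H neg t] by linarith
  qed
  ultimately show ?thesis unfolding E(1) by linarith
qed

section \<open>Continuity of the functional in time\<close>

context regular_path
begin

text \<open>Dominated convergence: the majorant
  \<open>\<bar>al\<bar> * K * x powr (al + g - 1)\<close> on \<open>(0, T + A)\<close> is the same
  for all shifts, endpoints and lengths. The positive limit length keeps
  \<open>(c + L) powr al\<close> away from the singularity.\<close>

lemma powr_increment_tendsto:
  assumes lim: "cn \<longlonglongrightarrow> c" "un \<longlonglongrightarrow> u" "Len \<longlonglongrightarrow> L"
    and dom: "\<And>n. 0 \<le> cn n" "\<And>n. 0 \<le> Len n" "\<And>n. - A \<le> un n - Len n" "\<And>n. un n \<le> T"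
    and pos: "0 \<le> c" "0 < L" "- A \<le> u - L" "u \<le> T"
  shows "(\<lambda>n. J (cn n) (un n) (Len n) b) \<longlonglongrightarrow> J c u L b"
  unfolding powr_increment_def
proof (intro tendsto_add tendsto_mult tendsto_diff)
  have bc: "isCont b x" for x using b_cont by (simp add: continuous_on_eq_continuous_at)
  show "(\<lambda>n. (cn n + Len n) powr al) \<longlonglongrightarrow> (c + L) powr al"
    using lim pos by (intro tendsto_powr tendsto_add) auto
  show "(\<lambda>n. b (un n)) \<longlonglongrightarrow> b u" "(\<lambda>n. b (un n - Len n)) \<longlonglongrightarrow> b (u - L)"
    using lim by (auto intro!: isCont_tendsto_compose[OF bc] tendsto_intros)
  have al1: "al < 1" using al_half by simp
  have h: "al + g - 1 \<noteq> - 1" "0 < 0 + 0 \<or> - 1 < al + g - 1" using al_g by auto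
  show "(\<lambda>n. LBINT x:{0<..<Len n}. - al * (cn n + x) powr (al - 1) * (b (un n) - b (un n - x))) \<longlonglongrightarrow>
    (LBINT x:{0<..<L}. - al * (c + x) powr (al - 1) * (b u - b (u - x)))"
    unfolding set_lebesgue_integral_def
  proof (rule integral_dominated_convergence)
    show "(\<lambda>x. indicator {0<..<L} x *\<^sub>R (- al * (c + x) powr (al - 1) * (b u - b (u - x)))) \<in> borel_measurable lborel"
      by measurable
    show "(\<lambda>x. indicator {0<..<Len n} x *\<^sub>R (- al * (cn n + x) powr (al - 1) * (b (un n) - b (un n - x)))) \<in> borel_measurable lborel" for n
      by measurable
    have "set_integrable lborel {0<..<T + A} (\<lambda>x. \<bar>al\<bar> * K * (0 + x) powr (al + g - 1))"
      using T by (intro set_integrable_mult_right powr_integral(1)[OF order_refl order_refl _ h]) auto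
    then show "integrable lborel (\<lambda>x. indicator {0<..<T + A} x *\<^sub>R (\<bar>al\<bar> * K * x powr (al + g - 1)))"
      by (simp add: set_integrable_def)
    show "AE x in lborel. norm (indicator {0<..<Len n} x *\<^sub>R (- al * (cn n + x) powr (al - 1) * (b (un n) - b (un n - x))))
      \<le> indicator {0<..<T + A} x *\<^sub>R (\<bar>al\<bar> * K * x powr (al + g - 1))" for n
    proof (rule AE_I2)
      fix x :: real
      show "norm (indicator {0<..<Len n} x *\<^sub>R (- al * (cn n + x) powr (al - 1) * (b (un n) - b (un n - x))))
        \<le> indicator {0<..<T + A} x *\<^sub>R (\<bar>al\<bar> * K * x powr (al + g - 1))"
      proof (cases "x \<in> {0<..<Len n}")
        case True
        then have "x \<in> {0<..<T + A}" using dom(3,4)[of n] by auto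
        moreover have "\<bar>- al * (cn n + x) powr (al - 1) * (b (un n) - b (un n - x))\<bar> \<le> \<bar>al\<bar> * K * x powr (al + g - 1)"
          by (rule increment_kernel_bound[OF b_holder_sub[OF dom(3,4)] dom(1) al1 True])
        ultimately show ?thesis using True by simp
      qed (use K_nonneg in simp)
    qed
    show "AE x in lborel. (\<lambda>n. indicator {0<..<Len n} x *\<^sub>R (- al * (cn n + x) powr (al - 1) * (b (un n) - b (un n - x))))
      \<longlonglongrightarrow> indicator {0<..<L} x *\<^sub>R (- al * (c + x) powr (al - 1) * (b u - b (u - x)))"
      \<comment> \<open>At \<open>x = L\<close> the indicators of the intervals
        \<open>(0, Len n)\<close> need not converge.\<close>
      using AE_lborel_singleton[of L]
    proof eventually_elim
      case (elim x)
      show ?case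
      proof (cases "0 < x")
        case x: True
        have "\<forall>\<^sub>F n in sequentially. indicator {0<..<Len n} x = (indicator {0<..<L} x :: real)"
        proof (cases "x < L")
          case True
          then show ?thesis using order_tendstoD(1)[OF lim(3) True] x by (auto elim!: eventually_mono)
        next
          case False
          then have "L < x" using elim by simp
          then show ?thesis using order_tendstoD(2)[OF lim(3) \<open>L < x\<close>] x by (auto elim!: eventually_mono)
        qed
        then have "(\<lambda>n. indicator {0<..<Len n} x) \<longlonglongrightarrow> (indicator {0<..<L} x :: real)"
          by (rule tendsto_eventually)
        then show ?thesis
          using x pos lim by (intro tendsto_intros tendsto_powr isCont_tendsto_compose[OF bc]) auto
      qed simp
    qed
  qed
qed

lemma tail_increment_tendsto:
  assumes lim: "tn \<longlonglongrightarrow> t" and t: "\<And>n. \<bar>tn n\<bar> \<le> T" "\<bar>t\<bar> \<le> T"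
  shows "(\<lambda>n. tail_increment al A (tn n) b) \<longlonglongrightarrow> tail_increment al A t b"
  unfolding tail_increment_def set_lebesgue_integral_def
proof (rule integral_dominated_convergence)
  have al1: "al < 1" using al_half by simp
  have tc: "0 \<le> tc" using T by (intro tail_const_nonneg) simp
  show "(\<lambda>x. indicator {0<..<1 / A} x *\<^sub>R (tail_density al t x * (b (- A) - b (- 1 / x)))) \<in> borel_measurable lborel"
    "(\<lambda>x. indicator {0<..<1 / A} x *\<^sub>R (tail_density al (tn n) x * (b (- A) - b (- 1 / x)))) \<in> borel_measurable lborel" for n
    by measurable
  have h: "- al \<noteq> - 1" "0 < 0 + 0 \<or> - 1 < - al" "g - 1 - al \<noteq> - 1" "0 < 0 + 0 \<or> - 1 < g - 1 - al"
    using al_half al_g by auto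
  have "set_integrable lborel {0<..<1 / A} (\<lambda>x. tc * \<bar>b (- A)\<bar> * (0 + x) powr (- al)
      + tc * K * (0 + x) powr (g - 1 - al))"
    using A_pos by (intro set_integral_add(1) set_integrable_mult_right powr_integral(1)[OF order_refl order_refl _ h(1,2)]
      powr_integral(1)[OF order_refl order_refl _ h(3,4)]) auto
  then show "integrable lborel (\<lambda>x. indicator {0<..<1 / A} x *\<^sub>R (tc * \<bar>b (- A)\<bar> * x powr (- al)
      + tc * K * x powr (g - 1 - al)))"
    by (simp add: set_integrable_def)
  show "AE x in lborel. norm (indicator {0<..<1 / A} x *\<^sub>R (tail_density al (tn n) x * (b (- A) - b (- 1 / x))))
    \<le> indicator {0<..<1 / A} x *\<^sub>R (tc * \<bar>b (- A)\<bar> * x powr (- al) + tc * K * x powr (g - 1 - al))" for n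
  proof (rule AE_I2)
    fix x :: real
    show "norm (indicator {0<..<1 / A} x *\<^sub>R (tail_density al (tn n) x * (b (- A) - b (- 1 / x))))
    \<le> indicator {0<..<1 / A} x *\<^sub>R (tc * \<bar>b (- A)\<bar> * x powr (- al) + tc * K * x powr (g - 1 - al))"
    proof (cases "x \<in> {0<..<1 / A}")
      case True
      have "\<bar>tail_density al (tn n) x * (b (- A) - b (- 1 / x))\<bar> \<le> tc * x powr (- al) * (\<bar>b (- A)\<bar> + K * x powr (g - 1))"
        unfolding abs_mult
      proof (intro mult_mono tail_density_bound[OF al1 t(1) T(2)])
        show "\<bar>b (- A) - b (- 1 / x)\<bar> \<le> \<bar>b (- A)\<bar> + K * x powr (g - 1)"
          using b_inv_bound[OF True] by linarith
      qed (use True tc in auto)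
      also have "\<dots> = tc * \<bar>b (- A)\<bar> * x powr (- al) + tc * K * (x powr (- al) * x powr (g - 1))"
        by (simp add: algebra_simps)
      also have "x powr (- al) * x powr (g - 1) = x powr (g - 1 - al)" by (simp add: powr_add[symmetric])
      finally show ?thesis using True by simp
    qed simp
  qed
  show "AE x in lborel. (\<lambda>n. indicator {0<..<1 / A} x *\<^sub>R (tail_density al (tn n) x * (b (- A) - b (- 1 / x))))
    \<longlonglongrightarrow> indicator {0<..<1 / A} x *\<^sub>R (tail_density al t x * (b (- A) - b (- 1 / x)))"
  proof (rule AE_I2)
    fix x :: real
    show "(\<lambda>n. indicator {0<..<1 / A} x *\<^sub>R (tail_density al (tn n) x * (b (- A) - b (- 1 / x))))
    \<longlonglongrightarrow> indicator {0<..<1 / A} x *\<^sub>R (tail_density al t x * (b (- A) - b (- 1 / x)))"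
    proof (cases "x \<in> {0<..<1 / A}")
      case True
      then have "A < 1 / x" using A_pos by (auto simp: field_simps)
      then have "t + 1 / x \<noteq> 0" using t(2) T by linarith
      then show ?thesis unfolding tail_density_def using True
        by (intro tendsto_intros tendsto_powr lim) auto
    qed simp
  qed
qed

text \<open>Time 0 is left out because some pieces have length \<open>t\<close>, and their boundary
  terms \<open>t powr al\<close> become singular there when \<open>al < 0\<close>.\<close>

lemma subfbm_functional_continuous: "continuous_on {0<..T} (\<lambda>t. subfbm_functional al A t b)"
  unfolding continuous_on_sequentially comp_def
proof (intro allI ballI impI, elim conjE)
  fix tn t assume t: "t \<in> {0<..T}" and tn: "\<forall>n. tn n \<in> {0<..T}" and lim: "tn \<longlonglongrightarrow> t"
  have tn': "0 < tn n" "tn n \<le> T" "tn n < A" "- tn n \<le> T" for n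
  proof -
    show "0 < tn n" "tn n \<le> T" using tn by auto
    then show "tn n < A" "- tn n \<le> T" using T by auto
  qed
  have t': "0 < t" "t \<le> T" "t < A" using t T by auto
  note lims = lim tendsto_minus[OF lim] tendsto_diff[OF tendsto_const lim] tendsto_const
  show "(\<lambda>n. subfbm_functional al A (tn n) b) \<longlonglongrightarrow> subfbm_functional al A t b"
    unfolding subfbm_functional_def
    by (intro tendsto_add tendsto_diff powr_increment_tendsto tail_increment_tendsto lims)
       (use tn' t' T in \<open>auto simp: abs_le_iff intro: less_imp_le order_trans[OF less_imp_le]\<close>)
qed

end

section \<open>Probability of a large error\<close>

text \<open>The set \<open>S\<close> may lack an endpoint: the half-open cases are
  \<open>(0, T]\<close> for the functional and \<open>[- 1 / A, 0)\<close> for the time-inverted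
  Brownian motion.\<close>

lemma exists_rational_exceeding:
  fixes f :: "real \<Rightarrow> real"
  assumes lu: "l < u" and S: "{l<..<u} \<subseteq> S" "S \<subseteq> {l..u}" and f: "continuous_on S f" and t: "t \<in> S" "c < f t"
  shows "\<exists>r\<in>\<rat>. r \<in> S \<and> c < f r"
proof -
  have "(f \<longlongrightarrow> f t) (at t within S)" using f t by (simp add: continuous_on_def)
  then have "\<forall>\<^sub>F x in at t within S. c < f x" using t by (simp add: order_tendstoD)
  then obtain d where d: "0 < d" "\<And>x. x \<in> S \<Longrightarrow> x \<noteq> t \<Longrightarrow> dist x t < d \<Longrightarrow> c < f x"
    unfolding eventually_at by blast
  have "l \<le> t" "t \<le> u" using t S by auto
  then have "max l (t - d) < min u (t + d)" using lu d by auto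
  then obtain r where r: "r \<in> \<rat>" "max l (t - d) < r" "r < min u (t + d)" using Rats_dense_in_real by blast
  then have "r \<in> S" using S by auto
  moreover have "c < f r" using d(2)[of r] r t \<open>r \<in> S\<close> by (cases "r = t") (auto simp: dist_real_def)
  ultimately show ?thesis using r by blast
qed

lemma transport_velocity_bound: "\<bar>x\<bar> = 1 \<Longrightarrow> \<bar>transport_velocity n x r u\<bar> = real n"
  by (simp add: transport_velocity_def abs_mult power_abs)

text \<open>The velocity has modulus \<open>n\<close> at all times and outcomes, also where
  infinitely many changes accumulate, so Lipschitz continuity holds surely. Measurability follows
  from joint measurability of the velocity by integration in time.\<close>

lemma transport_process_regular:
  fixes M :: "'a measure"
  assumes M: "prob_space M" and Z: "transport_process M n Z"
  shows "\<And>\<omega>. \<omega> \<in> space M \<Longrightarrow> Z 0 \<omega> = 0"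
    and "\<And>\<omega> s t. \<omega> \<in> space M \<Longrightarrow> 0 \<le> s \<Longrightarrow> 0 \<le> t \<Longrightarrow> \<bar>Z s \<omega> - Z t \<omega>\<bar> \<le> real n * \<bar>s - t\<bar>"
    and "\<And>t. 0 \<le> t \<Longrightarrow> Z t \<in> borel_measurable M"
proof -
  interpret prob_space M by fact
  obtain \<xi> :: "'a \<Rightarrow> real" and \<tau> :: "nat \<Rightarrow> 'a \<Rightarrow> real" where
    xi[measurable]: "\<xi> \<in> borel_measurable M" and xi1: "\<And>\<omega>. \<omega> \<in> space M \<Longrightarrow> \<xi> \<omega> \<in> {- 1, 1}"
    and tau: "\<And>k. distributed M lborel (\<tau> k) (exponential_density ((real n)\<^sup>2))"
    and Zeq: "\<And>\<omega> t. \<omega> \<in> space M \<Longrightarrow> 0 \<le> t \<Longrightarrow> Z t \<omega> = (LBINT u=0..t. transport_velocity n (\<xi> \<omega>) (\<lambda>k. \<tau> k \<omega>) u)"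
    using Z unfolding transport_process_def by blast
  have [measurable]: "\<tau> k \<in> borel_measurable M" for k
    using distributed_measurable[OF tau[of k]] by simp
  define v where "v \<omega> u = transport_velocity n (\<xi> \<omega>) (\<lambda>k. \<tau> k \<omega>) u" for \<omega> u
  have v_joint[measurable]: "(\<lambda>(\<omega>, u). v \<omega> u) \<in> borel_measurable (M \<Otimes>\<^sub>M lborel)"
  proof -
    have "(\<lambda>x. card {k. (\<Sum>j\<le>k. \<tau> j (fst x)) \<le> snd x}) \<in> measurable (M \<Otimes>\<^sub>M lborel) (count_space UNIV)"
      by (rule measurable_card) measurable
    then have "(\<lambda>x. (- 1 :: real) ^ card {k. (\<Sum>j\<le>k. \<tau> j (fst x)) \<le> snd x}) \<in> borel_measurable (M \<Otimes>\<^sub>M lborel)"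
      by (rule measurable_compose) simp
    then show ?thesis
      unfolding v_def transport_velocity_def case_prod_beta by measurable
  qed
  have v_meas[measurable]: "v \<omega> \<in> borel_measurable borel" if "\<omega> \<in> space M" for \<omega>
    using measurable_compose[OF measurable_Pair1'[OF that] v_joint] by simp
  have v_bound: "\<bar>v \<omega> u\<bar> = real n" if "\<omega> \<in> space M" for \<omega> u
    using xi1[OF that] by (auto simp: v_def intro!: transport_velocity_bound)
  have Zv: "Z t \<omega> = (\<integral>u. indicator {0<..<t} u * v \<omega> u \<partial>lborel)" if "\<omega> \<in> space M" "0 \<le> t" for \<omega> t
    using that by (simp add: Zeq v_def interval_lebesgue_integral_def set_lebesgue_integral_def zero_ereal_def)
  show "Z 0 \<omega> = 0" if "\<omega> \<in> space M" for \<omega> using Zv[OF that, of 0] by simp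
  have vi: "integrable lborel (\<lambda>u. indicator {0<..<t} u * v \<omega> u)" if w: "\<omega> \<in> space M" for \<omega> t
  proof (rule Bochner_Integration.integrable_bound)
    show "integrable lborel (\<lambda>u. real n * indicator {0<..<t} u :: real)"
      by (cases "0 \<le> t") (auto intro!: integrable_real_indicator)
    show "(\<lambda>u. indicator {0<..<t} u * v \<omega> u) \<in> borel_measurable lborel" using v_meas[OF w] by simp
  qed (auto simp: indicator_def v_bound[OF w])
  have lip: "\<bar>Z t \<omega> - Z s \<omega>\<bar> \<le> real n * (t - s)" if w: "\<omega> \<in> space M" and st: "0 \<le> s" "s \<le> t" for \<omega> s t
  proof -
    have "Z t \<omega> - Z s \<omega> = (\<integral>u. indicator {0<..<t} u * v \<omega> u - indicator {0<..<s} u * v \<omega> u \<partial>lborel)"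
      using st w by (simp add: Zv vi)
    then have "\<bar>Z t \<omega> - Z s \<omega>\<bar> \<le> (\<integral>u. \<bar>indicator {0<..<t} u * v \<omega> u - indicator {0<..<s} u * v \<omega> u\<bar> \<partial>lborel)"
      by (simp add: integral_abs_bound)
    also have "\<dots> \<le> (\<integral>u. real n * indicator {s..t} u \<partial>lborel)"
    proof (rule integral_mono')
      show "integrable lborel (\<lambda>u. real n * indicator {s..t} u :: real)"
        using st by (intro integrable_mult_right integrable_real_indicator) auto
    qed (use st v_bound[OF w] in \<open>auto simp: indicator_def\<close>)
    also have "\<dots> = real n * (t - s)" using st by simp
    finally show ?thesis .
  qed
  show "\<bar>Z s \<omega> - Z t \<omega>\<bar> \<le> real n * \<bar>s - t\<bar>" if "\<omega> \<in> space M" "0 \<le> s" "0 \<le> t" for \<omega> s t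
    using lip[OF that(1,2), of t] lip[OF that(1,3), of s] by (cases "s \<le> t") (auto simp: abs_minus_commute)
  show "Z t \<in> borel_measurable M" if "0 \<le> t" for t
  proof -
    have "(\<lambda>\<omega>. \<integral>u. indicator {0<..<t} u * v \<omega> u \<partial>lborel) \<in> borel_measurable M"
      by (rule lborel.borel_measurable_lebesgue_integral) measurable
    then show ?thesis by (rule measurable_cong[THEN iffD1, rotated]) (simp add: Zv that)
  qed
qed

text \<open>A nonmeasurable set has measure 0 by convention, so the rate carries information only
  once the exceedance sets are known to be measurable. Continuity on \<open>S\<close> reduces the
  supremum to rational times; at the remaining points the two processes coincide.\<close>

lemma transport_rate_events:
  fixes X :: "real \<Rightarrow> 'a \<Rightarrow> real" and Z :: "nat \<Rightarrow> real \<Rightarrow> 'a \<Rightarrow> real"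
  assumes rate: "transport_rate M {l..u} X Z" "0 < q" and lu: "l < u" and S: "{l<..<u} \<subseteq> S" "S \<subseteq> {l..u}"
    and meas: "\<And>n t. 1 \<le> n \<Longrightarrow> t \<in> {l..u} \<Longrightarrow> (\<lambda>\<omega>. X t \<omega> - Z n t \<omega>) \<in> borel_measurable M"
    and cont: "\<And>n \<omega>. 1 \<le> n \<Longrightarrow> \<omega> \<in> space M \<Longrightarrow> continuous_on S (\<lambda>t. X t \<omega> - Z n t \<omega>)"
    and eq: "\<And>n \<omega> t. 1 \<le> n \<Longrightarrow> \<omega> \<in> space M \<Longrightarrow> t \<in> {l..u} - S \<Longrightarrow> X t \<omega> = Z n t \<omega>"
  obtains C E where "0 < C" and "\<And>n. 1 \<le> n \<Longrightarrow> E n \<in> sets M" and "(\<lambda>n. measure M (E n)) \<in> o(\<lambda>n. real n powr (- q))"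
    and "\<And>n \<omega> t. \<omega> \<in> space M - E n \<Longrightarrow> t \<in> {l..u} \<Longrightarrow>
      \<bar>X t \<omega> - Z n t \<omega>\<bar> \<le> C * (real n powr (- 1/2) * ln (real n) powr (5/2))"
proof -
  obtain C where C: "0 < C" and o: "(\<lambda>n. sup_exceed_prob M {l..u} X (Z n) (C * real n powr (- 1/2) * ln (real n) powr (5/2)))
      \<in> o(\<lambda>n. real n powr (- q))"
    using rate unfolding transport_rate_def by blast
  define c where "c n = C * (real n powr (- 1/2) * ln (real n) powr (5/2))" for n :: nat
  have c: "0 \<le> c n" for n using C by (simp add: c_def)
  define E where "E n = {\<omega>\<in>space M. (SUP t\<in>{l..u}. ereal \<bar>X t \<omega> - Z n t \<omega>\<bar>) > ereal (c n)}" for n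
  have "E n \<in> sets M" if n: "1 \<le> n" for n
  proof -
    have "\<exists>r\<in>\<rat> \<inter> {l..u}. c n < \<bar>X r \<omega> - Z n r \<omega>\<bar>"
      if w: "\<omega> \<in> space M" and t: "t \<in> {l..u}" "c n < \<bar>X t \<omega> - Z n t \<omega>\<bar>" for \<omega> t
    proof -
      have "t \<in> S" using eq[OF n w, of t] t c[of n] by (cases "t \<in> S") auto
      moreover have "continuous_on S (\<lambda>t. \<bar>X t \<omega> - Z n t \<omega>\<bar>)" by (intro continuous_on_rabs cont n w)
      ultimately show ?thesis using exists_rational_exceeding[OF lu S] t S by blast
    qed
    then have "E n = (\<Union>r\<in>\<rat> \<inter> {l..u}. {\<omega>\<in>space M. c n < \<bar>X r \<omega> - Z n r \<omega>\<bar>})"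
      by (auto simp: E_def less_SUP_iff)
    moreover have "{\<omega>\<in>space M. c n < \<bar>X r \<omega> - Z n r \<omega>\<bar>} \<in> sets M" if "r \<in> {l..u}" for r
      using borel_measurable_abs[OF meas[OF n that]] by simp
    ultimately show ?thesis by (auto intro!: sets.countable_UN' countable_rat countable_Int1)
  qed
  moreover have "(\<lambda>n. measure M (E n)) \<in> o(\<lambda>n. real n powr (- q))"
    using o by (simp add: sup_exceed_prob_def E_def c_def mult.assoc)
  moreover have "\<bar>X t \<omega> - Z n t \<omega>\<bar> \<le> c n" if "\<omega> \<in> space M - E n" "t \<in> {l..u}" for n \<omega> t
    using that by (auto simp: E_def less_SUP_iff not_less)
  ultimately show thesis using that C unfolding c_def by blast
qed

text \<open>If the exceedance set fails to be measurable, its measure is 0 and the inequality is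
  trivial; otherwise it is monotonicity.\<close>

lemma sup_exceed_prob_le:
  assumes "prob_space M" and "N \<in> sets M"
    and "\<And>\<omega> t. \<omega> \<in> space M - N \<Longrightarrow> t \<in> I \<Longrightarrow> \<bar>X t \<omega> - Y t \<omega>\<bar> \<le> c"
  shows "sup_exceed_prob M I X Y c \<le> measure M N"
proof -
  interpret prob_space M by fact
  let ?E = "{\<omega>\<in>space M. (SUP t\<in>I. ereal \<bar>X t \<omega> - Y t \<omega>\<bar>) > ereal c}"
  have "?E \<subseteq> N" using assms(3) by (force simp: less_SUP_iff)
  then show ?thesis unfolding sup_exceed_prob_def
    using assms(2) by (cases "?E \<in> sets M") (auto simp: measure_notin_sets intro: finite_measure_mono)
qed

text \<open>Each time has its own null set; those of the rational times are united, and continuity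
  of both sides extends the equality to all times. The set is chosen before \<open>g\<close> and
  \<open>K\<close>, so it serves all regularity events at once.\<close>

lemma (in two_sided_brownian_motion) subfbm_version_eq_functional:
  assumes S: "subfbm_version M B H C T S" and H: "H - 1/2 \<noteq> 0" "0 < H" "H < 1" and T: "0 < T" "T < A"
  obtains N where "N \<in> null_sets M"
    and "\<And>\<omega> g K t. \<omega> \<in> space M - N \<Longrightarrow> regular_path (H - 1/2) A T g K (\<lambda>s. B s \<omega>) \<Longrightarrow> t \<in> {0..T} \<Longrightarrow>
      S t \<omega> = C * subfbm_functional (H - 1/2) A t (\<lambda>s. B s \<omega>)"
proof -
  let ?U = "\<lambda>t \<omega>. subfbm_functional (H - 1/2) A t (\<lambda>s. B s \<omega>)"
  have "AE \<omega> in M. S t \<omega> = C * ?U t \<omega>" if t: "t \<in> {0..T}" for t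
  proof -
    obtain X where X: "has_wiener_integral M B (subfbm_kernel H t) X" and eq: "AE \<omega> in M. S t \<omega> = C * X \<omega>"
      using S t unfolding subfbm_version_def by blast
    have "AE \<omega> in M. X \<omega> = ?U t \<omega>"
      by (rule wiener_integral_subfbm_kernel[OF X H]) (use t T in auto)
    with eq show ?thesis by eventually_elim simp
  qed
  then have "AE \<omega> in M. \<forall>t\<in>\<rat> \<inter> {0..T}. S t \<omega> = C * ?U t \<omega>"
    by (intro AE_ball_countable') (auto simp: countable_rat)
  then obtain N where N: "{\<omega> \<in> space M. \<not> (\<forall>t\<in>\<rat> \<inter> {0..T}. S t \<omega> = C * ?U t \<omega>)} \<subseteq> N" "N \<in> null_sets M"
    by (auto elim!: AE_E intro: that simp: null_sets_def)
  show thesis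
  proof (rule that[OF N(2)])
    fix \<omega> g K t assume w: "\<omega> \<in> space M - N" and reg: "regular_path (H - 1/2) A T g K (\<lambda>s. B s \<omega>)" and t: "t \<in> {0..T}"
    have rat: "S r \<omega> = C * ?U r \<omega>" if "r \<in> \<rat>" "r \<in> {0..T}" for r using N(1) w that by blast
    show "S t \<omega> = C * ?U t \<omega>"
    proof (rule ccontr)
      assume ne: "S t \<omega> \<noteq> C * ?U t \<omega>"
      \<comment> \<open>Time 0 is rational, hence settled; any other time lies in
        \<open>(0, T]\<close>, where the functional is continuous.\<close>
      then have "t \<noteq> 0" using rat[of 0] t by auto
      have "continuous_on {0<..T} (\<lambda>t. S t \<omega>)"
        using S w unfolding subfbm_version_def by (auto intro: continuous_on_subset)
      then have "continuous_on {0<..T} (\<lambda>t. \<bar>S t \<omega> - C * ?U t \<omega>\<bar>)"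
        by (intro continuous_intros regular_path.subfbm_functional_continuous[OF reg])
      then have "\<exists>r\<in>\<rat>. r \<in> {0<..T} \<and> 0 < \<bar>S r \<omega> - C * ?U r \<omega>\<bar>"
        by (rule exists_rational_exceeding[OF T(1), rotated 2]) (use ne t \<open>t \<noteq> 0\<close> in auto)
      then show False using rat by auto
    qed
  qed
qed


section \<open>Choice of the exponents and conclusion\<close>

lemma powr_mult_smallo:
  assumes "q < s"
  shows "(\<lambda>n. C * real n powr (- s)) \<in> o(\<lambda>n. real n powr (- q))"
proof -
  have "(\<lambda>n. real n powr (- s)) \<in> o(\<lambda>n. real n powr (- q))"
    using assms filterlim_real_sequentially by (subst powr_smallo_iff) auto
  then show ?thesis by simp
qed

theorem corollary2p3:
  fixes M :: "'a measure" and B S :: "real \<Rightarrow> 'a \<Rightarrow> real"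
    and Z1 Z2 Z3 :: "nat \<Rightarrow> real \<Rightarrow> 'a \<Rightarrow> real"
    and H T a C_H q \<beta> :: real
  assumes "H \<in> {0<..<1/2} \<union> {1/2<..<1}" and "T > 0" and "a < - T"
    and "two_sided_brownian_motion M B"
    and "C_H > 0"
    and "subfbm_version M B H C_H T S"
    and "\<forall>s\<in>{0..T}. \<forall>t\<in>{0..T}. prob_space.expectation M (\<lambda>\<omega>. S s \<omega> * S t \<omega>) =
           s powr (2 * H) + t powr (2 * H)
             - 1/2 * ((s + t) powr (2 * H) + \<bar>s - t\<bar> powr (2 * H))"
    and "\<forall>n\<ge>1. transport_process M n (Z1 n)"
    and "\<forall>n\<ge>1. transport_process M n (\<lambda>s. Z2 n (- s))"
    and "\<forall>n\<ge>1. transport_process M n (\<lambda>s. Z3 n (- s))"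
    and "transport_rate M {0..T} B Z1"
    and "transport_rate M {a..0} B Z2"
    and "transport_rate M {1/a..0} (brownian_inversion B) Z3"
    and "q > 0" and "0 < \<bar>H - 1/2\<bar>" and "\<bar>H - 1/2\<bar> < \<beta>" and "\<beta> < 1/2"
  shows "\<exists>C>0. (\<lambda>n. sup_exceed_prob M {0..T} S (S_approx C_H H a \<beta> Z1 Z2 Z3 n)
                  (C * real n powr (- (1/2 - \<beta>)) * ln (real n) powr (5/2)))
               \<in> o(\<lambda>n. real n powr (- q))"
proof -
  interpret two_sided_brownian_motion M B by fact
  have PM: "prob_space M" by (rule prob_space_axioms)
  define al where "al = H - 1/2"
  define A where "A = - a"
  \<comment> \<open>With this ratio the truncation length is \<open>n powr (- 1 / r)\<close>. The
    Hoelder order \<open>g\<close> is the midpoint of \<open>r / 2\<close> and \<open>1/2\<close>: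
    the lower bound makes \<open>eta\<close> positive and also gives
    \<open>\<bar>al\<bar> < g\<close>.\<close>
  define r where "r = \<bar>al\<bar> / \<beta>"
  define g where "g = (r + 1) / 4"
  define eta where "eta = g / r - 1/2"
  have A: "0 < A" "T < A" "a = - A" using assms(2,3) by (auto simp: A_def)
  have inv: "1 / a = - 1 / A" by (simp add: A_def)
  have al: "al \<noteq> 0" "0 < \<bar>al\<bar>" "\<bar>al\<bar> < 1/2" "\<bar>al\<bar> < \<beta>" "0 < \<beta>" using assms(15-17) by (auto simp: al_def)
  have Hal: "H - 1/2 \<noteq> 0" "0 < H" "H < 1" using assms(1) by auto
  have r: "0 < r" "r < 1" "\<bar>al\<bar> = r * \<beta>" using al by (auto simp: r_def)
  have g: "r / 2 < g" "g < 1/2" "0 < g" using r by (auto simp: g_def)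
  have "r * \<beta> < r * (1/2)" using r(1) assms(17) by (rule mult_strict_left_mono[rotated])
  then have al_g: "\<bar>al\<bar> < g" using r(3) g by simp
  have eta: "0 < eta" "g / r = 1/2 + eta" using r g by (auto simp: eta_def field_simps)
  define kap where "kap = regular_const g (- A) T"
  define G where "G = regular_event g (- A) T"
  have kap: "0 < kap"
    unfolding kap_def regular_const_def using A holder_factor_pos[OF g(3)] assms(2) by (intro add_pos_pos mult_pos_pos) auto
  \<comment> \<open>The first condition makes the tail \<open>n powr (- 2 * eta * m)\<close> of the
    Hoelder constant negligible against \<open>n powr (- q)\<close>; the second is what chaining
    over dyadic levels demands.\<close>
  obtain m :: nat where "max (q / eta) (2 / (1 - 2 * g)) \<le> real m" using real_arch_simple by blast
  then have m: "q \<le> eta * real m" "2 \<le> real m * (1 - 2 * g)" using eta g by (simp_all add: field_simps)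
  define C0 :: real where "C0 = 6 * (fact (2 * m) / (2 ^ m * fact m))"
  have A': "- A < 0" "- A < T" using A assms(2) by auto
  have G: "G lam \<in> sets M" "measure M (space M - G lam) \<le> C0 / lam ^ (2 * m)" if "0 < lam" for lam
    using regular_event_tail[OF g(3) m(2) A' that] by (auto simp: G_def C0_def)
  note Gh = regular_event_bounds(1)[OF _ g(3,2) A', folded G_def kap_def]
    and Gg = regular_event_bounds(2)[OF _ g(3,2) A', folded G_def kap_def]
  obtain N where N: "N \<in> null_sets M" and NS: "\<And>\<omega> g K t. \<omega> \<in> space M - N \<Longrightarrow> regular_path al A T g K (\<lambda>s. B s \<omega>) \<Longrightarrow>
      t \<in> {0..T} \<Longrightarrow> S t \<omega> = C_H * subfbm_functional al A t (\<lambda>s. B s \<omega>)"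
    using subfbm_version_eq_functional[OF assms(6) Hal assms(2) A(2)] unfolding al_def by blast
  define rate where "rate n = real n powr (- 1/2) * ln (real n) powr (5/2)" for n :: nat
  have rate0: "0 \<le> rate n" for n by (simp add: rate_def)
  have Bc: "continuous_on UNIV (\<lambda>s. B s \<omega>)" if "\<omega> \<in> space M" for \<omega> by (rule continuous_paths[OF that])
  have Z1r: "0 \<le> s \<Longrightarrow> 0 \<le> t \<Longrightarrow> \<bar>Z1 n s \<omega> - Z1 n t \<omega>\<bar> \<le> real n * \<bar>s - t\<bar>"
    if "1 \<le> n" "\<omega> \<in> space M" for n \<omega> s t
    using transport_process_regular[OF PM, of n "Z1 n"] assms(8) that by auto
  have Z2r: "s \<le> 0 \<Longrightarrow> t \<le> 0 \<Longrightarrow> \<bar>Z2 n s \<omega> - Z2 n t \<omega>\<bar> \<le> real n * \<bar>s - t\<bar>"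
    if "1 \<le> n" "\<omega> \<in> space M" for n \<omega> s t
    using transport_process_regular(2)[OF PM, of n "\<lambda>s. Z2 n (- s)" \<omega> "- s" "- t"] assms(9) that
    by (simp add: abs_minus_commute)
  have Z3r: "Z3 n 0 \<omega> = 0" "s \<le> 0 \<Longrightarrow> t \<le> 0 \<Longrightarrow> \<bar>Z3 n s \<omega> - Z3 n t \<omega>\<bar> \<le> real n * \<bar>s - t\<bar>"
    if "1 \<le> n" "\<omega> \<in> space M" for n \<omega> s t
    using transport_process_regular(1)[OF PM, of n "\<lambda>s. Z3 n (- s)" \<omega>]
      transport_process_regular(2)[OF PM, of n "\<lambda>s. Z3 n (- s)" \<omega> "- s" "- t"] assms(10) that
    by (simp_all add: abs_minus_commute)
  have Zm: "0 \<le> t \<Longrightarrow> Z1 n t \<in> borel_measurable M" "t \<le> 0 \<Longrightarrow> Z2 n t \<in> borel_measurable M"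
    "t \<le> 0 \<Longrightarrow> Z3 n t \<in> borel_measurable M" if "1 \<le> n" for n t
    using transport_process_regular(3)[OF PM, of n "Z1 n" t] transport_process_regular(3)[OF PM, of n "\<lambda>s. Z2 n (- s)" "- t"]
      transport_process_regular(3)[OF PM, of n "\<lambda>s. Z3 n (- s)" "- t"] assms(8-10) that by auto
  have Z1h: "holder_on 1 (real n) 0 T (\<lambda>s. Z1 n s \<omega>)" and Z2h: "holder_on 1 (real n) (- A) 0 (\<lambda>s. Z2 n s \<omega>)"
    and Z3h: "holder_on 1 (real n) (- 1 / A) 0 (\<lambda>s. Z3 n s \<omega>)" if "1 \<le> n" "\<omega> \<in> space M" for n \<omega>
    using Z1r[OF that] Z2r[OF that] Z3r(2)[OF that] by (auto simp: holder_on_def)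
  have A0: "- A < 0" "- 1 / A < 0" using A by auto
  have B_cont: "continuous_on X (\<lambda>s. B s \<omega>)" if "\<omega> \<in> space M" for \<omega> X
    by (rule continuous_on_subset[OF Bc[OF that]]) simp
  obtain C1 E1 where C1: "0 < C1" and E1: "\<And>n. 1 \<le> n \<Longrightarrow> E1 n \<in> sets M"
    "(\<lambda>n. measure M (E1 n)) \<in> o(\<lambda>n. real n powr (- q))"
    "\<And>n \<omega> t. \<omega> \<in> space M - E1 n \<Longrightarrow> t \<in> {0..T} \<Longrightarrow> \<bar>B t \<omega> - Z1 n t \<omega>\<bar> \<le> C1 * rate n"
    unfolding rate_def
  proof (rule transport_rate_events[OF assms(11,14,2), of "{0..T}"])
    show "continuous_on {0..T} (\<lambda>t. B t \<omega> - Z1 n t \<omega>)" if "1 \<le> n" "\<omega> \<in> space M" for n \<omega>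
      using holder_on_continuous[OF Z1h[OF that]] B_cont[OF that(2)] by (intro continuous_intros) auto
  qed (use measurable_B Zm in auto)
  obtain C2 E2 where E2: "\<And>n. 1 \<le> n \<Longrightarrow> E2 n \<in> sets M"
    "(\<lambda>n. measure M (E2 n)) \<in> o(\<lambda>n. real n powr (- q))"
    "\<And>n \<omega> t. \<omega> \<in> space M - E2 n \<Longrightarrow> t \<in> {- A..0} \<Longrightarrow> \<bar>B t \<omega> - Z2 n t \<omega>\<bar> \<le> C2 * rate n"
    unfolding rate_def
  proof (rule transport_rate_events[OF assms(12)[unfolded A(3)] assms(14) A0(1), of "{- A..0}"])
    show "continuous_on {- A..0} (\<lambda>t. B t \<omega> - Z2 n t \<omega>)" if "1 \<le> n" "\<omega> \<in> space M" for n \<omega>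
      using holder_on_continuous[OF Z2h[OF that]] B_cont[OF that(2)] by (intro continuous_intros) auto
  qed (use measurable_B Zm in auto)
  obtain C3 E3 where E3: "\<And>n. 1 \<le> n \<Longrightarrow> E3 n \<in> sets M"
    "(\<lambda>n. measure M (E3 n)) \<in> o(\<lambda>n. real n powr (- q))"
    "\<And>n \<omega> t. \<omega> \<in> space M - E3 n \<Longrightarrow> t \<in> {- 1 / A..0} \<Longrightarrow> \<bar>brownian_inversion B t \<omega> - Z3 n t \<omega>\<bar> \<le> C3 * rate n"
    unfolding rate_def
  \<comment> \<open>The time-inverted Brownian motion need not be continuous at 0 for every outcome,
    but there it vanishes together with the transport process.\<close>
  proof (rule transport_rate_events[OF assms(13)[unfolded inv] assms(14) A0(2), of "{- 1 / A..<0}"])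
    show "(\<lambda>\<omega>. brownian_inversion B t \<omega> - Z3 n t \<omega>) \<in> borel_measurable M" if "1 \<le> n" "t \<in> {- 1 / A..0}" for n t
      using measurable_B[of "1 / t"] Zm(3)[OF that(1), of t] that by (cases "t = 0") (auto simp: brownian_inversion_def)
    show "continuous_on {- 1 / A..<0} (\<lambda>t. brownian_inversion B t \<omega> - Z3 n t \<omega>)" if w: "1 \<le> n" "\<omega> \<in> space M" for n \<omega>
    proof -
      have "continuous_on {- 1 / A..<0} (\<lambda>t. t * B (1 / t) \<omega> - Z3 n t \<omega>)"
        using holder_on_continuous[OF Z3h[OF w]]
        by (intro continuous_intros continuous_on_compose2[OF Bc[OF w(2)]]) (auto intro: continuous_on_subset)
      then show ?thesis by (rule continuous_on_eq) (auto simp: brownian_inversion_def)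
    qed
  qed (use Z3r(1) in \<open>auto simp: brownian_inversion_def\<close>)
  define Cm where "Cm = max C1 (max C2 C3)"
  define G' where "G' n = space M - G (real n powr eta)" for n :: nat
  define Bad where "Bad n = E1 n \<union> E2 n \<union> E3 n \<union> G' n \<union> N" for n
  let ?rate = "\<lambda>n. real n powr (- (1/2 - \<beta>)) * ln (real n) powr (5/2)"
  have lamn: "0 < real n powr eta" if "1 \<le> n" for n using that by simp
  have G's: "G' n \<in> sets M" if "1 \<le> n" for n using G(1)[OF lamn[OF that]] by (auto simp: G'_def)
  define Cfin where "Cfin = C_H * (error_const al A T g * (Cm + kap))"
  have ec: "0 < error_const al A T g"
    unfolding error_const_def f_end_const_def using al_g tail_const_nonneg[of T al A] assms(2)
    by (intro add_pos_nonneg mult_nonneg_nonneg add_nonneg_nonneg) (auto intro!: divide_nonneg_nonneg add_nonneg_nonneg)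
  have Cfin: "0 < Cfin" using ec kap C1 assms(5) by (auto simp: Cfin_def Cm_def less_max_iff_disj intro!: mult_pos_pos add_pos_pos)
  define en where "en n = real n powr (- \<beta> / \<bar>al\<bar>)" for n :: nat
  have en_lim: "en \<longlonglongrightarrow> 0"
    unfolding en_def using al by (intro tendsto_neg_powr filterlim_real_sequentially) auto
  have "\<forall>\<^sub>F n in sequentially. en n < 1" "\<forall>\<^sub>F n in sequentially. en n < A - T" "\<forall>\<^sub>F n in sequentially. en n < 1 / A"
    using A by (auto intro!: order_tendstoD(2)[OF en_lim])
  moreover have "\<forall>\<^sub>F n in sequentially. 1 \<le> ln (real n)"
    using filterlim_compose[OF ln_at_top filterlim_real_sequentially] by (auto simp: filterlim_at_top)
  ultimately have large: "\<forall>\<^sub>F n in sequentially. 3 \<le> n \<and> en n < 1 \<and> en n < A - T \<and> en n < 1 / A \<and> 1 \<le> ln (real n)"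
    using eventually_ge_at_top[of 3] by eventually_elim auto
  have main: "\<bar>S t \<omega> - S_approx C_H H a \<beta> Z1 Z2 Z3 n t \<omega>\<bar> \<le> Cfin * ?rate n"
    if n: "3 \<le> n \<and> en n < 1 \<and> en n < A - T \<and> en n < 1 / A \<and> 1 \<le> ln (real n)"
      and w: "\<omega> \<in> space M - Bad n" and t: "t \<in> {0..T}" for n \<omega> t
  proof -
    have n1: "1 \<le> n" using n by simp
    have ws: "\<omega> \<in> space M" and wN: "\<omega> \<in> space M - N" and wG: "\<omega> \<in> G (real n powr eta)"
      and wE: "\<omega> \<notin> E1 n" "\<omega> \<notin> E2 n" "\<omega> \<notin> E3 n" using w by (auto simp: Bad_def G'_def)
    let ?K = "kap * real n powr eta"
    have Cle: "C1 * rate n \<le> Cm * rate n" "C2 * rate n \<le> Cm * rate n" "C3 * rate n \<le> Cm * rate n"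
      using rate0[of n] by (auto simp: Cm_def intro!: mult_right_mono)
    have reg: "regular_path al A T g ?K (\<lambda>s. B s \<omega>)"
      by unfold_locales (use al al_g g A assms(2) Bc[OF ws] Gh[OF wG lamn[OF n1]] Gg[OF wG lamn[OF n1]] kap in \<open>auto simp: holder_on_def\<close>)
    have ap: "approximated_path al A T g ?K (\<lambda>s. B s \<omega>) (Cm * rate n) (en n) (\<lambda>s. Z1 n s \<omega>) (\<lambda>s. Z2 n s \<omega>) (\<lambda>s. Z3 n s \<omega>)
      (real n) (real n) (real n)"
    proof (intro approximated_path.intro approximated_path_axioms.intro reg Z1h Z2h Z3h Z3r(1) n1 ws)
      show "\<bar>B s \<omega> - Z1 n s \<omega>\<bar> \<le> Cm * rate n" if "s \<in> {0..T}" for s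
        using E1(3)[of \<omega> n s] wE(1) ws that Cle(1) by auto
      show "\<bar>B s \<omega> - Z2 n s \<omega>\<bar> \<le> Cm * rate n" if "s \<in> {- A..0}" for s
        using E2(3)[of \<omega> n s] wE(2) ws that Cle(2) by auto
      show "\<bar>s * B (1 / s) \<omega> - Z3 n s \<omega>\<bar> \<le> Cm * rate n" if s: "s \<in> {- 1 / A..<0}" for s
        using E3(3)[of \<omega> n s] wE(3) ws s Cle(3) by (simp add: brownian_inversion_def)
      show "0 < en n" using n1 by (simp add: en_def)
    qed (use n in auto)
    have eps: "eps H \<beta> n = - en n" by (simp add: eps_def en_def al_def)
    let ?W = "W_approx 1 H (- A) (- en n) (\<lambda>s. Z1 n s \<omega>) (\<lambda>s. Z2 n s \<omega>) (\<lambda>s. Z3 n s \<omega>) t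
      + Y_approx 1 H (- A) (- en n) (\<lambda>s. Z2 n s \<omega>) (\<lambda>s. Z3 n s \<omega>) t"
    have "S_approx C_H H a \<beta> Z1 Z2 Z3 n t \<omega> = C_H * ?W"
      by (simp only: S_approx_def eps A(3) W_approx_def Y_approx_def distrib_left split: if_split) simp
    then have "\<bar>S t \<omega> - S_approx C_H H a \<beta> Z1 Z2 Z3 n t \<omega>\<bar> = C_H * \<bar>subfbm_functional al A t (\<lambda>s. B s \<omega>) - ?W\<bar>"
      using NS[OF wN reg t] assms(5) by (simp add: right_diff_distrib[symmetric] abs_mult)
    also have "\<dots> \<le> C_H * (error_const al A T g * (Cm * rate n * en n powr (- \<bar>al\<bar>) + ?K * en n powr (g - \<bar>al\<bar>)))"
      using approximated_path.approximation_error[OF ap al_def, of t] t assms(5) by (intro mult_left_mono) auto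
    also have "\<dots> \<le> C_H * (error_const al A T g * (Cm * ?rate n
       + kap * ?rate n))"
    proof (intro mult_left_mono add_mono)
      have "en n powr (- \<bar>al\<bar>) = real n powr \<beta>" using al by (simp add: en_def powr_powr)
      then have "rate n * en n powr (- \<bar>al\<bar>) = real n powr (- 1/2) * real n powr \<beta> * ln (real n) powr (5/2)"
        by (simp add: rate_def)
      also have "real n powr (- 1/2) * real n powr \<beta> = real n powr (- (1/2 - \<beta>))"
        by (simp add: powr_add[symmetric])
      finally show "Cm * rate n * en n powr (- \<bar>al\<bar>) \<le> Cm * ?rate n"
        by (simp only: mult.assoc order_refl)
      \<comment> \<open>By the choice of \<open>eta\<close>, the Hoelder constant times the
        truncation error is exactly the target power of \<open>n\<close>; the logarithm, at least 1
        here, then only enlarges the right-hand side.\<close>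
      have "eta + (- \<beta> / \<bar>al\<bar>) * (g - \<bar>al\<bar>) = eta - g / r + \<beta>"
        using r al by (simp add: r(3) field_simps)
      also have "\<dots> = - (1/2 - \<beta>)" using eta by simp
      finally have "real n powr eta * en n powr (g - \<bar>al\<bar>) = real n powr (- (1/2 - \<beta>))"
        by (simp add: en_def powr_powr powr_add[symmetric])
      also have "\<dots> \<le> ?rate n"
        using n ge_one_powr_ge_zero[of "ln (real n)" "5/2"] by (simp add: mult_le_cancel_left1)
      finally have "real n powr eta * en n powr (g - \<bar>al\<bar>) \<le> ?rate n" .
      from mult_left_mono[OF this, of kap] kap
      show "?K * en n powr (g - \<bar>al\<bar>) \<le> kap * ?rate n"
        by (simp add: mult.assoc)
    qed (use ec assms(5) in auto)
    also have "\<dots> = Cfin * ?rate n"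
      by (simp add: Cfin_def algebra_simps)
    finally show ?thesis .
  qed
  let ?h = "\<lambda>n. measure M (E1 n) + measure M (E2 n) + measure M (E3 n) + \<bar>C0\<bar> * real n powr (- (eta * real (2 * m)))"
  have bound: "\<forall>\<^sub>F n in sequentially. norm (sup_exceed_prob M {0..T} S (S_approx C_H H a \<beta> Z1 Z2 Z3 n)
      (Cfin * real n powr (- (1/2 - \<beta>)) * ln (real n) powr (5/2))) \<le> 1 * norm (?h n)"
    using large
  proof eventually_elim
    case (elim n)
    then have n1: "1 \<le> n" by simp
    note s = E1(1)[OF n1] E2(1)[OF n1] E3(1)[OF n1] G's[OF n1]
    have "sup_exceed_prob M {0..T} S (S_approx C_H H a \<beta> Z1 Z2 Z3 n)
      (Cfin * real n powr (- (1/2 - \<beta>)) * ln (real n) powr (5/2)) \<le> measure M (Bad n)"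
      by (rule sup_exceed_prob_le[OF PM]) (use s N main[OF elim] in \<open>auto simp: Bad_def mult.assoc\<close>)
    also have "\<dots> = measure M (E1 n \<union> E2 n \<union> E3 n \<union> G' n)"
      unfolding Bad_def using s N by (intro measure_Un_null_set) auto
    also have "\<dots> \<le> measure M (E1 n) + measure M (E2 n) + measure M (E3 n) + measure M (G' n)"
      using s by (intro order_trans[OF measure_Un_le] add_mono order_refl) auto
    also have "measure M (G' n) \<le> \<bar>C0\<bar> * real n powr (- (eta * real (2 * m)))"
    proof -
      have "measure M (G' n) \<le> C0 / (real n powr eta) ^ (2 * m)" unfolding G'_def by (rule G(2)[OF lamn[OF n1]])
      also have "\<dots> \<le> \<bar>C0\<bar> / (real n powr eta) ^ (2 * m)" by (intro divide_right_mono) auto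
      also have "(real n powr eta) ^ (2 * m) = real n powr (eta * real (2 * m))"
        using n1 by (simp add: powr_power mult_ac)
      finally show ?thesis by (simp add: powr_minus_divide)
    qed
    finally show ?case by (simp add: sup_exceed_prob_def)
  qed
  have "q < eta * real (2 * m)"
    using m(1) assms(14) by simp
  then have "?h \<in> o(\<lambda>n. real n powr (- q))"
    by (intro sum_in_smallo(1) E1(2) E2(2) E3(2) powr_mult_smallo)
  with bigoI[OF bound] have "(\<lambda>n. sup_exceed_prob M {0..T} S (S_approx C_H H a \<beta> Z1 Z2 Z3 n)
      (Cfin * real n powr (- (1/2 - \<beta>)) * ln (real n) powr (5/2))) \<in> o(\<lambda>n. real n powr (- q))"
    by (rule landau_o.big_small_trans)
  with Cfin show ?thesis by blast
qed

end
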